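(* Let $0<|q|\neq1$ and $\lambda\in\mathbb{Z}$, and let $W_\lambda(q)=\big(H_{\lambda+i,j}(q)\big)_{0\le i,j\le5}$ (row index $i$, column index $j$), with $H_{\lambda,j}$ as in the context. Then $$\det(W_\lambda(q))=32\,q^{\lambda+\frac{11}{4}},$$ and $$ W_\lambda(q)\begin{pmatrix} 0&0&\frac12&0&0&0\\ 0&1&0&0&0&0\\ \frac12&0&0&0&0&0\\ 0&0&0&-1&0&0\\ 0&0&0&0&\frac14&0\\ 0&0&0&0&0&-1 \end{pmatrix}W_{-\lambda-5}(q^{-1})^T=\begin{pmatrix} -12&8&-4&2&0&0\\ 8&-4&2&0&0&0\\ -4&2&0&0&0&2\\ 2&0&0&0&2&-4\\ 0&0&0&2&-4&8+2q^{\lambda+2}\\ 0&0&2&-4&8+2q^{\lambda+3}&-12-4q^{\lambda+2}-4q^{\lambda+3} \end{pmatrix}. $$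
   Context: $(a;q)_m=\prod_{i=0}^{m-1}(1-aq^i)$. Write $q=e^{2\pi i\tau}$; fractional powers mean $q^{r}=e^{2\pi i r\tau}$ (and $(q^{-1})^r=q^{-r}$). For $|q|<1$ put $$E_l^{(m)}(q)=\sum_{s\ge1}\frac{s^{l-1}q^{s(m+1)}}{1-q^s},\qquad \mathcal{E}_2(q)=1-24\sum_{n\ge1}\frac{q^n}{(1-q^n)^2}.$$ For $|q|<1$, $\lambda\in\mathbb{Z}$ and $j=0,1,2$, $$H^+_{\lambda,j}(q)=(-1)^\lambda\sum_{m\ge0}\frac{q^{m(2m+1)+\lambda m}}{(q;q)_m^2(q;q)_{2m}}\,p_{\lambda,j,m}(q),\qquad H^-_{\lambda,j}(q)=(-1)^\lambda\sum_{n\ge0}\frac{q^{n(n+1)+\lambda n}}{(q;q)_n^2(q;q)_{2n}}\,P_{\lambda,j,n}(q),$$ where $p_{\lambda,0,m}=P_{\lambda,0,n}=1$, $$p_{\lambda,1,m}=4m+\lambda+1-2E_1^{(m)}-2E_1^{(2m)},\qquad p_{\lambda,2,m}=p_{\lambda,1,m}^2-2E_2^{(m)}-4E_2^{(2m)}-\tfrac13\mathcal{E}_2,$$ $$P_{\lambda,1,n}=2n+\lambda+1-2E_1^{(n)}-2E_1^{(2n)},\qquad P_{\lambda,2,n}=P_{\lambda,1,n}^2+12E_2^{(0)}-\tfrac12-2E_2^{(n)}-4E_2^{(2n)}+\tfrac13\mathcal{E}_2 .$$ For $j=3,4,5$, $$H^+_{\lambda,3}=\frac{(-1)^\lambda q^{1/8}}{(1-q^{1/2})^2}\sum_{m\ge0}\frac{q^{(2m+1)(m+1)+\lambda(m+1/2)}}{(q^{3/2};q)_m^2(q;q)_{2m+1}},\qquad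 H^-_{\lambda,3}=\frac{(-1)^\lambda q^{-1/8}}{(1-q^{-1/2})^2}\sum_{n\ge0}\frac{q^{n(n+2)+\lambda(n+1/2)}}{(q^{3/2};q)_n^2(q;q)_{2n+1}},$$ $$H^+_{\lambda,4}=\sum_{m\ge0}\frac{q^{(2m+1)m+\lambda m}}{(-q;q)_m^2(q;q)_{2m}},\qquad H^-_{\lambda,4}=\sum_{n\ge0}\frac{q^{n(n+1)+\lambda n}}{(-q;q)_n^2(q;q)_{2n}},$$ $$H^+_{\lambda,5}=\frac{q^{1/8}}{(1+q^{1/2})^2}\sum_{m\ge0}\frac{q^{(2m+1)(m+1)+\lambda(m+1/2)}}{(-q^{3/2};q)_m^2(q;q)_{2m+1}},\qquad H^-_{\lambda,5}=\frac{q^{-1/8}}{(1+q^{-1/2})^2}\sum_{n\ge0}\frac{q^{n(n+2)+\lambda(n+1/2)}}{(-q^{3/2};q)_n^2(q;q)_{2n+1}}.$$ With $\delta=(\delta_0,\dots,\delta_5)=(0,1,2,0,0,0)$ set $H_{\lambda,j}(q)=H^+_{\lambda,j}(q)$ if $|q|<1$ and $H_{\lambda,j}(q)=(-1)^{\delta_j}H^-_{-\lambda,j}(q^{-1})$ if $|q|>1$. *)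

theory Defs
  imports Complex_Main "Jordan_Normal_Form.Determinant"
begin

text \<open>
  Since half- and quarter-integral powers of $q$ occur, everything is a function of $\tau$ with
  $q = e^{2 \pi i \tau}$. Replacing $q$ by $q^{-1}$, with the convention $(q^{-1})^r = q^{-r}$,
  is replacing $\tau$ by $-\tau$.
\<close>

definition nome :: "complex \<Rightarrow> complex" where
  "nome \<tau> = exp (2 * of_real pi * \<i> * \<tau>)"

definition qpow :: "complex \<Rightarrow> real \<Rightarrow> complex" where
  "qpow \<tau> r = exp (2 * of_real pi * \<i> * of_real r * \<tau>)"

definition qpoch :: "complex \<Rightarrow> complex \<Rightarrow> nat \<Rightarrow> complex" where
  "qpoch a q m = (\<Prod>i<m. 1 - a * q ^ i)"

text \<open>The series below run over $s \ge 1$ (resp. $n \ge 1$), hence the \<open>Suc\<close>.\<close>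

definition E_series :: "nat \<Rightarrow> nat \<Rightarrow> complex \<Rightarrow> complex" where
  "E_series k m q =
     (\<Sum>s. of_nat (Suc s) ^ (k - 1) * q ^ (Suc s * (m + 1)) / (1 - q ^ Suc s))"

definition calE2 :: "complex \<Rightarrow> complex" where
  "calE2 q = 1 - 24 * (\<Sum>n. q ^ Suc n / (1 - q ^ Suc n)\<^sup>2)"

definition p_one :: "int \<Rightarrow> nat \<Rightarrow> complex \<Rightarrow> complex" where
  "p_one l m q = of_int (4 * int m + l + 1) - 2 * E_series 1 m q - 2 * E_series 1 (2 * m) q"

definition p_two :: "int \<Rightarrow> nat \<Rightarrow> complex \<Rightarrow> complex" where
  "p_two l m q =
     (p_one l m q)\<^sup>2 - 2 * E_series 2 m q - 4 * E_series 2 (2 * m) q - 1 / 3 * calE2 q"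

definition P_one :: "int \<Rightarrow> nat \<Rightarrow> complex \<Rightarrow> complex" where
  "P_one l n q = of_int (2 * int n + l + 1) - 2 * E_series 1 n q - 2 * E_series 1 (2 * n) q"

definition P_two :: "int \<Rightarrow> nat \<Rightarrow> complex \<Rightarrow> complex" where
  "P_two l n q =
     (P_one l n q)\<^sup>2 + 12 * E_series 2 0 q - 1 / 2
       - 2 * E_series 2 n q - 4 * E_series 2 (2 * n) q + 1 / 3 * calE2 q"

definition p_fun :: "int \<Rightarrow> nat \<Rightarrow> nat \<Rightarrow> complex \<Rightarrow> complex" where
  "p_fun l j m q = (if j = 0 then 1 else if j = 1 then p_one l m q else p_two l m q)"

definition P_fun :: "int \<Rightarrow> nat \<Rightarrow> nat \<Rightarrow> complex \<Rightarrow> complex" where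
  "P_fun l j n q = (if j = 0 then 1 else if j = 1 then P_one l n q else P_two l n q)"

text \<open>
  In the following two definitions only \<open>j \<le> 5\<close> and $|q| < 1$ matter.
\<close>

definition H_plus :: "int \<Rightarrow> nat \<Rightarrow> complex \<Rightarrow> complex" where
  "H_plus l j \<tau> = (let q = nome \<tau> in
     if j \<le> 2 then
       (-1) powi l *
         (\<Sum>m. q powi (int m * (2 * int m + 1) + l * int m)
               / ((qpoch q q m)\<^sup>2 * qpoch q q (2 * m)) * p_fun l j m q)
     else if j = 3 then
       (-1) powi l * qpow \<tau> (1/8) / (1 - qpow \<tau> (1/2))\<^sup>2 *
         (\<Sum>m. qpow \<tau> ((2 * real m + 1) * (real m + 1) + of_int l * (real m + 1/2))
               / ((qpoch (qpow \<tau> (3/2)) q m)\<^sup>2 * qpoch q q (2 * m + 1)))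
     else if j = 4 then
       (\<Sum>m. q powi ((2 * int m + 1) * int m + l * int m)
             / ((qpoch (- q) q m)\<^sup>2 * qpoch q q (2 * m)))
     else if j = 5 then
       qpow \<tau> (1/8) / (1 + qpow \<tau> (1/2))\<^sup>2 *
         (\<Sum>m. qpow \<tau> ((2 * real m + 1) * (real m + 1) + of_int l * (real m + 1/2))
               / ((qpoch (- qpow \<tau> (3/2)) q m)\<^sup>2 * qpoch q q (2 * m + 1)))
     else 0)"

definition H_minus :: "int \<Rightarrow> nat \<Rightarrow> complex \<Rightarrow> complex" where
  "H_minus l j \<tau> = (let q = nome \<tau> in
     if j \<le> 2 then
       (-1) powi l *
         (\<Sum>n. q powi (int n * (int n + 1) + l * int n)
               / ((qpoch q q n)\<^sup>2 * qpoch q q (2 * n)) * P_fun l j n q)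
     else if j = 3 then
       (-1) powi l * qpow \<tau> (-1/8) / (1 - qpow \<tau> (-1/2))\<^sup>2 *
         (\<Sum>n. qpow \<tau> (real n * (real n + 2) + of_int l * (real n + 1/2))
               / ((qpoch (qpow \<tau> (3/2)) q n)\<^sup>2 * qpoch q q (2 * n + 1)))
     else if j = 4 then
       (\<Sum>n. q powi (int n * (int n + 1) + l * int n)
             / ((qpoch (- q) q n)\<^sup>2 * qpoch q q (2 * n)))
     else if j = 5 then
       qpow \<tau> (-1/8) / (1 + qpow \<tau> (-1/2))\<^sup>2 *
         (\<Sum>n. qpow \<tau> (real n * (real n + 2) + of_int l * (real n + 1/2))
               / ((qpoch (- qpow \<tau> (3/2)) q n)\<^sup>2 * qpoch q q (2 * n + 1)))
     else 0)"

definition H_delta :: "nat \<Rightarrow> nat" where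
  "H_delta j = [0, 1, 2, 0, 0, 0] ! j"

text \<open>The second branch is meant for $|q| > 1$; the value for $|q| = 1$ is immaterial.\<close>

definition H_fun :: "int \<Rightarrow> nat \<Rightarrow> complex \<Rightarrow> complex" where
  "H_fun l j \<tau> =
     (if cmod (nome \<tau>) < 1 then H_plus l j \<tau>
      else (-1) ^ H_delta j * H_minus (- l) j (- \<tau>))"

definition W_mat :: "int \<Rightarrow> complex \<Rightarrow> complex mat" where
  "W_mat l \<tau> = mat 6 6 (\<lambda>(i, j). H_fun (l + int i) j \<tau>)"

end

theory Submission
  imports Defs "HOL-Complex_Analysis.Complex_Analysis"
begin

text \<open>
  Let $|q| < 1$ and put $s = q^{1/2}$. Up to elementary prefactors every column comes from one pair of
  series,
  \[ U_a(x) = \sum_m (x q^m)^a \frac{x^{4m} q^{m(2m+1)}}{(qx;q)_m^2 (qx^2;q)_{2m}}, \qquad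
     V_b(x) = \sum_n (x q^n)^b \frac{x^{2n} q^{n(n+1)}}{(qx;q)_n^2 (qx^2;q)_{2n}}, \]
  at one of the points $x = 1, -1, s, -s$. Consecutive denominators of $U_a$ differ by
  $(1-z)^2 (1-z^2) (1-z^2/q)$ with $z = x q^m$, a polynomial of degree six whose roots are these four
  points. The root 1 is triple, so it carries three columns: the Taylor coefficients of $U$ and $V$ in
  $\log x$, and this is where the Lambert series come from.

  The bilinear relation. The entries of the matrix product are values of one bilinear form $B(a,b)$
  in $H^+_{a,j}$ and $H^-_{b,j}$, with $a - b = i + k - 5$. Multiply the series out and collect the
  terms with $m + n = N$ (with $m + n = N - 1$ at $x = s$ and $x = -s$). In terms of $z = x q^m$ all
  factors of the two denominators merge into one rational function,
  \[ R_N(z) = \frac{z^{4N+1+d}}{\prod_{j \le N} (z - q^j)^2 \prod_{k \le 2N} (z^2 - q^k)}, \qquad d = a - b, \]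
  and for $N \ge 1$ the coefficient of $q^{bN}$ in $B(a,b)$ is $2 (-1)^d q^{N^2+N}$ times the sum of all residues of
  $R_N$: the points $q^m$ are triple poles and give the first three columns, the points $-q^m$ and
  $\pm s q^m$ are simple poles and give the other three. The residue theorem turns the sum into the
  behaviour of $R_N$ at infinity. For $|d| \le 5$ it vanishes unless $N = 1$ and $d = 4$
  or $d = 5$; the term $N = 0$ is elementary. This is \<open>bilinear_form_eq\<close>. If $|q| > 1$ the two kinds
  of series exchange their roles and the same form is evaluated at $q^{-1}$.

  The determinant. The degree six polynomial above is also the symbol of a recurrence of order six in
  $\lambda$ (\<open>H_plus_recurrence\<close>); hence $\det W_{\lambda+1} = q \det W_\lambda$. As
  $\lambda \to +\infty$ only the terms $m = 0$ survive, and after explicit column operations $W_\lambda$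
  tends to a confluent Vandermonde matrix with nodes $-1$ (three times), $-s$, 1 and $s$, which fixes the
  constant (\<open>det_W_disc\<close>). For $|q| > 1$ the determinant follows by taking determinants in the bilinear
  relation.
\<close>

section \<open>Residue sums and second derivatives of products\<close>

text \<open>
  On a large circle $f(z)$ differs from $L/z$ by $o(1/|z|)$, so the two contour integrals agree in the
  limit, while the residue theorem says that the integral of $f$ does not depend on the circle.
\<close>

lemma sum_residues_eq_limit_at_infinity:
  fixes f :: "complex \<Rightarrow> complex"
  assumes fin: "finite S" and holo: "f holomorphic_on (UNIV - S)"
    and lim: "((\<lambda>z. z * f z) \<longlongrightarrow> L) at_infinity"
  shows "(\<Sum>p\<in>S. residue f p) = L"
proof -
  define T where "T = (\<Sum>p\<in>S. residue f p)"
  have "norm (T - L) \<le> e" if "e > 0" for e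
  proof -
    from lim \<open>e > 0\<close> have "eventually (\<lambda>z. dist (z * f z) L < e) at_infinity"
      by (rule tendstoD)
    then obtain b where b: "\<And>z. norm z \<ge> b \<Longrightarrow> norm (z * f z - L) < e"
      by (auto simp: eventually_at_infinity dist_norm)
    obtain B where B: "\<And>p. p \<in> S \<Longrightarrow> norm p \<le> B"
      using finite_imp_bounded[OF fin] by (auto simp: bounded_iff)
    \<comment> \<open>A circle that encloses all poles and on which the bound holds.\<close>
    define r where "r = Max {1, b, B + 1}"
    have r: "r \<ge> 1" "r \<ge> b" "r \<ge> B + 1" by (auto simp: r_def)
    have inball: "p \<in> ball 0 r" if "p \<in> S" for p
      using B[OF that] r by auto
    have path: "path_image (circlepath 0 r) \<subseteq> UNIV - S"
      using inball r by (auto simp: sphere_def)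
    have "contour_integral (circlepath 0 r) f
        = 2 * pi * \<i> * (\<Sum>p\<in>S. winding_number (circlepath 0 r) p * residue f p)"
      by (rule Residue_theorem[where S = UNIV]) (use fin holo path in auto)
    also have "(\<Sum>p\<in>S. winding_number (circlepath 0 r) p * residue f p) = T"
      unfolding T_def using inball by (intro sum.cong refl) (simp add: winding_number_circlepath)
    finally have ci: "contour_integral (circlepath 0 r) f = 2 * pi * \<i> * T" .
    have "f contour_integrable_on circlepath 0 r"
      by (rule contour_integrable_continuous_circlepath)
         (rule holomorphic_on_imp_continuous_on[OF holomorphic_on_subset[OF holo path]])
    then have 1: "(f has_contour_integral (2 * pi * \<i> * T)) (circlepath 0 r)"
      using ci has_contour_integral_integral by metis
    have 2: "((\<lambda>z. L / (z - 0)) has_contour_integral (2 * pi * \<i> * L)) (circlepath 0 r)"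
      using Cauchy_integral_circlepath_simple[of "\<lambda>_. L" 0 r 0] r by simp
    have "norm (2 * pi * \<i> * T - 2 * pi * \<i> * L) \<le> e / r * (2 * pi * r)"
    proof (rule has_contour_integral_bound_circlepath[OF has_contour_integral_diff[OF 1 2]])
      fix x :: complex assume "norm (x - 0) = r"
      then have x: "norm x = r" "x \<noteq> 0" using r by auto
      have "f x - L / (x - 0) = (x * f x - L) / x" using x by (simp add: field_simps)
      then show "norm (f x - L / (x - 0)) \<le> e / r"
        using b[of x] x r by (simp add: norm_divide divide_right_mono)
    qed (use r \<open>e > 0\<close> in auto)
    also have "2 * pi * \<i> * T - 2 * pi * \<i> * L = 2 * pi * \<i> * (T - L)"
      by (simp add: algebra_simps)
    finally show ?thesis using r by (simp add: norm_mult)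
  qed
  then have "norm (T - L) \<le> 0" using field_le_epsilon[of "norm (T - L)" 0] by simp
  then show ?thesis by (simp add: T_def)
qed

lemma has_log_derivative_prod:
  fixes f l :: "'i \<Rightarrow> complex \<Rightarrow> complex"
  assumes "\<And>i. i \<in> I \<Longrightarrow> (f i has_field_derivative f i w * l i w) (at w)"
  shows "((\<lambda>w. \<Prod>i\<in>I. f i w) has_field_derivative (\<Prod>i\<in>I. f i w) * (\<Sum>i\<in>I. l i w)) (at w)"
  using assms
proof (induction I rule: infinite_finite_induct)
  case (insert i I)
  show ?case
    using DERIV_mult[OF insert.prems[of i] insert.IH[OF insert.prems]] insert.hyps
    by (simp add: algebra_simps)
qed auto

text \<open>
  Residues at triple poles need a second derivative of a long product. Its logarithmic derivative is a
  short sum, and $f'' = f (l^2 + l')$ when $f' = f l$.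
\<close>

lemma second_deriv_from_log_derivative:
  fixes f l :: "complex \<Rightarrow> complex"
  assumes "open U" "y \<in> U"
    and f: "\<And>w. w \<in> U \<Longrightarrow> (f has_field_derivative f w * l w) (at w)"
    and l: "(l has_field_derivative l') (at y)"
  shows "(deriv ^^ 2) f y = f y * ((l y)\<^sup>2 + l')"
proof -
  have "deriv (deriv f) y = deriv (\<lambda>w. f w * l w) y"
  proof (rule deriv_cong_ev)
    show "\<forall>\<^sub>F w in nhds y. deriv f w = f w * l w"
      using eventually_nhds_in_open[OF assms(1,2)]
      by (rule eventually_mono) (rule DERIV_imp_deriv[OF f])
  qed simp
  also have "\<dots> = f y * ((l y)\<^sup>2 + l')"
    by (rule DERIV_imp_deriv)
       (use DERIV_mult[OF f[OF \<open>y \<in> U\<close>] l] in \<open>simp add: algebra_simps power2_eq_square\<close>)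
  finally show ?thesis by (simp add: numeral_2_eq_2)
qed

section \<open>The kernel and the sum of its residues\<close>

text \<open>
  Both $q$ and a fixed square root of it are parameters, because the poles of the kernel are the
  numbers $\pm s^k$.
\<close>

locale punctured_disc =
  fixes s q :: complex
  assumes s_nz: "s \<noteq> 0" and norm_s: "norm s < 1" and q_eq: "q = s\<^sup>2"
begin

lemma q_nz: "q \<noteq> 0" and norm_q: "norm q < 1"
  using s_nz norm_s by (auto simp: q_eq norm_power power_less_one_iff)

lemma q_power: "q ^ k = s ^ (2 * k)"
  by (simp add: q_eq power_mult)

text \<open>
  Powers of $s$ have pairwise different moduli, so the poles $\pm s^k$ are distinct.
\<close>

lemma s_power_inj: "s ^ k = s ^ j \<longleftrightarrow> k = j"
proof
  assume "s ^ k = s ^ j"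
  then have "norm s ^ k = norm s ^ j" by (metis norm_power)
  then show "k = j" using s_nz norm_s
    by (metis power_strict_decreasing_iff zero_less_norm_iff nat_neq_iff order_less_irrefl)
qed simp

lemma s_power_neq_minus: "s ^ k \<noteq> - (s ^ j)"
proof
  assume *: "s ^ k = - (s ^ j)"
  then have "norm s ^ k = norm s ^ j" by (metis norm_power norm_minus_cancel)
  then have "k = j" using s_nz norm_s
    by (metis power_strict_decreasing_iff zero_less_norm_iff nat_neq_iff order_less_irrefl)
  then show False using * s_nz by auto
qed

lemma q_power_inj: "q ^ k = q ^ j \<longleftrightarrow> k = j"
  unfolding q_power s_power_inj by simp

definition kernel_denom :: "nat \<Rightarrow> complex \<Rightarrow> complex" where
  "kernel_denom N z = (\<Prod>j\<le>N. (z - q ^ j)\<^sup>2) * (\<Prod>k\<le>2*N. z\<^sup>2 - q ^ k)"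

definition kernel_poles :: "nat \<Rightarrow> complex set" where
  "kernel_poles N = (\<lambda>k. s ^ k) ` {..2*N} \<union> (\<lambda>k. - (s ^ k)) ` {..2*N}"

lemma sq_minus_q_power: "z\<^sup>2 - q ^ k = (z - s ^ k) * (z + s ^ k)"
  by (simp add: q_power power_mult mult.commute[of 2] power2_eq_square algebra_simps)

lemma kernel_denom_nz: "kernel_denom N z \<noteq> 0" if "z \<notin> kernel_poles N"
proof -
  have "z \<noteq> q ^ j" if "j \<le> N" for j
    using \<open>z \<notin> kernel_poles N\<close> that by (auto simp: kernel_poles_def q_power)
  moreover have "z\<^sup>2 \<noteq> q ^ k" if "k \<le> 2 * N" for k
  proof -
    have "z \<noteq> s ^ k" "z \<noteq> - (s ^ k)"
      using \<open>z \<notin> kernel_poles N\<close> that by (auto simp: kernel_poles_def)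
    then have "z\<^sup>2 - q ^ k \<noteq> 0"
      unfolding sq_minus_q_power by (simp add: add_eq_0_iff2)
    then show ?thesis by simp
  qed
  ultimately show ?thesis by (simp add: kernel_denom_def)
qed

text \<open>
  Even powers of $s$ are the integral powers of $q$, odd powers the half-integral ones; these two kinds
  of poles belong to different columns of the matrix.
\<close>

lemma sum_kernel_poles:
  "(\<Sum>p\<in>kernel_poles N. f p) =
     (\<Sum>m\<le>N. f (q ^ m) + f (- (q ^ m))) + (\<Sum>m<N. f (s * q ^ m) + f (- (s * q ^ m)) :: complex)"
proof -
  have "(\<Sum>p\<in>kernel_poles N. f p) =
      (\<Sum>p\<in>(\<lambda>k. s ^ k) ` {..2*N}. f p) + (\<Sum>p\<in>(\<lambda>k. - (s ^ k)) ` {..2*N}. f p)"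
    unfolding kernel_poles_def using s_power_neq_minus by (intro sum.union_disjoint) auto
  also have "\<dots> = (\<Sum>k\<le>2*N. f (s ^ k)) + (\<Sum>k\<le>2*N. f (- (s ^ k)))"
    by (subst (1 2) sum.reindex) (auto simp: inj_on_def s_power_inj)
  also have "\<dots> = (\<Sum>k\<le>2*N. f (s ^ k) + f (- (s ^ k)))"
    by (simp add: sum.distrib)
  also have "\<dots> = (\<Sum>m\<le>N. f (q ^ m) + f (- (q ^ m))) + (\<Sum>m<N. f (s * q ^ m) + f (- (s * q ^ m)))"
    by (induction N) (simp_all add: q_power algebra_simps power2_eq_square)
  finally show ?thesis .
qed

text \<open>
  The denominator in the coordinate $u = 1/z$, with its pole at $u = 0$ removed.
\<close>

definition rev_denom :: "nat \<Rightarrow> complex \<Rightarrow> complex" where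
  "rev_denom N u = (\<Prod>j\<le>N. (1 - q ^ j * u)\<^sup>2) * (\<Prod>k\<le>2*N. 1 - q ^ k * u\<^sup>2)"

lemma kernel_denom_inverse:
  assumes "u \<noteq> 0"
  shows "kernel_denom N (inverse u) = rev_denom N u / u ^ (6 * N + 4)"
proof -
  have 1: "(\<Prod>j\<le>N. (inverse u - q ^ j)\<^sup>2) = (\<Prod>j\<le>N. (1 - q ^ j * u)\<^sup>2) / u ^ (2 * (N + 1))"
  proof -
    have "(\<Prod>j\<le>N. (inverse u - q ^ j)\<^sup>2) = (\<Prod>j\<le>N. (1 - q ^ j * u)\<^sup>2 / u\<^sup>2)"
      using assms by (intro prod.cong refl) (simp add: field_simps power2_eq_square)
    also have "\<dots> = (\<Prod>j\<le>N. (1 - q ^ j * u)\<^sup>2) / u ^ (2 * (N + 1))"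
      by (simp only: prod_dividef prod_constant card_atMost power_mult Suc_eq_plus1)
    finally show ?thesis .
  qed
  have 2: "(\<Prod>k\<le>2*N. (inverse u)\<^sup>2 - q ^ k) = (\<Prod>k\<le>2*N. 1 - q ^ k * u\<^sup>2) / u ^ (2 * (2 * N + 1))"
  proof -
    have "(\<Prod>k\<le>2*N. (inverse u)\<^sup>2 - q ^ k) = (\<Prod>k\<le>2*N. (1 - q ^ k * u\<^sup>2) / u\<^sup>2)"
      using assms by (intro prod.cong refl) (simp add: field_simps power2_eq_square)
    also have "\<dots> = (\<Prod>k\<le>2*N. 1 - q ^ k * u\<^sup>2) / u ^ (2 * (2 * N + 1))"
      by (simp only: prod_dividef prod_constant card_atMost power_mult Suc_eq_plus1)
    finally show ?thesis .
  qed
  have 3: "6 * N + 4 = 2 * (N + 1) + 2 * (2 * N + 1)" by simp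
  show ?thesis
    unfolding kernel_denom_def rev_denom_def 1 2 3 power_add[of u "2 * (N + 1)"] by simp
qed

lemma rev_denom_tendsto: "(rev_denom N \<longlongrightarrow> 1) (at 0)"
proof -
  have "isCont (rev_denom N) 0"
    unfolding rev_denom_def by (intro continuous_intros)
  moreover have "rev_denom N 0 = 1" by (simp add: rev_denom_def)
  ultimately show ?thesis by (simp add: isCont_def)
qed

lemma kernel_times_z_at_inverse:
  assumes "u \<noteq> 0" "e + 1 \<le> 6 * N + 4"
  shows "inverse u * ((inverse u) ^ e / kernel_denom N (inverse u)) = u ^ (6 * N + 3 - e) / rev_denom N u"
proof -
  have "u ^ (6 * N + 4) = u ^ (6 * N + 3 - e) * u ^ (e + 1)"
    unfolding power_add[symmetric] by (rule arg_cong[of _ _ "\<lambda>k. u ^ k"]) (use assms(2) in simp)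
  then show ?thesis using assms(1) unfolding kernel_denom_inverse[OF assms(1)]
    by (simp add: field_simps)
qed

text \<open>
  The denominator has degree $6N+4$, so only a numerator of degree $6N+3$ leaves a residue at infinity
  among the degrees considered here.
\<close>

lemma kernel_at_infinity:
  assumes "e + 1 \<le> 6 * N + 4"
  shows "((\<lambda>z. z * (z ^ e / kernel_denom N z)) \<longlongrightarrow> (if e = 6 * N + 3 then 1 else 0)) at_infinity"
proof -
  have "((\<lambda>u. u ^ (6 * N + 3 - e) / rev_denom N u) \<longlongrightarrow> 0 ^ (6 * N + 3 - e) / 1) (at 0)"
    by (intro tendsto_intros rev_denom_tendsto) auto
  moreover have "\<forall>\<^sub>F u in at 0. u ^ (6 * N + 3 - e) / rev_denom N u
      = inverse u * ((inverse u) ^ e / kernel_denom N (inverse u))"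
    using kernel_times_z_at_inverse[OF _ assms] by (auto simp: eventually_at_filter)
  ultimately have "((\<lambda>u. inverse u * ((inverse u) ^ e / kernel_denom N (inverse u))) \<longlongrightarrow> 0 ^ (6 * N + 3 - e) / 1) (at 0)"
    by (rule Lim_transform_eventually)
  then show ?thesis unfolding lim_at_infinity_0 o_def
    using assms by (cases "e = 6 * N + 3") (auto simp: power_0_left)
qed

text \<open>
  The one case in which numerator and denominator have the same degree. Subtracting the limit 1 does not
  change residues, and the next coefficient of the expansion at infinity is the sum of the roots of the
  denominator: $2(1+q)$ from the double factors, 0 from the others.
\<close>

lemma kernel_minus_one_at_infinity:
  "((\<lambda>z. z * (z ^ 10 / kernel_denom 1 z - 1)) \<longlongrightarrow> 2 + 2 * q) at_infinity"
proof -
  have r: "rev_denom 1 u = (1 - u)\<^sup>2 * (1 - q * u)\<^sup>2 * ((1 - u\<^sup>2) * (1 - q * u\<^sup>2) * (1 - q\<^sup>2 * u\<^sup>2))" for u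
    by (simp add: rev_denom_def eval_nat_numeral atMost_Suc algebra_simps)
  have "(rev_denom 1 has_field_derivative - (2 + 2 * q)) (at 0)"
    unfolding r[abs_def] by (auto intro!: derivative_eq_intros simp: algebra_simps)
  then have "((\<lambda>u. (rev_denom 1 u - 1) / u) \<longlongrightarrow> - (2 + 2 * q)) (at 0)"
    by (simp add: has_field_derivative_iff rev_denom_def[of _ 0])
  then have "((\<lambda>u. - ((rev_denom 1 u - 1) / u) / rev_denom 1 u) \<longlongrightarrow> - (- (2 + 2 * q)) / 1) (at 0)"
    by (intro tendsto_intros rev_denom_tendsto) auto
  moreover have "\<forall>\<^sub>F u in at 0. - ((rev_denom 1 u - 1) / u) / rev_denom 1 u
      = inverse u * ((inverse u) ^ 10 / kernel_denom 1 (inverse u) - 1)"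
  proof -
    have "\<forall>\<^sub>F u in at 0. rev_denom 1 u \<noteq> 0"
      by (rule tendsto_imp_eventually_ne[OF rev_denom_tendsto]) simp
    moreover have "\<forall>\<^sub>F u in at 0. u \<noteq> (0::complex)" by (simp add: eventually_at_filter)
    ultimately show ?thesis
    proof eventually_elim
      case (elim u)
      have "kernel_denom 1 (inverse u) = rev_denom 1 u / u ^ 10"
        using kernel_denom_inverse[of u 1] elim by simp
      with elim show ?case
        by (simp add: field_simps del: One_nat_def)
    qed
  qed
  ultimately have "((\<lambda>u. inverse u * ((inverse u) ^ 10 / kernel_denom 1 (inverse u) - 1)) \<longlongrightarrow> - (- (2 + 2 * q)) / 1) (at 0)"
    by (rule Lim_transform_eventually)
  then show ?thesis unfolding lim_at_infinity_0 o_def by (simp add: add.commute)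
qed

lemma finite_kernel_poles [simp]: "finite (kernel_poles N)"
  by (simp add: kernel_poles_def)

lemma kernel_holomorphic: "(\<lambda>z. z ^ e / kernel_denom N z) holomorphic_on (UNIV - kernel_poles N)"
proof (intro holomorphic_intros)
  show "(\<lambda>z. kernel_denom N z) holomorphic_on UNIV - kernel_poles N"
    unfolding kernel_denom_def by (intro holomorphic_intros)
qed (use kernel_denom_nz in auto)

definition residue_total :: "nat \<Rightarrow> nat \<Rightarrow> complex" where
  "residue_total N e = (\<Sum>p\<in>kernel_poles N. residue (\<lambda>z. z ^ e / kernel_denom N z) p)"

lemma residue_total_low:
  assumes "e + 1 \<le> 6 * N + 4"
  shows "residue_total N e = (if e = 6 * N + 3 then 1 else 0)"
  unfolding residue_total_def
  by (rule sum_residues_eq_limit_at_infinity[OF finite_kernel_poles kernel_holomorphic kernel_at_infinity[OF assms]])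

lemma residue_total_degree_10: "residue_total 1 10 = 2 + 2 * q"
proof -
  let ?f = "\<lambda>z. z ^ 10 / kernel_denom 1 z"
  have "(\<lambda>z. ?f z - 1) holomorphic_on (UNIV - kernel_poles 1)"
    by (intro holomorphic_on_diff kernel_holomorphic holomorphic_on_const)
  from sum_residues_eq_limit_at_infinity[OF finite_kernel_poles this kernel_minus_one_at_infinity]
  have "(\<Sum>p\<in>kernel_poles 1. residue (\<lambda>z. ?f z - 1) p) = 2 + 2 * q" .
  moreover have "residue (\<lambda>z. ?f z - 1) p = residue ?f p" if "p \<in> kernel_poles 1" for p
  proof -
    let ?U = "UNIV - (kernel_poles 1 - {p})"
    have U: "open ?U" "p \<in> ?U" by (auto intro!: open_Diff finite_imp_closed)
    have "?f holomorphic_on ?U - {p}"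
      by (rule holomorphic_on_subset[OF kernel_holomorphic]) (use that in auto)
    from residue_diff[OF U this, of "\<lambda>_. 1"] show ?thesis
      by (simp add: residue_const)
  qed
  ultimately show ?thesis unfolding residue_total_def by simp
qed

end

section \<open>The residue at each pole of the kernel\<close>

context punctured_disc
begin

lemma sq_eq_q_power_imp_pole:
  assumes "z\<^sup>2 = q ^ k" "k \<le> 2 * N"
  shows "z \<in> kernel_poles N"
proof -
  have "(z - s ^ k) * (z + s ^ k) = 0"
    using assms(1) by (simp flip: sq_minus_q_power)
  then have "z = s ^ k \<or> z = - (s ^ k)" by (auto simp: add_eq_0_iff2)
  then show ?thesis using assms(2) by (auto simp: kernel_poles_def)
qed

lemma q_power_in_poles: "j \<le> N \<Longrightarrow> q ^ j \<in> kernel_poles N"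
  by (rule sq_eq_q_power_imp_pole[of _ "2 * j"]) (auto simp: power_mult mult.commute)

lemma open_around_pole: "open (UNIV - (kernel_poles N - {p}))"
  by (auto intro!: open_Diff finite_imp_closed)

text \<open>
  The hypothesis \<open>off\<close> keeps the point away from the squared factors, so only the factor
  $z^2 - q^{k_0} = (z - z_0)(z + z_0)$ vanishes there. This covers both $-q^m$ and $\pm s q^m$.
\<close>

lemma residue_kernel_simple:
  assumes z0: "z0\<^sup>2 = q ^ k0" and k0: "k0 \<le> 2 * N"
    and off: "\<And>j. j \<le> N \<Longrightarrow> z0 \<noteq> q ^ j"
  shows "residue (\<lambda>z. z ^ e / kernel_denom N z) z0
    = z0 ^ e / ((\<Prod>j\<le>N. z0 - q ^ j)\<^sup>2 * (\<Prod>k\<in>{..2*N} - {k0}. q ^ k0 - q ^ k) * (2 * z0))"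
proof -
  define U where "U = UNIV - (kernel_poles N - {z0})"
  define g where "g = (\<lambda>w. w ^ e / ((\<Prod>j\<le>N. w - q ^ j)\<^sup>2 * (\<Prod>k\<in>{..2*N} - {k0}. w\<^sup>2 - q ^ k) * (w + z0)))"
  have "z0 \<noteq> 0" using z0 q_nz by auto
  have nz: "(\<Prod>j\<le>N. w - q ^ j)\<^sup>2 * (\<Prod>k\<in>{..2*N} - {k0}. w\<^sup>2 - q ^ k) * (w + z0) \<noteq> 0" if "w \<in> U" for w
  proof -
    have "w \<noteq> q ^ j" if "j \<le> N" for j
      using off[OF that] \<open>w \<in> U\<close> q_power_in_poles[OF that] by (auto simp: U_def)
    moreover have "w\<^sup>2 \<noteq> q ^ k" if "k \<le> 2 * N" "k \<noteq> k0" for k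
    proof
      assume *: "w\<^sup>2 = q ^ k"
      then have "w = z0" using sq_eq_q_power_imp_pole[OF * that(1)] \<open>w \<in> U\<close> by (auto simp: U_def)
      then show False using * z0 that(2) by (auto simp: q_power_inj)
    qed
    moreover have "w + z0 \<noteq> 0"
    proof
      assume "w + z0 = 0"
      then have w: "w = - z0" by (simp add: eq_neg_iff_add_eq_0)
      then have "w \<in> kernel_poles N"
        by (intro sq_eq_q_power_imp_pole[of _ k0]) (use z0 k0 in auto)
      then have "w = z0" using \<open>w \<in> U\<close> by (auto simp: U_def)
      then show False using w \<open>z0 \<noteq> 0\<close> by simp
    qed
    ultimately show ?thesis by auto
  qed
  have "g holomorphic_on U"
    unfolding g_def by (intro holomorphic_intros nz)
  moreover have "open U" "z0 \<in> U" by (auto simp: U_def open_around_pole)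
  ultimately have "residue (\<lambda>w. g w / (w - z0)) z0 = g z0"
    by (intro residue_simple[of U])
  moreover have "(\<lambda>w. g w / (w - z0)) = (\<lambda>z. z ^ e / kernel_denom N z)"
  proof
    fix w
    have "(\<Prod>k\<le>2*N. w\<^sup>2 - q ^ k) = (w\<^sup>2 - q ^ k0) * (\<Prod>k\<in>{..2*N} - {k0}. w\<^sup>2 - q ^ k)"
      using k0 by (intro prod.remove) auto
    moreover have "w\<^sup>2 - q ^ k0 = (w + z0) * (w - z0)"
      by (simp add: z0[symmetric] power2_eq_square algebra_simps)
    ultimately show "g w / (w - z0) = w ^ e / kernel_denom N w"
      by (simp add: g_def kernel_denom_def prod_power_distrib mult_ac)
  qed
  ultimately show ?thesis by (simp add: g_def z0)
qed

text \<open>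
  At $y = q^m$ the factors $(z-y)^2$ and $z^2 - y^2$ combine to $(z-y)^3 (z+y)$. The numbers $l$ and $l'$
  are the logarithmic derivative of the remaining cofactor and the derivative of that, at $y$.
\<close>

lemma residue_kernel_triple:
  fixes e :: nat
  assumes m: "m \<le> N"
  defines "y \<equiv> q ^ m"
  defines "l \<equiv> of_nat e / y - 2 * (\<Sum>j\<in>{..N} - {m}. 1 / (y - q ^ j))
      - 2 * y * (\<Sum>k\<in>{..2*N} - {2*m}. 1 / (y\<^sup>2 - q ^ k)) - 1 / (2 * y)"
  defines "l' \<equiv> - (of_nat e / y\<^sup>2) + 2 * (\<Sum>j\<in>{..N} - {m}. (1 / (y - q ^ j))\<^sup>2)
      - 2 * (\<Sum>k\<in>{..2*N} - {2*m}. 1 / (y\<^sup>2 - q ^ k))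
      + 4 * y\<^sup>2 * (\<Sum>k\<in>{..2*N} - {2*m}. (1 / (y\<^sup>2 - q ^ k))\<^sup>2) + 1 / (2 * y)\<^sup>2"
  shows "residue (\<lambda>z. z ^ e / kernel_denom N z) y
    = y ^ e / ((\<Prod>j\<in>{..N} - {m}. y - q ^ j)\<^sup>2 * (\<Prod>k\<in>{..2*N} - {2*m}. y\<^sup>2 - q ^ k) * (2 * y))
       * ((l\<^sup>2 + l') / 2)"
proof -
  define U where "U = UNIV - (kernel_poles N - {y}) - {0}"
  let ?J = "{..N} - {m}" and ?K = "{..2*N} - {2*m}"
  define P where "P = (\<lambda>w. (\<Prod>j\<in>?J. w - q ^ j)\<^sup>2 * (\<Prod>k\<in>?K. w\<^sup>2 - q ^ k) * (w + y))"
  define g where "g = (\<lambda>w. w ^ e / P w)"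
  define lg where "lg = (\<lambda>w. of_nat e / w - 2 * (\<Sum>j\<in>?J. 1 / (w - q ^ j))
      - (\<Sum>k\<in>?K. 2 * w / (w\<^sup>2 - q ^ k)) - 1 / (w + y))"
  have y: "y \<noteq> 0" "y\<^sup>2 = q ^ (2 * m)" using q_nz by (auto simp: y_def power_mult mult.commute)
  have nz: "w \<noteq> 0 \<and> (\<forall>j\<in>?J. w - q ^ j \<noteq> 0) \<and> (\<forall>k\<in>?K. w\<^sup>2 - q ^ k \<noteq> 0) \<and> w + y \<noteq> 0" if "w \<in> U" for w
  proof (intro conjI ballI)
    show "w \<noteq> 0" using that by (auto simp: U_def)
    show "w - q ^ j \<noteq> 0" if "j \<in> ?J" for j
      using \<open>w \<in> U\<close> q_power_in_poles[of j N] that by (auto simp: U_def y_def q_power_inj)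
    show "w\<^sup>2 - q ^ k \<noteq> 0" if "k \<in> ?K" for k
    proof
      assume "w\<^sup>2 - q ^ k = 0"
      then have *: "w\<^sup>2 = q ^ k" by simp
      then have "w = y" using sq_eq_q_power_imp_pole[OF *, of N] that \<open>w \<in> U\<close> by (auto simp: U_def)
      then show False using * y that by (auto simp: q_power_inj)
    qed
    show "w + y \<noteq> 0"
    proof
      assume "w + y = 0"
      then have w: "w = - y" by (simp add: eq_neg_iff_add_eq_0)
      then have "w \<in> kernel_poles N"
        by (intro sq_eq_q_power_imp_pole[of _ "2 * m"]) (use y m in auto)
      then have "w = y" using \<open>w \<in> U\<close> by (auto simp: U_def)
      then show False using w \<open>y \<noteq> 0\<close> by simp
    qed
  qed
  have U: "open U" "y \<in> U" using y by (auto simp: U_def intro!: open_Diff open_around_pole)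
  have g': "(g has_field_derivative g w * lg w) (at w)" if "w \<in> U" for w
  proof -
    note n = nz[OF that]
    have 1: "((\<lambda>w. \<Prod>j\<in>?J. w - q ^ j) has_field_derivative
        (\<Prod>j\<in>?J. w - q ^ j) * (\<Sum>j\<in>?J. 1 / (w - q ^ j))) (at w)"
      by (rule has_log_derivative_prod[where l = "\<lambda>j w. 1 / (w - q ^ j)"])
         (use n in \<open>auto intro!: derivative_eq_intros\<close>)
    have 2: "((\<lambda>w. \<Prod>k\<in>?K. w\<^sup>2 - q ^ k) has_field_derivative
        (\<Prod>k\<in>?K. w\<^sup>2 - q ^ k) * (\<Sum>k\<in>?K. 2 * w / (w\<^sup>2 - q ^ k))) (at w)"
      by (rule has_log_derivative_prod[where l = "\<lambda>k w. 2 * w / (w\<^sup>2 - q ^ k)"])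
         (use n in \<open>auto intro!: derivative_eq_intros\<close>)
    have 3: "(P has_field_derivative P w * (2 * (\<Sum>j\<in>?J. 1 / (w - q ^ j)) + (\<Sum>k\<in>?K. 2 * w / (w\<^sup>2 - q ^ k)) + 1 / (w + y))) (at w)"
      unfolding P_def
      by (rule derivative_eq_intros 1 2 refl)+ (use n in \<open>simp add: field_simps power2_eq_square\<close>)
    have Pnz: "P w \<noteq> 0" using n by (auto simp: P_def)
    have 4: "((\<lambda>w. w ^ e) has_field_derivative w ^ e * (of_nat e / w)) (at w)"
      by (rule derivative_eq_intros refl)+ (use n in \<open>cases e; simp\<close>)
    show ?thesis
      unfolding g_def
      by (rule DERIV_cong[OF DERIV_divide[OF 4 3 Pnz]])
         (use Pnz in \<open>simp add: lg_def field_simps\<close>)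
  qed
  have "(lg has_field_derivative l') (at y)"
  proof -
    note n = nz[OF \<open>y \<in> U\<close>]
    have 1: "((\<lambda>w. \<Sum>j\<in>?J. 1 / (w - q ^ j)) has_field_derivative (\<Sum>j\<in>?J. - (1 / (y - q ^ j))\<^sup>2)) (at y)"
      by (rule DERIV_sum) (use n in \<open>auto intro!: derivative_eq_intros simp: power2_eq_square\<close>)
    have 2: "((\<lambda>w. \<Sum>k\<in>?K. 2 * w / (w\<^sup>2 - q ^ k)) has_field_derivative
        (\<Sum>k\<in>?K. 2 * (1 / (y\<^sup>2 - q ^ k)) - 4 * y\<^sup>2 * (1 / (y\<^sup>2 - q ^ k))\<^sup>2)) (at y)"
    proof (rule DERIV_sum)
      fix k assume "k \<in> ?K"
      then have c: "y\<^sup>2 - q ^ k \<noteq> 0" using n by blast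
      have "(2 * d - 2 * y * (2 * y)) / (d * d) = 2 * (1 / d) - 4 * y\<^sup>2 * (1 / d)\<^sup>2"
        if "d \<noteq> 0" for d
        using that by (simp add: field_simps power2_eq_square)
      from this[OF c] have "(2 * (y\<^sup>2 - q ^ k) - 2 * y * (2 * y)) / ((y\<^sup>2 - q ^ k) * (y\<^sup>2 - q ^ k))
          = 2 * (1 / (y\<^sup>2 - q ^ k)) - 4 * y\<^sup>2 * (1 / (y\<^sup>2 - q ^ k))\<^sup>2"
        .
      moreover have "((\<lambda>w. 2 * w / (w\<^sup>2 - q ^ k)) has_field_derivative
          (2 * (y\<^sup>2 - q ^ k) - 2 * y * (2 * y)) / ((y\<^sup>2 - q ^ k) * (y\<^sup>2 - q ^ k))) (at y)"
        using c by (auto intro!: derivative_eq_intros)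
      ultimately show "((\<lambda>w. 2 * w / (w\<^sup>2 - q ^ k)) has_field_derivative
          2 * (1 / (y\<^sup>2 - q ^ k)) - 4 * y\<^sup>2 * (1 / (y\<^sup>2 - q ^ k))\<^sup>2) (at y)" by metis
    qed
    have 3: "((\<lambda>w. of_nat e / w) has_field_derivative - (of_nat e / y\<^sup>2)) (at y)"
      using y(1) by (auto intro!: derivative_eq_intros simp: power2_eq_square)
    have 4: "((\<lambda>w. 1 / (w + y)) has_field_derivative - (1 / (2 * y))\<^sup>2) (at y)"
      using y(1) by (auto intro!: derivative_eq_intros simp: power2_eq_square)
    show ?thesis
      unfolding lg_def
      by (rule DERIV_cong[OF DERIV_diff[OF DERIV_diff[OF DERIV_diff[OF 3 DERIV_cmult[OF 1, of 2]] 2] 4]])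
         (simp add: l'_def sum_negf sum_subtractf sum_distrib_left power_divide power_mult_distrib)
  qed
  then have "(deriv ^^ 2) g y = g y * ((lg y)\<^sup>2 + l')"
    using second_deriv_from_log_derivative[OF U, of g lg l'] g' by blast
  moreover have "lg y = l"
    by (simp add: lg_def l_def sum_distrib_left)
  moreover have "residue (\<lambda>w. g w / (w - y) ^ Suc 2) y = (deriv ^^ 2) g y / fact 2"
  proof (rule residue_holomorphic_over_power[OF U])
    show "g holomorphic_on U"
      unfolding holomorphic_on_open[OF U(1)] using g' by blast
  qed
  moreover have "(\<lambda>w. g w / (w - y) ^ Suc 2) = (\<lambda>z. z ^ e / kernel_denom N z)"
  proof
    fix w
    have "(\<Prod>k\<le>2*N. w\<^sup>2 - q ^ k) = (w\<^sup>2 - q ^ (2*m)) * (\<Prod>k\<in>?K. w\<^sup>2 - q ^ k)"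
      "(\<Prod>j\<le>N. w - q ^ j) = (w - y) * (\<Prod>j\<in>?J. w - q ^ j)"
      unfolding y_def using m by (auto intro!: prod.remove)
    moreover have "w\<^sup>2 - q ^ (2*m) = (w + y) * (w - y)"
      unfolding y(2)[symmetric] by (simp add: power2_eq_square algebra_simps)
    moreover have "kernel_denom N w = (\<Prod>j\<le>N. w - q ^ j)\<^sup>2 * (\<Prod>k\<le>2*N. w\<^sup>2 - q ^ k)"
      by (simp add: kernel_denom_def prod_power_distrib)
    ultimately have "kernel_denom N w = P w * (w - y) ^ Suc 2"
      unfolding P_def by (simp only: power2_eq_square power_Suc mult_ac)
    then show "g w / (w - y) ^ Suc 2 = w ^ e / kernel_denom N w"
      by (simp add: g_def)
  qed
  ultimately show ?thesis
    by (simp add: g_def P_def)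
qed

end

section \<open>Products and sums over the remaining powers of q\<close>

text \<open>
  At the pole indexed by $M$ the remaining indices split into $M$ indices below and $n$ above; the ones
  below give $q$-Pochhammer symbols and Lambert sums of length $M$, the ones above of length $n$.
\<close>

lemma split_off_diagonal:
  fixes M n :: nat
  shows "{..M + n} - {M} = {..<M} \<union> (\<lambda>i. M + Suc i) ` {..<n}"
proof -
  have "x \<in> (\<lambda>i. M + Suc i) ` {..<n}" if "x \<le> M + n" "x > M" for x
    by (rule image_eqI[of _ _ "x - Suc M"]) (use that in auto)
  then show ?thesis by auto (metis lessThan_iff nat_neq_iff)
qed

lemma sum_off_diagonal:
  "(\<Sum>j\<in>{..M + n} - {M}. f j) = (\<Sum>i<M. f (M - Suc i)) + (\<Sum>i<n. f (M + Suc i) :: complex)"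
proof -
  have "(\<Sum>j\<in>{..M + n} - {M}. f j) = (\<Sum>j<M. f j) + (\<Sum>j\<in>(\<lambda>i. M + Suc i) ` {..<n}. f j)"
    unfolding split_off_diagonal by (rule sum.union_disjoint) auto
  also have "(\<Sum>j<M. f j) = (\<Sum>i<M. f (M - Suc i))"
    by (rule sum.nat_diff_reindex[symmetric])
  also have "(\<Sum>j\<in>(\<lambda>i. M + Suc i) ` {..<n}. f j) = (\<Sum>i<n. f (M + Suc i))"
    by (subst sum.reindex) (auto simp: inj_on_def)
  finally show ?thesis .
qed

lemma prod_off_diagonal:
  "(\<Prod>j\<in>{..M + n} - {M}. f j) = (\<Prod>i<M. f i) * (\<Prod>i<n. f (M + Suc i) :: complex)"
proof -
  have "(\<Prod>j\<in>{..M + n} - {M}. f j) = (\<Prod>j<M. f j) * (\<Prod>j\<in>(\<lambda>i. M + Suc i) ` {..<n}. f j)"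
    unfolding split_off_diagonal by (rule prod.union_disjoint) auto
  also have "(\<Prod>j\<in>(\<lambda>i. M + Suc i) ` {..<n}. f j) = (\<Prod>i<n. f (M + Suc i))"
    by (subst prod.reindex) (auto simp: inj_on_def)
  finally show ?thesis .
qed

text \<open>
  The partial sums by which $E_1^{(0)}$ exceeds $E_1^{(M)}$; \<open>lambert2\<close> plays the same role for
  $E_2^{(M)}$.
\<close>

definition lambert1 :: "complex \<Rightarrow> nat \<Rightarrow> complex" where
  "lambert1 q M = (\<Sum>i<M. q ^ Suc i / (1 - q ^ Suc i))"

definition lambert2 :: "complex \<Rightarrow> nat \<Rightarrow> complex" where
  "lambert2 q M = (\<Sum>i<M. q ^ Suc i / (1 - q ^ Suc i)\<^sup>2)"

text \<open>
  The power of $q$ whose exponent is the triangular number $M(M-1)/2$, written as a product to avoid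
  the division.
\<close>

definition tri_power :: "complex \<Rightarrow> nat \<Rightarrow> complex" where
  "tri_power q M = (\<Prod>i<M. q ^ i)"

lemma tri_power_sq: "(tri_power q m)\<^sup>2 * q ^ m = q ^ (m * m)"
  unfolding tri_power_def
  by (induction m) (simp_all add: power2_eq_square power_add[symmetric] algebra_simps flip: power_mult)

lemma tri_power_even: "tri_power q (2 * m) * q ^ m = q ^ (2 * m * m)"
proof (induction m)
  case (Suc m)
  have "tri_power q (2 * Suc m) * q ^ Suc m = (tri_power q (2 * m) * q ^ m) * (q ^ (2 * m) * q ^ (2 * m + 1) * q)"
    by (simp add: tri_power_def)
  also have "\<dots> = q ^ (2 * m * m + 2 * m + (2 * m + 1) + 1)"
    unfolding Suc.IH by (simp only: power_add power_one_right mult.assoc)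
  finally show ?case by (simp add: algebra_simps)
qed (simp add: tri_power_def)

lemma tri_power_odd: "tri_power q (2 * m + 1) = q ^ (2 * m * m + m)"
  unfolding tri_power_def
  by (induction m) (simp_all add: power_add[symmetric] algebra_simps)

context punctured_disc
begin

lemma one_minus_q_power_nz: "1 - q ^ Suc i \<noteq> 0"
  using q_power_inj[of "Suc i" 0] by auto

text \<open>
  Reversing the product turns $t q^M - q^i$ into $-q^i (1 - t q^{M-i})$. The scaling $t$ allows
  points that are not integral powers of $q$.
\<close>

lemma prod_below:
  "(\<Prod>i<M. t * q ^ M - q ^ i) = (-1) ^ M * tri_power q M * qpoch (t * q) q M"
proof -
  have "(\<Prod>i<M. t * q ^ M - q ^ i) = (\<Prod>i<M. (- (q ^ i)) * (1 - t * q ^ (M - i)))"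
  proof (intro prod.cong refl)
    fix i assume "i \<in> {..<M}"
    then have "q ^ M = q ^ i * q ^ (M - i)" by (simp flip: power_add)
    then show "t * q ^ M - q ^ i = (- (q ^ i)) * (1 - t * q ^ (M - i))" by (simp add: algebra_simps)
  qed
  also have "\<dots> = (\<Prod>i<M. - (q ^ i)) * (\<Prod>i<M. 1 - t * q ^ (M - i))"
    by (rule prod.distrib)
  also have "(\<Prod>i<M. - (q ^ i)) = (-1) ^ M * tri_power q M"
    unfolding tri_power_def by (induction M) auto
  also have "(\<Prod>i<M. 1 - t * q ^ (M - i)) = (\<Prod>i<M. 1 - t * q ^ (M - (M - Suc i)))"
    by (rule prod.nat_diff_reindex[symmetric])
  also have "\<dots> = qpoch (t * q) q M"
    unfolding qpoch_def by (intro prod.cong refl) (simp add: Suc_diff_Suc)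
  finally show ?thesis .
qed

lemma prod_above:
  assumes "z \<noteq> 0"
  shows "(\<Prod>i<n. z - q ^ (M + i)) = z ^ n * qpoch (q ^ M / z) q n"
proof -
  have "(\<Prod>i<n. z - q ^ (M + i)) = (\<Prod>i<n. z * (1 - q ^ M / z * q ^ i))"
    using assms by (intro prod.cong refl) (simp add: field_simps power_add)
  then show ?thesis unfolding qpoch_def by (simp add: prod.distrib)
qed

lemma prod_scaled_off_diagonal:
  assumes "t \<noteq> 0"
  shows "(\<Prod>j\<in>{..M + n} - {M}. t * q ^ M - q ^ j) =
     ((-1) ^ M * tri_power q M * qpoch (t * q) q M) * ((t * q ^ M) ^ n * qpoch (q / t) q n)"
proof -
  have "(\<Prod>i<n. t * q ^ M - q ^ (M + Suc i)) = (t * q ^ M) ^ n * qpoch (q / t) q n"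
    using prod_above[of "t * q ^ M" "Suc M" n] q_nz assms by simp
  then show ?thesis
    unfolding prod_off_diagonal prod_below by simp
qed

lemma prod_q_powers_off_diagonal:
  "(\<Prod>j\<in>{..M + n} - {M}. q ^ M - q ^ j) =
     ((-1) ^ M * tri_power q M * qpoch q q M) * (q ^ (M * n) * qpoch q q n)"
  using prod_scaled_off_diagonal[of 1 M n] by (simp add: power_mult)

lemma sum_off_diagonal_first:
  "(\<Sum>j\<in>{..M + n} - {M}. q ^ M * (1 / (q ^ M - q ^ j))) = of_nat n + lambert1 q n - lambert1 q M"
proof -
  have "(\<Sum>i<M. q ^ M * (1 / (q ^ M - q ^ (M - Suc i)))) = (\<Sum>i<M. - (q ^ Suc i / (1 - q ^ Suc i)))"
  proof (intro sum.cong refl)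
    fix i assume "i \<in> {..<M}"
    then have "q ^ M = q ^ (M - Suc i) * q ^ Suc i" by (simp only: flip: power_add) simp
    then show "q ^ M * (1 / (q ^ M - q ^ (M - Suc i))) = - (q ^ Suc i / (1 - q ^ Suc i))"
      using one_minus_q_power_nz[of i] q_nz by (simp add: field_simps del: power_Suc)
  qed
  moreover have "(\<Sum>i<n. q ^ M * (1 / (q ^ M - q ^ (M + Suc i)))) = (\<Sum>i<n. 1 + q ^ Suc i / (1 - q ^ Suc i))"
  proof (intro sum.cong refl)
    fix i assume "i \<in> {..<n}"
    show "q ^ M * (1 / (q ^ M - q ^ (M + Suc i))) = 1 + q ^ Suc i / (1 - q ^ Suc i)"
      unfolding power_add[of q M "Suc i"] using one_minus_q_power_nz[of i] q_nz
      by (simp add: field_simps del: power_Suc)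
  qed
  ultimately show ?thesis
    unfolding sum_off_diagonal lambert1_def by (simp add: sum.distrib sum_negf)
qed

lemma sum_off_diagonal_second:
  "(\<Sum>j\<in>{..M + n} - {M}. (q ^ M * (1 / (q ^ M - q ^ j)))\<^sup>2) =
     lambert2 q M + lambert2 q n - lambert1 q M + of_nat n + lambert1 q n"
proof -
  have aux: "(w / (1 - w))\<^sup>2 = w / (1 - w)\<^sup>2 - w / (1 - w)"
    "(1 / (1 - w))\<^sup>2 = w / (1 - w)\<^sup>2 + 1 + w / (1 - w)" if "1 - w \<noteq> 0" for w :: complex
    using that by (auto simp: divide_simps power2_eq_square) (auto simp: algebra_simps)
  have "(\<Sum>i<M. (q ^ M * (1 / (q ^ M - q ^ (M - Suc i))))\<^sup>2)
      = (\<Sum>i<M. q ^ Suc i / (1 - q ^ Suc i)\<^sup>2 - q ^ Suc i / (1 - q ^ Suc i))"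
  proof (intro sum.cong refl)
    fix i assume "i \<in> {..<M}"
    then have "q ^ M = q ^ (M - Suc i) * q ^ Suc i" by (simp only: flip: power_add) simp
    then have "q ^ M * (1 / (q ^ M - q ^ (M - Suc i))) = - (q ^ Suc i / (1 - q ^ Suc i))"
      using one_minus_q_power_nz[of i] q_nz by (simp add: field_simps del: power_Suc)
    then show "(q ^ M * (1 / (q ^ M - q ^ (M - Suc i))))\<^sup>2 = q ^ Suc i / (1 - q ^ Suc i)\<^sup>2 - q ^ Suc i / (1 - q ^ Suc i)"
      using aux(1)[OF one_minus_q_power_nz] by (simp only: power2_minus)
  qed
  moreover have "(\<Sum>i<n. (q ^ M * (1 / (q ^ M - q ^ (M + Suc i))))\<^sup>2)
      = (\<Sum>i<n. q ^ Suc i / (1 - q ^ Suc i)\<^sup>2 + 1 + q ^ Suc i / (1 - q ^ Suc i))"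
  proof (intro sum.cong refl)
    fix i assume "i \<in> {..<n}"
    have "q ^ M * (1 / (q ^ M - q ^ (M + Suc i))) = 1 / (1 - q ^ Suc i)"
      unfolding power_add[of q M "Suc i"] using one_minus_q_power_nz[of i] q_nz
      by (simp add: field_simps del: power_Suc)
    then show "(q ^ M * (1 / (q ^ M - q ^ (M + Suc i))))\<^sup>2
        = q ^ Suc i / (1 - q ^ Suc i)\<^sup>2 + 1 + q ^ Suc i / (1 - q ^ Suc i)"
      using aux(2)[OF one_minus_q_power_nz] by (simp only:)
  qed
  ultimately show ?thesis
    unfolding sum_off_diagonal lambert1_def lambert2_def by (simp add: sum.distrib sum_subtractf)
qed

end

section \<open>Residues as products of series coefficients\<close>

context punctured_disc
begin

text \<open>
  The coefficients of the series with all dependence on $\lambda$ removed; $t = 1$ belongs to the columns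
  0, 1, 2 and $t = -1$ to column 4. The variants with suffix \<open>half\<close>, at $x = s$ and $x = -s$, belong to
  the columns 3 and 5.
\<close>

definition plus_coeff :: "complex \<Rightarrow> nat \<Rightarrow> complex" where
  "plus_coeff t m = q ^ (m * (2 * m + 1)) / ((qpoch (t * q) q m)\<^sup>2 * qpoch q q (2 * m))"

definition minus_coeff :: "complex \<Rightarrow> nat \<Rightarrow> complex" where
  "minus_coeff t n = q ^ (n * (n + 1)) / ((qpoch (t * q) q n)\<^sup>2 * qpoch q q (2 * n))"

definition plus_coeff_half :: "complex \<Rightarrow> nat \<Rightarrow> complex" where
  "plus_coeff_half x m = q ^ ((2 * m + 1) * (m + 1)) / ((qpoch (x * q) q m)\<^sup>2 * qpoch q q (2 * m + 1))"

definition minus_coeff_half :: "complex \<Rightarrow> nat \<Rightarrow> complex" where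
  "minus_coeff_half x n = q ^ (n * (n + 2)) / ((qpoch (x * q) q n)\<^sup>2 * qpoch q q (2 * n + 1))"

lemma power_split_powi:
  assumes "(z::complex) \<noteq> 0" "int e = int k + d"
  shows "z ^ e = z ^ k * z powi d"
  using assms by (metis power_int_add power_int_of_nat)

text \<open>
  The bookkeeping of the powers of $q$ when a residue at $\pm q^m$ is compared with the product of the
  $m$-th and the $n$-th coefficient.
\<close>

lemma weight_integer:
  "q ^ (N * N + N) * (q ^ m) ^ (4 * N + 1) = q ^ (m * (2 * m + 1)) * q ^ (n * (n + 1)) *
     ((tri_power q m)\<^sup>2 * tri_power q (2 * m) * ((q ^ m) ^ (2 * n) * (q ^ (2 * m)) ^ (2 * n)) * (q ^ m) ^ 3)"
  if "N = m + n"
proof -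
  have "q ^ (m * (2 * m + 1)) * q ^ (n * (n + 1)) *
     ((tri_power q m)\<^sup>2 * tri_power q (2 * m) * ((q ^ m) ^ (2 * n) * (q ^ (2 * m)) ^ (2 * n)) * (q ^ m) ^ 3)
     = q ^ (m * (2 * m + 1)) * q ^ (n * (n + 1)) * (((tri_power q m)\<^sup>2 * q ^ m) * (tri_power q (2 * m) * q ^ m)
        * ((q ^ m) ^ (2 * n) * (q ^ (2 * m)) ^ (2 * n)) * q ^ m)"
    by (simp add: power3_eq_cube)
  also have "\<dots> = q ^ (m * (2 * m + 1) + n * (n + 1) + (m * m + 2 * m * m + (m * (2 * n) + 2 * m * (2 * n)) + m))"
    unfolding tri_power_sq tri_power_even by (simp only: power_add power_mult)
  also have "m * (2 * m + 1) + n * (n + 1) + (m * m + 2 * m * m + (m * (2 * n) + 2 * m * (2 * n)) + m)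
      = N * N + N + m * (4 * N + 1)"
    unfolding that by (simp add: algebra_simps)
  finally show ?thesis by (simp only: power_add power_mult)
qed

lemma prod_scaled_off_diagonal_sq:
  assumes "t \<noteq> 0"
  shows "(\<Prod>j\<in>{..M + n} - {M}. t * q ^ M - q ^ j)\<^sup>2 =
     (tri_power q M)\<^sup>2 * (qpoch (t * q) q M)\<^sup>2 * ((t * q ^ M) ^ (2 * n) * (qpoch (q / t) q n)\<^sup>2)"
proof -
  have "((-1 :: complex) ^ M)\<^sup>2 = 1" by (cases "even M") auto
  then show ?thesis
    unfolding prod_scaled_off_diagonal[OF assms] power_mult_distrib power_even_eq by simp
qed

lemma prod_even_off_diagonal:
  "(\<Prod>k\<in>{..2 * m + 2 * n} - {2 * m}. q ^ (2 * m) - q ^ k) =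
     tri_power q (2 * m) * qpoch q q (2 * m) * ((q ^ (2 * m)) ^ (2 * n) * qpoch q q (2 * n))"
  unfolding prod_q_powers_off_diagonal power_mult[of q "2 * m"] by simp

text \<open>
  With $d = a - b$ the number $\delta$ is $p_{a,1,m} - P_{b,1,n}$, and the bracket is
  $p_{a,2,m} + P_{b,2,n} - 2 p_{a,1,m} P_{b,1,n}$: the constants $E_1^{(0)}$, $E_2^{(0)}$ and
  $\mathcal{E}_2$ cancel in these combinations. The summand $-1/2$ comes from the factors
  $(z-y)^2 (z^2-y^2)$, which agree with $2y (z-y)^3$ only to leading order.
\<close>

lemma residue_at_triple_pole:
  fixes d :: int
  assumes N: "N = m + n" and e: "int e = 4 * int N + 1 + d"
  defines "\<delta> \<equiv> of_int (4 * int m - 2 * int n + d) + 2 * lambert1 q m + 2 * lambert1 q (2 * m)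
                 - 2 * lambert1 q n - 2 * lambert1 q (2 * n)"
  shows "2 * q ^ (N * N + N) * residue (\<lambda>z. z ^ e / kernel_denom N z) (q ^ m) =
    (q ^ m) powi d * (plus_coeff 1 m * minus_coeff 1 n) *
      (\<delta>\<^sup>2 - 1/2 + 2 * (lambert2 q m + lambert2 q n) + 4 * (lambert2 q (2 * m) + lambert2 q (2 * n))) / 2"
proof -
  define y where "y = q ^ m"
  have y: "y \<noteq> 0" "y\<^sup>2 = q ^ (2 * m)" using q_nz by (auto simp: y_def power_mult mult.commute)
  define S1 where "S1 = (\<Sum>j\<in>{..N} - {m}. 1 / (y - q ^ j))"
  define S2 where "S2 = (\<Sum>j\<in>{..N} - {m}. (1 / (y - q ^ j))\<^sup>2)"
  define T1 where "T1 = (\<Sum>k\<in>{..2*N} - {2*m}. 1 / (y\<^sup>2 - q ^ k))"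
  define T2 where "T2 = (\<Sum>k\<in>{..2*N} - {2*m}. (1 / (y\<^sup>2 - q ^ k))\<^sup>2)"
  define l where "l = of_nat e / y - 2 * S1 - 2 * y * T1 - 1 / (2 * y)"
  define l' where "l' = - (of_nat e / y\<^sup>2) + 2 * S2 - 2 * T1 + 4 * y\<^sup>2 * T2 + 1 / (2 * y)\<^sup>2"
  define Z where "Z = \<delta>\<^sup>2 - 1/2 + 2 * (lambert2 q m + lambert2 q n) + 4 * (lambert2 q (2 * m) + lambert2 q (2 * n))"
  have N2: "2 * N = 2 * m + 2 * n" and mN: "m \<le> N" using N by auto
  have e': "of_nat e = (of_int (4 * int m + 4 * int n + 1 + d) :: complex)"
    using e N by (metis of_int_of_nat_eq of_nat_add distrib_left)
  have s1: "y * S1 = of_nat n + lambert1 q n - lambert1 q m"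
    unfolding S1_def sum_distrib_left N y_def by (rule sum_off_diagonal_first)
  have s2: "y\<^sup>2 * S2 = lambert2 q m + lambert2 q n - lambert1 q m + of_nat n + lambert1 q n"
    unfolding S2_def sum_distrib_left N power_mult_distrib[symmetric] y_def by (rule sum_off_diagonal_second)
  have t1: "y\<^sup>2 * T1 = of_nat (2 * n) + lambert1 q (2 * n) - lambert1 q (2 * m)"
    unfolding T1_def sum_distrib_left N2 y(2) by (rule sum_off_diagonal_first)
  have t2: "(y\<^sup>2)\<^sup>2 * T2 = lambert2 q (2 * m) + lambert2 q (2 * n) - lambert1 q (2 * m) + of_nat (2 * n) + lambert1 q (2 * n)"
    unfolding T2_def sum_distrib_left N2 power_mult_distrib[symmetric] y(2) by (rule sum_off_diagonal_second)
  \<comment> \<open>The Lambert sums below and above the pole enter with opposite signs; the constant is $1 - 1/2$, from the exponent and from the factor $z + y$.\<close>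
  have A: "y * l = \<delta> + 1/2"
  proof -
    have "y * l = of_nat e - 2 * (y * S1) - 2 * (y\<^sup>2 * T1) - 1 / 2"
      using y(1) by (simp add: l_def field_simps power2_eq_square)
    then show ?thesis unfolding s1 t1 e' by (simp add: \<delta>_def algebra_simps)
  qed
  have B: "y\<^sup>2 * l' = 2 * (lambert2 q m + lambert2 q n) + 4 * (lambert2 q (2 * m) + lambert2 q (2 * n)) - \<delta> - 3/4"
  proof -
    have "y\<^sup>2 * l' = - of_nat e + 2 * (y\<^sup>2 * S2) - 2 * (y\<^sup>2 * T1) + 4 * ((y\<^sup>2)\<^sup>2 * T2) + 1 / 4"
      using y(1) by (simp add: l'_def field_simps power2_eq_square)
    then show ?thesis unfolding s2 t1 t2 e' by (simp add: \<delta>_def algebra_simps)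
  qed
  have "y\<^sup>2 * (l\<^sup>2 + l') = (y * l)\<^sup>2 + y\<^sup>2 * l'" by (simp add: power2_eq_square algebra_simps)
  also have "\<dots> = Z" unfolding A B Z_def by (simp add: power2_eq_square algebra_simps)
  finally have Z: "l\<^sup>2 + l' = Z / y\<^sup>2" using y(1) by (simp add: field_simps)
  define P where "P = (tri_power q m)\<^sup>2 * tri_power q (2 * m) * (y ^ (2 * n) * (q ^ (2 * m)) ^ (2 * n))"
  define G where "G = (qpoch q q m)\<^sup>2 * qpoch q q (2 * m) * ((qpoch q q n)\<^sup>2 * qpoch q q (2 * n))"
  have prods: "(\<Prod>j\<in>{..N} - {m}. y - q ^ j)\<^sup>2 * (\<Prod>k\<in>{..2*N} - {2*m}. y\<^sup>2 - q ^ k) = P * G"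
  proof -
    have p1: "(\<Prod>j\<in>{..N} - {m}. y - q ^ j)\<^sup>2
        = (tri_power q m)\<^sup>2 * (qpoch q q m)\<^sup>2 * (y ^ (2 * n) * (qpoch q q n)\<^sup>2)"
      using prod_scaled_off_diagonal_sq[of 1 m n] by (simp add: y_def N)
    show ?thesis
      unfolding p1 N2 y(2) prod_even_off_diagonal P_def G_def by (simp only: mult_ac)
  qed
  have res: "residue (\<lambda>z. z ^ e / kernel_denom N z) y = y ^ e / (P * G * (2 * y)) * ((l\<^sup>2 + l') / 2)"
    unfolding prods[symmetric]
    by (rule residue_kernel_triple[OF mN, of e, folded y_def, folded S1_def S2_def T1_def T2_def, folded l_def l'_def])
  have ye: "y ^ e = y ^ (4 * N + 1) * y powi d"
    by (rule power_split_powi) (use y e in auto)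
  have P: "P \<noteq> 0" using q_nz by (auto simp: P_def y_def tri_power_def)
  have W: "q ^ (N * N + N) * y ^ (4 * N + 1) = q ^ (m * (2 * m + 1)) * q ^ (n * (n + 1)) * (P * y ^ 3)"
    unfolding y_def P_def using weight_integer[OF N] by simp
  have "2 * q ^ (N * N + N) * residue (\<lambda>z. z ^ e / kernel_denom N z) y
      = (q ^ (N * N + N) * y ^ (4 * N + 1)) * y powi d / (P * y ^ 3 * G) * (Z / 2)"
    unfolding res Z ye using y(1) P by (simp add: field_simps power2_eq_square power3_eq_cube)
  also have "\<dots> = y powi d * (plus_coeff 1 m * minus_coeff 1 n) * Z / 2"
    unfolding W using y(1) P by (simp add: plus_coeff_def minus_coeff_def G_def mult_ac)
  finally show ?thesis unfolding y_def Z_def .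
qed

lemma residue_at_minus_q_power:
  fixes d :: int
  assumes N: "N = m + n" and e: "int e = 4 * int N + 1 + d"
  shows "2 * q ^ (N * N + N) * residue (\<lambda>z. z ^ e / kernel_denom N z) (- (q ^ m)) =
    (- (q ^ m)) powi d * (plus_coeff (-1) m * minus_coeff (-1) n) / 4"
proof -
  define y where "y = q ^ m"
  have y: "y \<noteq> 0" "y\<^sup>2 = q ^ (2 * m)" using q_nz by (auto simp: y_def power_mult mult.commute)
  have N2: "2 * N = 2 * m + 2 * n" using N by simp
  define P where "P = (tri_power q m)\<^sup>2 * tri_power q (2 * m) * (y ^ (2 * n) * (q ^ (2 * m)) ^ (2 * n))"
  define G where "G = (qpoch (-1 * q) q m)\<^sup>2 * qpoch q q (2 * m) * ((qpoch (-1 * q) q n)\<^sup>2 * qpoch q q (2 * n))"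
  have "(\<Prod>j\<le>N. - y - q ^ j) = (- y - q ^ m) * (\<Prod>j\<in>{..N} - {m}. - y - q ^ j)"
    using N by (intro prod.remove) auto
  also have "(\<Prod>j\<in>{..N} - {m}. - y - q ^ j) = (\<Prod>j\<in>{..m + n} - {m}. -1 * q ^ m - q ^ j)"
    by (simp add: y_def N)
  finally have "(\<Prod>j\<le>N. - y - q ^ j)\<^sup>2 = (- y - q ^ m)\<^sup>2 * (\<Prod>j\<in>{..m + n} - {m}. -1 * q ^ m - q ^ j)\<^sup>2"
    by (simp only: power_mult_distrib)
  also have "(- y - q ^ m)\<^sup>2 = 4 * y\<^sup>2"
    by (simp add: y_def power2_eq_square algebra_simps)
  also have "(\<Prod>j\<in>{..m + n} - {m}. -1 * q ^ m - q ^ j)\<^sup>2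
      = (tri_power q m)\<^sup>2 * (qpoch (-1 * q) q m)\<^sup>2 * (y ^ (2 * n) * (qpoch (-1 * q) q n)\<^sup>2)"
    using prod_scaled_off_diagonal_sq[of "-1" m n] by (simp add: y_def)
  finally have prods: "(\<Prod>j\<le>N. - y - q ^ j)\<^sup>2 * (\<Prod>k\<in>{..2*N} - {2*m}. q ^ (2 * m) - q ^ k) = 4 * y\<^sup>2 * (P * G)"
    unfolding N2 prod_even_off_diagonal P_def G_def by (simp only: mult_ac)
  have res: "residue (\<lambda>z. z ^ e / kernel_denom N z) (- y) = (- y) ^ e / (4 * y\<^sup>2 * (P * G) * (2 * - y))"
    unfolding prods[symmetric]
  proof (rule residue_kernel_simple)
    show "(- y)\<^sup>2 = q ^ (2 * m)" using y by simp
    show "2 * m \<le> 2 * N" using N by simp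
    show "- y \<noteq> q ^ j" for j
      unfolding y_def q_power using s_power_neq_minus by metis
  qed
  have ye: "(- y) ^ e = - (y ^ (4 * N + 1)) * (- y) powi d"
    using power_split_powi[of "- y" e "4 * N + 1" d] y e by (simp add: power_mult)
  have P: "P \<noteq> 0" using q_nz by (auto simp: P_def y_def tri_power_def)
  have W: "q ^ (N * N + N) * y ^ (4 * N + 1) = q ^ (m * (2 * m + 1)) * q ^ (n * (n + 1)) * (P * y ^ 3)"
    unfolding y_def P_def using weight_integer[OF N] by simp
  have "2 * q ^ (N * N + N) * residue (\<lambda>z. z ^ e / kernel_denom N z) (- y)
      = (q ^ (N * N + N) * y ^ (4 * N + 1)) * (- y) powi d / (P * y ^ 3 * G) / 4"
    unfolding res ye using y(1) P by (simp add: field_simps power2_eq_square power3_eq_cube)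
  also have "\<dots> = (- y) powi d * (plus_coeff (-1) m * minus_coeff (-1) n) / 4"
    unfolding W using y(1) P by (simp add: plus_coeff_def minus_coeff_def G_def mult_ac)
  finally show ?thesis unfolding y_def .
qed

lemma qpoch_Suc_left: "qpoch a q (Suc n) = (1 - a) * qpoch (a * q) q n"
  unfolding qpoch_def prod.lessThan_Suc_shift by (simp add: mult.assoc mult.commute)

text \<open>
  The analogue of the previous weight for the poles $\pm s q^m$. Here $m + n = N - 1$, since there is
  one half-integral power fewer.
\<close>

lemma weight_half:
  assumes "N = m + n + 1"
  shows "q ^ (N * N + N) * (q ^ (2 * m + 1)) ^ (2 * N) = q * (q ^ ((2 * m + 1) * (m + 1)) * q ^ (n * (n + 2))) *
     ((tri_power q (m + 1))\<^sup>2 * tri_power q (2 * m + 1) * ((q ^ (2 * m + 1)) ^ (n + 1) * (q ^ (2 * m + 1)) ^ (2 * n + 1)))"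
proof -
  have tri: "(tri_power q (m + 1))\<^sup>2 = q ^ (m * (m + 1))"
  proof -
    have "(tri_power q (m + 1))\<^sup>2 * q ^ (m + 1) = q ^ (m * (m + 1)) * q ^ (m + 1)"
      unfolding tri_power_sq power_add[symmetric] by (simp add: algebra_simps)
    then show ?thesis using q_nz by simp
  qed
  have "q * (q ^ ((2 * m + 1) * (m + 1)) * q ^ (n * (n + 2))) *
     ((tri_power q (m + 1))\<^sup>2 * tri_power q (2 * m + 1) * ((q ^ (2 * m + 1)) ^ (n + 1) * (q ^ (2 * m + 1)) ^ (2 * n + 1)))
     = q ^ (1 + ((2 * m + 1) * (m + 1) + n * (n + 2)) + (m * (m + 1) + (2 * m * m + m) + ((2 * m + 1) * (n + 1) + (2 * m + 1) * (2 * n + 1))))"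
    unfolding tri tri_power_odd by (simp only: power_add power_mult power_one_right)
  also have "1 + ((2 * m + 1) * (m + 1) + n * (n + 2)) + (m * (m + 1) + (2 * m * m + m) + ((2 * m + 1) * (n + 1) + (2 * m + 1) * (2 * n + 1)))
     = N * N + N + (2 * m + 1) * (2 * N)"
    unfolding assms by (simp add: algebra_simps)
  finally show ?thesis by (simp only: power_add power_mult)
qed

text \<open>
  No squared factor vanishes here, so both the indices below and above contribute one factor $1 - x$
  more than the coefficients contain. This explains $(1-x)^4$, which the prefactors of columns 3 and 5
  supply.
\<close>

lemma residue_at_half_power:
  fixes d :: int
  assumes x: "x\<^sup>2 = q" and N: "N = m + n + 1" and e: "int e = 4 * int N + 1 + d"
    and off: "\<And>j. x * q ^ m \<noteq> q ^ j"
  shows "2 * q ^ (N * N + N) * residue (\<lambda>z. z ^ e / kernel_denom N z) (x * q ^ m) =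
    - ((x * q ^ m) powi d * (plus_coeff_half x m * minus_coeff_half x n) * (q / (1 - x) ^ 4))"
proof -
  define y where "y = x * q ^ m"
  have xnz: "x \<noteq> 0" using x q_nz by auto
  have y: "y \<noteq> 0" "y\<^sup>2 = q ^ (2 * m + 1)"
  proof -
    have "y\<^sup>2 = x\<^sup>2 * q ^ (2 * m)" by (simp add: y_def power_mult_distrib power_even_eq)
    then show "y\<^sup>2 = q ^ (2 * m + 1)" unfolding x by simp
  qed (use q_nz xnz in \<open>auto simp: y_def\<close>)
  have N2: "2 * N = (2 * m + 1) + (2 * n + 1)" using N by simp
  define P where "P = (tri_power q (m + 1))\<^sup>2 * tri_power q (2 * m + 1) * ((q ^ (2 * m + 1)) ^ (n + 1) * (q ^ (2 * m + 1)) ^ (2 * n + 1))"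
  define G where "G = (qpoch (x * q) q m)\<^sup>2 * qpoch q q (2 * m + 1) * ((qpoch (x * q) q n)\<^sup>2 * qpoch q q (2 * n + 1))"
  have "(\<Prod>j\<le>N. y - q ^ j) = (\<Prod>i<m + 1. y - q ^ i) * (\<Prod>i<n + 1. y - q ^ (m + 1 + i))"
  proof -
    have "(\<Prod>j<M + K. f j) = (\<Prod>i<M. f i) * (\<Prod>i<K. f (M + i) :: complex)" for f and M K :: nat
      by (induction K) auto
    moreover have "{..N} = {..<(m + 1) + (n + 1)}" using N by auto
    ultimately show ?thesis by (simp only:)
  qed
  also have "(\<Prod>i<m + 1. y - q ^ i) = (-1) ^ (m + 1) * tri_power q (m + 1) * ((1 - x) * qpoch (x * q) q m)"
  proof -
    have "y = x / q * q ^ (m + 1)" using q_nz by (simp add: y_def)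
    then have "(\<Prod>i<m + 1. y - q ^ i) = (-1) ^ (m + 1) * tri_power q (m + 1) * qpoch (x / q * q) q (m + 1)"
      using prod_below[of "x / q" "m + 1"] by (simp only:)
    then show ?thesis using q_nz qpoch_Suc_left[of x m] by simp
  qed
  also have "(\<Prod>i<n + 1. y - q ^ (m + 1 + i)) = y ^ (n + 1) * ((1 - x) * qpoch (x * q) q n)"
  proof -
    have "q ^ (m + 1) / y = x"
      using q_nz xnz x by (simp add: y_def field_simps power2_eq_square)
    then show ?thesis using prod_above[OF y(1), of "m + 1" "n + 1"] qpoch_Suc_left[of x n] by simp
  qed
  finally have "(\<Prod>j\<le>N. y - q ^ j)\<^sup>2 = (1 - x) ^ 4 * ((tri_power q (m + 1))\<^sup>2 * ((qpoch (x * q) q m)\<^sup>2 * (qpoch (x * q) q n)\<^sup>2) * (y\<^sup>2) ^ (n + 1))"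
    by (simp add: power_mult_distrib power_even_eq[symmetric] power_mult[symmetric] mult_ac flip: power_mult)
  then have prods: "(\<Prod>j\<le>N. y - q ^ j)\<^sup>2 * (\<Prod>k\<in>{..2*N} - {2*m+1}. q ^ (2 * m + 1) - q ^ k)
      = - ((1 - x) ^ 4 * (P * G))"
    unfolding N2 prod_q_powers_off_diagonal P_def G_def y(2)
    by (simp only: power_mult) (simp add: mult_ac)
  have res: "residue (\<lambda>z. z ^ e / kernel_denom N z) y = y ^ e / (- ((1 - x) ^ 4 * (P * G)) * (2 * y))"
    unfolding prods[symmetric]
    by (rule residue_kernel_simple) (use y(2) N off in \<open>auto simp: y_def\<close>)
  have ye: "y ^ e = (y\<^sup>2) ^ (2 * N) * y * y powi d"
    using power_split_powi[of y e "4 * N + 1" d] y(1) e by (simp flip: power_mult)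
  have P: "P \<noteq> 0" using q_nz by (auto simp: P_def tri_power_def)
  have W: "q ^ (N * N + N) * (y\<^sup>2) ^ (2 * N) = q * (q ^ ((2 * m + 1) * (m + 1)) * q ^ (n * (n + 2))) * P"
    unfolding y(2) P_def by (rule weight_half[OF N])
  have "2 * q ^ (N * N + N) * residue (\<lambda>z. z ^ e / kernel_denom N z) y
      = - ((q ^ (N * N + N) * (y\<^sup>2) ^ (2 * N)) * y powi d / (P * G) / (1 - x) ^ 4)"
    unfolding res ye using y(1) P by (simp add: field_simps)
  also have "\<dots> = - (y powi d * (plus_coeff_half x m * minus_coeff_half x n) * (q / (1 - x) ^ 4))"
    unfolding W using P by (simp add: plus_coeff_half_def minus_coeff_half_def G_def mult_ac)
  finally show ?thesis unfolding y_def .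
qed

end

section \<open>Lambert series and convergence\<close>

context punctured_disc
begin

lemma norm_one_minus_ge:
  assumes "norm t \<le> 1"
  shows "1 - norm q \<le> norm (1 - t * q ^ Suc i)"
proof -
  have "norm (t * q ^ Suc i) \<le> 1 * norm q ^ Suc i"
    unfolding norm_mult norm_power using assms by (intro mult_right_mono) auto
  also have "\<dots> \<le> norm q ^ 1"
    using power_decreasing[of 1 "Suc i" "norm q"] norm_q by simp
  finally show ?thesis
    using norm_triangle_ineq2[of 1 "t * q ^ Suc i"] by simp
qed

lemma summable_E_series:
  assumes "k \<le> 2"
  shows "summable (\<lambda>i. of_nat (Suc i) ^ (k - 1) * q ^ (Suc i * (m + 1)) / (1 - q ^ Suc i))"
proof (rule summable_comparison_test')
  have "summable (\<lambda>i. of_nat (Suc i) * norm q ^ i)"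
    by (rule sums_summable[OF geometric_deriv_sums]) (use norm_q in simp)
  then show "summable (\<lambda>i. of_nat (Suc i) * norm q ^ i / (1 - norm q))"
    by (rule summable_divide)
  fix i :: nat
  have "real (Suc i) ^ (k - 1) \<le> real (Suc i) ^ 1"
    by (rule power_increasing) (use assms in auto)
  moreover have "norm q ^ (Suc i * (m + 1)) \<le> norm q ^ i"
    by (rule power_decreasing) (use norm_q in auto)
  moreover have "1 - norm q \<le> norm (1 - q ^ Suc i)"
    using norm_one_minus_ge[of 1 i] by simp
  ultimately have "real (Suc i) ^ (k - 1) * norm q ^ (Suc i * (m + 1)) / norm (1 - q ^ Suc i)
      \<le> real (Suc i) * norm q ^ i / (1 - norm q)"
    using norm_q by (intro frac_le mult_mono) auto
  then show "norm (of_nat (Suc i) ^ (k - 1) * q ^ (Suc i * (m + 1)) / (1 - q ^ Suc i))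
      \<le> of_nat (Suc i) * norm q ^ i / (1 - norm q)"
    by (simp only: norm_divide norm_mult norm_power norm_of_nat)
qed

text \<open>
  The difference cancels the denominators $1 - q^s$ and leaves a geometric series or its derivative.
\<close>

lemma E_series_step:
  assumes "k \<in> {1, 2}"
  shows "E_series k m q - E_series k (Suc m) q = q ^ Suc m / (1 - q ^ Suc m) ^ k"
proof -
  have k: "k \<le> 2" using assms by auto
  define w where "w = q ^ Suc m"
  have w: "norm w < 1" using norm_q by (simp add: w_def norm_power power_less_one_iff del: power_Suc)
  have "E_series k m q - E_series k (Suc m) q
      = (\<Sum>i. of_nat (Suc i) ^ (k - 1) * q ^ (Suc i * (m + 1)) / (1 - q ^ Suc i)
             - of_nat (Suc i) ^ (k - 1) * q ^ (Suc i * (Suc m + 1)) / (1 - q ^ Suc i))"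
    unfolding E_series_def by (intro suminf_diff summable_E_series k)
  also have "\<dots> = (\<Sum>i. of_nat (Suc i) ^ (k - 1) * w ^ Suc i)"
  proof (intro arg_cong[of _ _ suminf] ext)
    fix i :: nat
    have e: "q ^ (Suc i * (m + 1)) = w ^ Suc i" "q ^ (Suc i * (Suc m + 1)) = w ^ Suc i * q ^ Suc i"
      unfolding w_def power_mult[symmetric] power_add[symmetric] by (simp_all add: algebra_simps)
    show "of_nat (Suc i) ^ (k - 1) * q ^ (Suc i * (m + 1)) / (1 - q ^ Suc i)
             - of_nat (Suc i) ^ (k - 1) * q ^ (Suc i * (Suc m + 1)) / (1 - q ^ Suc i)
         = of_nat (Suc i) ^ (k - 1) * w ^ Suc i"
      unfolding e using one_minus_q_power_nz[of i]
      by (simp add: diff_divide_distrib[symmetric] algebra_simps del: power_Suc of_nat_Suc)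
         (simp add: field_simps del: power_Suc of_nat_Suc)
  qed
  also have "\<dots> = w / (1 - w) ^ k"
  proof (cases "k = 1")
    case True
    have "(\<lambda>i. w * w ^ i) sums (w * (1 / (1 - w)))"
      by (intro sums_mult geometric_sums w)
    then show ?thesis using True by (simp add: sums_iff)
  next
    case False
    then have "k = 2" using assms by simp
    have "(\<lambda>i. w * (of_nat (Suc i) * w ^ i)) sums (w * (1 / (1 - w)\<^sup>2))"
      by (intro sums_mult geometric_deriv_sums w)
    then show ?thesis using \<open>k = 2\<close> by (simp add: sums_iff mult_ac)
  qed
  finally show ?thesis by (simp add: w_def)
qed

lemma E_series_1_eq: "E_series 1 m q = E_series 1 0 q - lambert1 q m"
proof (induction m)
  case (Suc m)
  then show ?case using E_series_step[of 1 m] by (simp add: lambert1_def algebra_simps)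
qed (simp add: lambert1_def)

lemma E_series_2_eq: "E_series 2 m q = E_series 2 0 q - lambert2 q m"
proof (induction m)
  case (Suc m)
  then show ?case using E_series_step[of 2 m] by (simp add: lambert2_def algebra_simps)
qed (simp add: lambert2_def)

end

text \<open>
  All factors of the coefficients except a Gaussian power $q^{m^2}$ grow at most exponentially, and
  this crude class is closed under the operations that occur.
\<close>

definition exp_bounded :: "(nat \<Rightarrow> complex) \<Rightarrow> bool" where
  "exp_bounded f \<longleftrightarrow> (\<exists>C\<ge>1. \<forall>m. norm (f m) \<le> C ^ Suc m)"

lemma exp_boundedI:
  assumes "\<And>m. norm (f m) \<le> K * B ^ m"
  shows "exp_bounded f"
proof -
  define C where "C = max 1 (max \<bar>K\<bar> \<bar>B\<bar>)"
  have C: "C \<ge> 1" "\<bar>K\<bar> \<le> C" "\<bar>B\<bar> \<le> C" by (auto simp: C_def)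
  have "norm (f m) \<le> C ^ Suc m" for m
  proof -
    have "norm (f m) \<le> \<bar>K * B ^ m\<bar>" using assms[of m] by linarith
    also have "\<dots> = \<bar>K\<bar> * \<bar>B\<bar> ^ m" by (simp add: abs_mult power_abs)
    also have "\<dots> \<le> C * C ^ m" using C by (intro mult_mono power_mono) auto
    finally show ?thesis by simp
  qed
  then show ?thesis using C unfolding exp_bounded_def by blast
qed

lemma exp_bounded_const [simp]: "exp_bounded (\<lambda>_. c)"
  by (rule exp_boundedI[of _ "norm c" 1]) simp

lemma exp_bounded_power: "exp_bounded (\<lambda>m. c ^ m)"
  by (rule exp_boundedI[of _ 1 "norm c"]) (simp add: norm_power)

lemma exp_bounded_of_nat: "exp_bounded (\<lambda>m. of_nat m)"
  by (rule exp_boundedI[of _ 1 2]) (simp add: less_imp_le of_nat_less_two_power)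

lemma exp_bounded_mult:
  assumes "exp_bounded f" "exp_bounded g"
  shows "exp_bounded (\<lambda>m. f m * g m)"
proof -
  obtain C where C: "C \<ge> 1" "\<And>m. norm (f m) \<le> C ^ Suc m" using assms(1) unfolding exp_bounded_def by blast
  obtain D where D: "D \<ge> 1" "\<And>m. norm (g m) \<le> D ^ Suc m" using assms(2) unfolding exp_bounded_def by blast
  have "norm (f m * g m) \<le> (C * D) * (C * D) ^ m" for m
  proof -
    have "norm (f m * g m) \<le> C ^ Suc m * D ^ Suc m"
      unfolding norm_mult using C D by (intro mult_mono) auto
    then show ?thesis by (simp add: power_mult_distrib mult_ac)
  qed
  then show ?thesis by (rule exp_boundedI)
qed

lemma exp_bounded_add:
  assumes "exp_bounded f" "exp_bounded g"
  shows "exp_bounded (\<lambda>m. f m + g m)"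
proof -
  obtain C where C: "C \<ge> 1" "\<And>m. norm (f m) \<le> C ^ Suc m" using assms(1) unfolding exp_bounded_def by blast
  obtain D where D: "D \<ge> 1" "\<And>m. norm (g m) \<le> D ^ Suc m" using assms(2) unfolding exp_bounded_def by blast
  have "norm (f m + g m) \<le> (2 * max C D) * (max C D) ^ m" for m
  proof -
    have "norm (f m + g m) \<le> C ^ Suc m + D ^ Suc m"
      using C(2)[of m] D(2)[of m] norm_triangle_ineq[of "f m" "g m"] by linarith
    also have "\<dots> \<le> max C D ^ Suc m + max C D ^ Suc m"
      using C(1) D(1) by (intro add_mono power_mono) auto
    finally show ?thesis by simp
  qed
  then show ?thesis by (rule exp_boundedI)
qed

lemma exp_bounded_minus: "exp_bounded f \<Longrightarrow> exp_bounded (\<lambda>m. - f m)"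
  unfolding exp_bounded_def by simp

lemma exp_bounded_diff: "exp_bounded f \<Longrightarrow> exp_bounded g \<Longrightarrow> exp_bounded (\<lambda>m. f m - g m)"
  using exp_bounded_add[OF _ exp_bounded_minus, of f g] by simp

lemma exp_bounded_double:
  assumes "exp_bounded f"
  shows "exp_bounded (\<lambda>m. f (2 * m))"
proof -
  obtain C where C: "C \<ge> 1" "\<And>m. norm (f m) \<le> C ^ Suc m" using assms unfolding exp_bounded_def by blast
  have "norm (f (2 * m)) \<le> C * (C\<^sup>2) ^ m" for m
    using C(2)[of "2 * m"] by (simp add: power_mult)
  then show ?thesis by (rule exp_boundedI)
qed

lemma exp_bounded_Suc:
  assumes "exp_bounded f"
  shows "exp_bounded (\<lambda>m. f (Suc m))"
proof -
  obtain C where C: "C \<ge> 1" "\<And>m. norm (f m) \<le> C ^ Suc m" using assms unfolding exp_bounded_def by blast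
  have "norm (f (Suc m)) \<le> C\<^sup>2 * C ^ m" for m
    using C(2)[of "Suc m"] by (simp add: power2_eq_square mult_ac)
  then show ?thesis by (rule exp_boundedI)
qed

context punctured_disc
begin

text \<open>
  Eventually $|q|^m C \le 1/2$, so the Gaussian factor beats any exponential.
\<close>

lemma summable_gaussian:
  assumes "exp_bounded f"
  shows "summable (\<lambda>m. norm (q ^ (m * m) * f m))"
proof -
  obtain C where C: "C \<ge> 1" "\<And>m. norm (f m) \<le> C ^ Suc m" using assms unfolding exp_bounded_def by blast
  have "(\<lambda>m. norm q ^ m * C) \<longlonglongrightarrow> 0 * C"
    by (intro tendsto_intros LIMSEQ_power_zero) (use norm_q in auto)
  then have "eventually (\<lambda>m. norm q ^ m * C < 1 / 2) sequentially"
    by (intro order_tendstoD(2)) auto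
  then have "eventually (\<lambda>m. norm (norm (q ^ (m * m) * f m)) \<le> C * (1 / 2) ^ m) sequentially"
  proof eventually_elim
    case (elim m)
    have "norm (q ^ (m * m) * f m) \<le> norm q ^ (m * m) * C ^ Suc m"
      unfolding norm_mult norm_power using C(2)[of m] by (intro mult_left_mono) auto
    also have "\<dots> = C * (norm q ^ m * C) ^ m" by (simp add: power_mult power_mult_distrib)
    also have "\<dots> \<le> C * (1 / 2) ^ m"
      using elim C by (intro mult_left_mono power_mono) auto
    finally show ?case by simp
  qed
  then show ?thesis
    by (rule summable_comparison_test_ev) (intro summable_mult summable_geometric, simp)
qed

text \<open>
  Every factor of the denominator has modulus at least $1 - |q|$, which gives a geometric bound.
\<close>

lemma exp_bounded_inverse_qpoch:
  assumes "norm t \<le> 1"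
  shows "exp_bounded (\<lambda>m. inverse (qpoch (t * q) q m))"
proof (rule exp_boundedI[of _ 1])
  fix m :: nat
  have "norm (inverse (qpoch (t * q) q m)) = (\<Prod>i<m. 1 / norm (1 - t * q ^ Suc i))"
    unfolding qpoch_def by (induction m) (simp_all add: norm_mult norm_inverse divide_inverse mult.assoc)
  also have "\<dots> \<le> (\<Prod>i<m. 1 / (1 - norm q))"
    by (rule prod_mono) (use norm_one_minus_ge[OF assms] norm_q in \<open>auto intro!: frac_le simp del: power_Suc\<close>)
  finally show "norm (inverse (qpoch (t * q) q m)) \<le> 1 * (1 / (1 - norm q)) ^ m" by simp
qed

lemma exp_bounded_sum:
  assumes "\<And>i. norm (f i) \<le> K"
  shows "exp_bounded (\<lambda>m. \<Sum>i<m. f i)"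
proof (rule exp_boundedI[of _ K 2])
  fix m :: nat
  have "norm (\<Sum>i<m. f i) \<le> of_nat m * K"
    using sum_norm_bound[of "{..<m}" f K] assms by simp
  also have "\<dots> \<le> 2 ^ m * K"
    using assms[of 0] norm_ge_zero[of "f 0"]
    by (intro mult_right_mono) (auto simp: less_imp_le of_nat_less_two_power simp del: norm_ge_zero)
  finally show "norm (\<Sum>i<m. f i) \<le> K * 2 ^ m" by (simp add: mult_ac)
qed

lemma norm_lambert_term: "norm (q ^ Suc i / (1 - q ^ Suc i) ^ k) \<le> 1 / (1 - norm q) ^ k"
proof -
  have "norm q ^ Suc i \<le> 1" using norm_q by (intro power_le_one) auto
  then show ?thesis
    unfolding norm_divide norm_power using norm_one_minus_ge[of 1 i] norm_q
    by (intro frac_le power_mono) (auto simp del: power_Suc)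
qed

lemma exp_bounded_lambert1: "exp_bounded (lambert1 q)"
  unfolding lambert1_def[abs_def] by (rule exp_bounded_sum) (use norm_lambert_term[of _ 1] in simp)

lemma exp_bounded_lambert2: "exp_bounded (lambert2 q)"
  unfolding lambert2_def[abs_def] by (rule exp_bounded_sum) (rule norm_lambert_term)

lemma exp_bounded_power_le: "exp_bounded (\<lambda>m. q ^ k m)"
  by (rule exp_boundedI[of _ 1 1]) (use norm_q in \<open>simp add: norm_power power_le_one\<close>)

lemma exp_bounded_powi: "exp_bounded (\<lambda>m. (q ^ m) powi l)"
  by (rule exp_boundedI[of _ 1 "norm (q powi l)"])
     (simp add: norm_power norm_power_int power_int_power power_int_power' mult.commute)

definition gaussian :: "(nat \<Rightarrow> complex) \<Rightarrow> bool" where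
  "gaussian c \<longleftrightarrow> (\<exists>f. exp_bounded f \<and> c = (\<lambda>m. q ^ (m * m) * f m))"

lemma gaussian_mult:
  assumes "gaussian c" "exp_bounded g"
  shows "gaussian (\<lambda>m. c m * g m)" "gaussian (\<lambda>m. g m * c m)"
proof -
  obtain f where "exp_bounded f" "c = (\<lambda>m. q ^ (m * m) * f m)"
    using assms(1) unfolding gaussian_def by auto
  then have "exp_bounded (\<lambda>m. f m * g m) \<and> (\<lambda>m. c m * g m) = (\<lambda>m. q ^ (m * m) * (f m * g m))"
    using assms(2) by (auto intro!: exp_bounded_mult)
  then show "gaussian (\<lambda>m. c m * g m)" unfolding gaussian_def by blast
  then show "gaussian (\<lambda>m. g m * c m)" by (simp only: mult.commute)
qed

lemma gaussian_summable: "gaussian c \<Longrightarrow> summable (\<lambda>m. norm (c m))"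
  unfolding gaussian_def using summable_gaussian by auto

lemma gaussian_plus_coeff:
  assumes "norm t \<le> 1"
  shows "gaussian (plus_coeff t)"
proof -
  have "plus_coeff t = (\<lambda>m. q ^ (m * m) * (q ^ (m * m + m) * (inverse (qpoch (t * q) q m) * inverse (qpoch (t * q) q m)
      * inverse (qpoch (1 * q) q (2 * m)))))"
  proof
    fix m :: nat
    have "m * (2 * m + 1) = m * m + (m * m + m)" by (simp add: algebra_simps)
    then have e: "q ^ (m * (2 * m + 1)) = q ^ (m * m) * q ^ (m * m + m)" by (simp only: power_add)
    show "plus_coeff t m = q ^ (m * m) * (q ^ (m * m + m) * (inverse (qpoch (t * q) q m) * inverse (qpoch (t * q) q m)
      * inverse (qpoch (1 * q) q (2 * m))))"
      unfolding plus_coeff_def e by (simp add: divide_inverse power2_eq_square mult_ac)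
  qed
  moreover have "exp_bounded (\<lambda>m. q ^ (m * m + m) * (inverse (qpoch (t * q) q m) * inverse (qpoch (t * q) q m)
      * inverse (qpoch (1 * q) q (2 * m))))"
    by (intro exp_bounded_mult exp_bounded_power_le exp_bounded_inverse_qpoch assms
         exp_bounded_double[where f = "\<lambda>m. inverse (qpoch (1 * q) q m)"]) auto
  ultimately show ?thesis unfolding gaussian_def by blast
qed

lemma gaussian_minus_coeff:
  assumes "norm t \<le> 1"
  shows "gaussian (minus_coeff t)"
proof -
  have "minus_coeff t = (\<lambda>m. q ^ (m * m) * (q ^ m * (inverse (qpoch (t * q) q m) * inverse (qpoch (t * q) q m)
      * inverse (qpoch (1 * q) q (2 * m)))))"
  proof
    fix m :: nat
    have "m * (m + 1) = m * m + m" by (simp add: algebra_simps)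
    then have e: "q ^ (m * (m + 1)) = q ^ (m * m) * q ^ m" by (simp only: power_add)
    show "minus_coeff t m = q ^ (m * m) * (q ^ m * (inverse (qpoch (t * q) q m) * inverse (qpoch (t * q) q m)
      * inverse (qpoch (1 * q) q (2 * m))))"
      unfolding minus_coeff_def e by (simp add: divide_inverse power2_eq_square mult_ac)
  qed
  moreover have "exp_bounded (\<lambda>m. q ^ m * (inverse (qpoch (t * q) q m) * inverse (qpoch (t * q) q m)
      * inverse (qpoch (1 * q) q (2 * m))))"
    by (intro exp_bounded_mult exp_bounded_power_le exp_bounded_inverse_qpoch assms
         exp_bounded_double[where f = "\<lambda>m. inverse (qpoch (1 * q) q m)"]) auto
  ultimately show ?thesis unfolding gaussian_def by blast
qed

lemma exp_bounded_inverse_qpoch_odd: "exp_bounded (\<lambda>m. inverse (qpoch (1 * q) q (2 * m + 1)))"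
  using exp_bounded_double[OF exp_bounded_Suc[OF exp_bounded_inverse_qpoch[of 1]]] by simp

lemma gaussian_plus_coeff_half:
  assumes "norm x \<le> 1"
  shows "gaussian (plus_coeff_half x)"
proof -
  have "plus_coeff_half x = (\<lambda>m. q ^ (m * m) * (q ^ (m * m + 3 * m + 1) * (inverse (qpoch (x * q) q m) * inverse (qpoch (x * q) q m)
      * inverse (qpoch (1 * q) q (2 * m + 1)))))"
  proof
    fix m :: nat
    have "(2 * m + 1) * (m + 1) = m * m + (m * m + 3 * m + 1)" by (simp add: algebra_simps)
    then have e: "q ^ ((2 * m + 1) * (m + 1)) = q ^ (m * m) * q ^ (m * m + 3 * m + 1)" by (simp only: power_add)
    show "plus_coeff_half x m = q ^ (m * m) * (q ^ (m * m + 3 * m + 1) * (inverse (qpoch (x * q) q m) * inverse (qpoch (x * q) q m)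
      * inverse (qpoch (1 * q) q (2 * m + 1))))"
      unfolding plus_coeff_half_def e by (simp add: divide_inverse power2_eq_square mult_ac)
  qed
  moreover have "exp_bounded (\<lambda>m. q ^ (m * m + 3 * m + 1) * (inverse (qpoch (x * q) q m) * inverse (qpoch (x * q) q m)
      * inverse (qpoch (1 * q) q (2 * m + 1))))"
    by (intro exp_bounded_mult exp_bounded_power_le exp_bounded_inverse_qpoch assms exp_bounded_inverse_qpoch_odd)
  ultimately show ?thesis unfolding gaussian_def by blast
qed

lemma gaussian_minus_coeff_half:
  assumes "norm x \<le> 1"
  shows "gaussian (minus_coeff_half x)"
proof -
  have "minus_coeff_half x = (\<lambda>m. q ^ (m * m) * (q ^ (2 * m) * (inverse (qpoch (x * q) q m) * inverse (qpoch (x * q) q m)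
      * inverse (qpoch (1 * q) q (2 * m + 1)))))"
  proof
    fix m :: nat
    have "m * (m + 2) = m * m + 2 * m" by (simp add: algebra_simps)
    then have e: "q ^ (m * (m + 2)) = q ^ (m * m) * q ^ (2 * m)" by (simp only: power_add)
    show "minus_coeff_half x m = q ^ (m * m) * (q ^ (2 * m) * (inverse (qpoch (x * q) q m) * inverse (qpoch (x * q) q m)
      * inverse (qpoch (1 * q) q (2 * m + 1))))"
      unfolding minus_coeff_half_def e by (simp add: divide_inverse power2_eq_square mult_ac)
  qed
  moreover have "exp_bounded (\<lambda>m. q ^ (2 * m) * (inverse (qpoch (x * q) q m) * inverse (qpoch (x * q) q m)
      * inverse (qpoch (1 * q) q (2 * m + 1))))"
    by (intro exp_bounded_mult exp_bounded_power_le exp_bounded_inverse_qpoch assms exp_bounded_inverse_qpoch_odd)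
  ultimately show ?thesis unfolding gaussian_def by blast
qed

lemma p_one_eq: "p_one l m q = of_int l + (4 * of_nat m + 1 - 4 * E_series 1 0 q + 2 * lambert1 q m + 2 * lambert1 q (2 * m))"
  unfolding p_one_def E_series_1_eq[of m] E_series_1_eq[of "2 * m"] by simp

lemma P_one_eq: "P_one l m q = of_int l + (2 * of_nat m + 1 - 4 * E_series 1 0 q + 2 * lambert1 q m + 2 * lambert1 q (2 * m))"
  unfolding P_one_def E_series_1_eq[of m] E_series_1_eq[of "2 * m"] by simp

lemma p_two_eq: "p_two l m q = (p_one l m q)\<^sup>2 + (2 * lambert2 q m + 4 * lambert2 q (2 * m) - 6 * E_series 2 0 q - calE2 q / 3)"
  unfolding p_two_def E_series_2_eq[of m] E_series_2_eq[of "2 * m"] by simp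

lemma P_two_eq: "P_two l m q = (P_one l m q)\<^sup>2 + (2 * lambert2 q m + 4 * lambert2 q (2 * m) + 6 * E_series 2 0 q - 1 / 2 + calE2 q / 3)"
  unfolding P_two_def E_series_2_eq[of m] E_series_2_eq[of "2 * m"] by simp

lemma exp_bounded_p_one: "exp_bounded (\<lambda>m. p_one l m q)" and exp_bounded_P_one: "exp_bounded (\<lambda>m. P_one l m q)"
  unfolding p_one_eq P_one_eq
  by (intro exp_bounded_add exp_bounded_diff exp_bounded_mult exp_bounded_const exp_bounded_of_nat
      exp_bounded_lambert1 exp_bounded_double[OF exp_bounded_lambert1])+

lemma exp_bounded_p_fun: "exp_bounded (\<lambda>m. p_fun l j m q)" and exp_bounded_P_fun: "exp_bounded (\<lambda>m. P_fun l j m q)"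
proof -
  have "exp_bounded (\<lambda>m. p_two l m q)" "exp_bounded (\<lambda>m. P_two l m q)"
    unfolding p_two_eq P_two_eq power2_eq_square
    by (intro exp_bounded_add exp_bounded_diff exp_bounded_mult exp_bounded_const exp_bounded_p_one exp_bounded_P_one
      exp_bounded_lambert2 exp_bounded_double[OF exp_bounded_lambert2])+
  then show "exp_bounded (\<lambda>m. p_fun l j m q)" "exp_bounded (\<lambda>m. P_fun l j m q)"
    using exp_bounded_p_one exp_bounded_P_one
    by (cases "j = 0"; cases "j = 1"; simp add: p_fun_def P_fun_def)+
qed

end

section \<open>The twelve families as power sums\<close>

lemma qpow_add: "qpow \<tau> (x + y) = qpow \<tau> x * qpow \<tau> y"
  unfolding qpow_def by (simp add: exp_add[symmetric] algebra_simps)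

lemma qpow_nz [simp]: "qpow \<tau> x \<noteq> 0"
  by (simp add: qpow_def)

lemma qpow_0 [simp]: "qpow \<tau> 0 = 1"
  by (simp add: qpow_def)

lemma qpow_minus: "qpow \<tau> (- x) = inverse (qpow \<tau> x)"
  using qpow_add[of \<tau> x "- x"] by (simp add: field_simps)

lemma qpow_minus_arg: "qpow (- \<tau>) x = inverse (qpow \<tau> x)"
  unfolding qpow_minus[symmetric] by (simp add: qpow_def)

lemma qpow_of_nat_mult: "qpow \<tau> (of_nat k * x) = qpow \<tau> x ^ k"
  by (induction k) (simp_all add: qpow_add algebra_simps)

lemma qpow_of_int_mult: "qpow \<tau> (of_int k * x) = qpow \<tau> x powi k"
proof (cases "k \<ge> 0")
  case True
  then show ?thesis using qpow_of_nat_mult[of \<tau> "nat k" x] by (simp add: power_int_def)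
next
  case False
  then have "qpow \<tau> (of_int k * x) = qpow \<tau> (- (of_nat (nat (- k)) * x))" by simp
  then show ?thesis using False unfolding qpow_minus qpow_of_nat_mult by (simp add: power_int_def power_inverse)
qed

lemma qpow_1 [simp]: "qpow \<tau> 1 = nome \<tau>"
  by (simp add: qpow_def nome_def)

lemma nome_nz [simp]: "nome \<tau> \<noteq> 0"
  by (simp add: nome_def)

lemma nome_minus: "nome (- \<tau>) = inverse (nome \<tau>)"
  by (simp add: nome_def exp_minus)

lemma minus_one_powi_sq: "(-1 :: complex) powi l * (-1) powi l = 1"
  using power_int_mult_distrib[of "-1::complex" "-1" l] by simp

lemma minus_one_powi_cancel: "(-1 :: complex) powi l * ((-1) powi l * w) = w"
  using minus_one_powi_sq[of l] by (simp flip: mult.assoc)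

text \<open>
  The point $\tau$ rather than $q$ is the parameter, because eighth powers of $q$ occur.
\<close>

locale unit_nome =
  fixes \<tau> :: complex
  assumes norm_nome: "norm (nome \<tau>) < 1"
begin

definition s where "s = qpow \<tau> (1/2)"
definition q where "q = nome \<tau>"

sublocale punctured_disc s q
proof
  show "s \<noteq> 0" by (simp add: s_def)
  show qs: "q = s\<^sup>2"
    using qpow_add[of \<tau> "1/2" "1/2"] by (simp add: s_def q_def power2_eq_square)
  show "norm s < 1"
    using norm_nome unfolding q_def[symmetric] qs by (simp add: norm_power power_less_one_iff)
qed

lemma qpow_half_odd: "qpow \<tau> (3/2) = s * q"
  using qpow_add[of \<tau> "1/2" 1] by (simp add: s_def q_def)

lemma qpow_of_nat: "qpow \<tau> (of_nat k) = q ^ k"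
  using qpow_of_nat_mult[of \<tau> k 1] by (simp add: q_def)

lemma qpow_half_exponent: "qpow \<tau> (of_nat k + of_int l * (of_nat m + 1/2)) = q ^ k * ((q ^ m) powi l * s powi l)"
proof -
  have "qpow \<tau> (of_int l * (of_nat m + 1/2)) = (q ^ m * s) powi l"
    unfolding qpow_of_int_mult qpow_add qpow_of_nat s_def ..
  then show ?thesis unfolding qpow_add qpow_of_nat by (simp add: power_int_mult_distrib)
qed

text \<open>
  The powers $(q^m)^\lambda$ are the only dependence on $\lambda$ of the terms, apart from the
  polynomials $p$; everything else that depends on $\lambda$ is collected in \<open>plus_factor\<close>.
\<close>

definition plus_term :: "int \<Rightarrow> nat \<Rightarrow> nat \<Rightarrow> complex" where
  "plus_term l j m = (q ^ m) powi l *
     (if j \<le> 2 then plus_coeff 1 m * p_fun l j m q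
      else if j = 3 then plus_coeff_half s m
      else if j = 4 then plus_coeff (-1) m
      else plus_coeff_half (- s) m)"

definition minus_term :: "int \<Rightarrow> nat \<Rightarrow> nat \<Rightarrow> complex" where
  "minus_term l j n = (q ^ n) powi l *
     (if j \<le> 2 then minus_coeff 1 n * P_fun l j n q
      else if j = 3 then minus_coeff_half s n
      else if j = 4 then minus_coeff (-1) n
      else minus_coeff_half (- s) n)"

definition plus_factor :: "int \<Rightarrow> nat \<Rightarrow> complex" where
  "plus_factor l j =
     (if j \<le> 2 then (-1) powi l
      else if j = 3 then qpow \<tau> (1/8) / (1 - s)\<^sup>2 * (- s) powi l
      else if j = 4 then 1
      else qpow \<tau> (1/8) / (1 + s)\<^sup>2 * s powi l)"

definition minus_factor :: "int \<Rightarrow> nat \<Rightarrow> complex" where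
  "minus_factor l j =
     (if j \<le> 2 then (-1) powi l
      else if j = 3 then qpow \<tau> (-1/8) / (1 - inverse s)\<^sup>2 * (- s) powi l
      else if j = 4 then 1
      else qpow \<tau> (-1/8) / (1 + inverse s)\<^sup>2 * s powi l)"

lemma norm_s_le [simp]: "norm s \<le> 1" using norm_s by simp

lemma summable_plus_term: "summable (\<lambda>m. norm (plus_term l j m))"
proof (rule gaussian_summable)
  have "gaussian (\<lambda>m. plus_coeff 1 m * p_fun l j m q)"
    by (intro gaussian_mult gaussian_plus_coeff exp_bounded_p_fun) auto
  moreover have "gaussian (plus_coeff (-1))" "gaussian (plus_coeff_half s)" "gaussian (plus_coeff_half (- s))"
    by (auto intro!: gaussian_plus_coeff gaussian_plus_coeff_half)
  ultimately have "gaussian (\<lambda>m. if j \<le> 2 then plus_coeff 1 m * p_fun l j m q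
      else if j = 3 then plus_coeff_half s m
      else if j = 4 then plus_coeff (-1) m
      else plus_coeff_half (- s) m)"
    by (cases "j \<le> 2"; cases "j = 3"; cases "j = 4"; simp)
  then show "gaussian (plus_term l j)"
    unfolding plus_term_def[abs_def] by (intro gaussian_mult exp_bounded_powi)
qed

lemma summable_minus_term: "summable (\<lambda>m. norm (minus_term l j m))"
proof (rule gaussian_summable)
  have "gaussian (\<lambda>m. minus_coeff 1 m * P_fun l j m q)"
    by (intro gaussian_mult gaussian_minus_coeff exp_bounded_P_fun) auto
  moreover have "gaussian (minus_coeff (-1))" "gaussian (minus_coeff_half s)" "gaussian (minus_coeff_half (- s))"
    by (auto intro!: gaussian_minus_coeff gaussian_minus_coeff_half)
  ultimately have "gaussian (\<lambda>m. if j \<le> 2 then minus_coeff 1 m * P_fun l j m q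
      else if j = 3 then minus_coeff_half s m
      else if j = 4 then minus_coeff (-1) m
      else minus_coeff_half (- s) m)"
    by (cases "j \<le> 2"; cases "j = 3"; cases "j = 4"; simp)
  then show "gaussian (minus_term l j)"
    unfolding minus_term_def[abs_def] by (intro gaussian_mult exp_bounded_powi)
qed

lemma powi_exponent: "q powi (int k + l * int m) = (q ^ m) powi l * q ^ k"
proof -
  have "q powi (int k + l * int m) = q powi (int k) * q powi (int m * l)"
    using q_nz by (simp add: power_int_add mult.commute[of l])
  then show ?thesis unfolding power_int_mult by simp
qed

lemma H_plus_eq:
  assumes "j < 6"
  shows "H_plus l j \<tau> = plus_factor l j * (\<Sum>m. plus_term l j m)"
proof -
  have e1: "int m * (2 * int m + 1) + l * int m = int (m * (2 * m + 1)) + l * int m"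
    "(2 * int m + 1) * int m + l * int m = int (m * (2 * m + 1)) + l * int m" for m
    by (simp_all add: algebra_simps)
  have e2: "qpow \<tau> ((2 * real m + 1) * (real m + 1) + of_int l * (real m + 1/2))
      = q ^ ((2 * m + 1) * (m + 1)) * ((q ^ m) powi l * s powi l)" for m
  proof -
    have "(2 * real m + 1) * (real m + 1) = of_nat ((2 * m + 1) * (m + 1))" by (simp add: algebra_simps)
    then show ?thesis by (simp only: qpow_half_exponent)
  qed
  consider "j \<le> 2" | "j = 3" | "j = 4" | "j = 5" using assms by linarith
  then show ?thesis
  proof cases
    case 1
    then show ?thesis
      unfolding H_plus_def Let_def q_def[symmetric] e1 powi_exponent
      by (simp add: plus_factor_def plus_term_def plus_coeff_def mult_ac)
  next
    case 2
    have "(\<Sum>m. qpow \<tau> ((2 * real m + 1) * (real m + 1) + of_int l * (real m + 1/2))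
               / ((qpoch (qpow \<tau> (3/2)) q m)\<^sup>2 * qpoch q q (2 * m + 1))) = (\<Sum>m. s powi l * plus_term l j m)"
      unfolding e2 qpow_half_odd using 2 by (simp add: plus_term_def plus_coeff_half_def mult_ac)
    also have "\<dots> = s powi l * (\<Sum>m. plus_term l j m)"
      by (rule suminf_mult[OF summable_norm_cancel[OF summable_plus_term]])
    finally have *: "(\<Sum>m. qpow \<tau> ((2 * real m + 1) * (real m + 1) + of_int l * (real m + 1/2))
               / ((qpoch (qpow \<tau> (3/2)) q m)\<^sup>2 * qpoch q q (2 * m + 1))) = s powi l * (\<Sum>m. plus_term l j m)" .
    have "(- s) powi l = (-1) powi l * s powi l"
      using power_int_mult_distrib[of "-1" s l] by simp
    then show ?thesis
      unfolding H_plus_def Let_def q_def[symmetric] * s_def[symmetric] using 2 by (simp add: plus_factor_def)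
  next
    case 3
    then show ?thesis
      unfolding H_plus_def Let_def q_def[symmetric] e1 powi_exponent
      by (simp add: plus_factor_def plus_term_def plus_coeff_def mult_ac)
  next
    case 4
    have "(\<Sum>m. qpow \<tau> ((2 * real m + 1) * (real m + 1) + of_int l * (real m + 1/2))
               / ((qpoch (- qpow \<tau> (3/2)) q m)\<^sup>2 * qpoch q q (2 * m + 1))) = (\<Sum>m. s powi l * plus_term l j m)"
      unfolding e2 qpow_half_odd using 4 by (simp add: plus_term_def plus_coeff_half_def mult_ac)
    also have "\<dots> = s powi l * (\<Sum>m. plus_term l j m)"
      by (rule suminf_mult[OF summable_norm_cancel[OF summable_plus_term]])
    finally have *: "(\<Sum>m. qpow \<tau> ((2 * real m + 1) * (real m + 1) + of_int l * (real m + 1/2))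
               / ((qpoch (- qpow \<tau> (3/2)) q m)\<^sup>2 * qpoch q q (2 * m + 1))) = s powi l * (\<Sum>m. plus_term l j m)" .
    show ?thesis
      unfolding H_plus_def Let_def q_def[symmetric] * s_def[symmetric] using 4 by (simp add: plus_factor_def)
  qed
qed

lemma qpow_minus_half: "qpow \<tau> (-1/2) = inverse s"
  using qpow_minus[of \<tau> "1/2"] by (simp add: s_def)

lemma H_minus_eq:
  assumes "j < 6"
  shows "H_minus l j \<tau> = minus_factor l j * (\<Sum>m. minus_term l j m)"
proof -
  have e1: "int m * (int m + 1) + l * int m = int (m * (m + 1)) + l * int m" for m
    by (simp add: algebra_simps)
  have e2: "qpow \<tau> (real m * (real m + 2) + of_int l * (real m + 1/2))
      = q ^ (m * (m + 2)) * ((q ^ m) powi l * s powi l)" for m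
  proof -
    have "real m * (real m + 2) = of_nat (m * (m + 2))" by (simp add: algebra_simps)
    then show ?thesis by (simp only: qpow_half_exponent)
  qed
  consider "j \<le> 2" | "j = 3" | "j = 4" | "j = 5" using assms by linarith
  then show ?thesis
  proof cases
    case 1
    then show ?thesis
      unfolding H_minus_def Let_def q_def[symmetric] e1 powi_exponent
      by (simp add: minus_factor_def minus_term_def minus_coeff_def mult_ac)
  next
    case 2
    have "(\<Sum>m. qpow \<tau> (real m * (real m + 2) + of_int l * (real m + 1/2))
               / ((qpoch (qpow \<tau> (3/2)) q m)\<^sup>2 * qpoch q q (2 * m + 1))) = (\<Sum>m. s powi l * minus_term l j m)"
      unfolding e2 qpow_half_odd using 2 by (simp add: minus_term_def minus_coeff_half_def mult_ac)
    also have "\<dots> = s powi l * (\<Sum>m. minus_term l j m)"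
      by (rule suminf_mult[OF summable_norm_cancel[OF summable_minus_term]])
    finally have *: "(\<Sum>m. qpow \<tau> (real m * (real m + 2) + of_int l * (real m + 1/2))
               / ((qpoch (qpow \<tau> (3/2)) q m)\<^sup>2 * qpoch q q (2 * m + 1))) = s powi l * (\<Sum>m. minus_term l j m)" .
    have "(- s) powi l = (-1) powi l * s powi l"
      using power_int_mult_distrib[of "-1" s l] by simp
    then show ?thesis
      unfolding H_minus_def Let_def q_def[symmetric] * qpow_minus_half using 2 by (simp add: minus_factor_def)
  next
    case 3
    then show ?thesis
      unfolding H_minus_def Let_def q_def[symmetric] e1 powi_exponent
      by (simp add: minus_factor_def minus_term_def minus_coeff_def mult_ac)
  next
    case 4
    have "(\<Sum>m. qpow \<tau> (real m * (real m + 2) + of_int l * (real m + 1/2))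
               / ((qpoch (- qpow \<tau> (3/2)) q m)\<^sup>2 * qpoch q q (2 * m + 1))) = (\<Sum>m. s powi l * minus_term l j m)"
      unfolding e2 qpow_half_odd using 4 by (simp add: minus_term_def minus_coeff_half_def mult_ac)
    also have "\<dots> = s powi l * (\<Sum>m. minus_term l j m)"
      by (rule suminf_mult[OF summable_norm_cancel[OF summable_minus_term]])
    finally have *: "(\<Sum>m. qpow \<tau> (real m * (real m + 2) + of_int l * (real m + 1/2))
               / ((qpoch (- qpow \<tau> (3/2)) q m)\<^sup>2 * qpoch q q (2 * m + 1))) = s powi l * (\<Sum>m. minus_term l j m)" .
    show ?thesis
      unfolding H_minus_def Let_def q_def[symmetric] * qpow_minus_half using 4 by (simp add: minus_factor_def)
  qed
qed

end

section \<open>The bilinear relation\<close>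

context unit_nome
begin

lemma Cauchy_product_terms:
  "(\<lambda>N. \<Sum>m\<le>N. plus_term a j m * minus_term b k (N - m)) sums
     ((\<Sum>m. plus_term a j m) * (\<Sum>n. minus_term b k n))"
  by (rule Cauchy_product_sums[OF summable_plus_term summable_minus_term])

lemma powi_merge: "(q ^ m) powi (b + d) * (q ^ n) powi b = (q ^ m) powi d * (q ^ (m + n)) powi b"
  using q_nz by (simp add: power_int_add power_add power_int_mult_distrib)

text \<open>
  The combination of the columns 0, 1, 2 that the pairing prescribes. It depends on $\lambda$ only
  through $q^{bN}$, because $p$ and $P$ enter through the difference $\delta$ alone.
\<close>

lemma triple_term:
  defines "\<delta> m n d \<equiv> of_int (4 * int m - 2 * int n + d) + 2 * lambert1 q m + 2 * lambert1 q (2 * m)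
                 - 2 * lambert1 q n - 2 * lambert1 q (2 * n)"
  shows "1/2 * (plus_term (b + d) 0 m * minus_term b 2 n) - plus_term (b + d) 1 m * minus_term b 1 n
      + 1/2 * (plus_term (b + d) 2 m * minus_term b 0 n)
    = (q ^ (m + n)) powi b * ((q ^ m) powi d * (plus_coeff 1 m * minus_coeff 1 n) *
      ((\<delta> m n d)\<^sup>2 - 1/2 + 2 * (lambert2 q m + lambert2 q n) + 4 * (lambert2 q (2 * m) + lambert2 q (2 * n))) / 2)"
proof -
  have "P_two b n q + p_two (b + d) m q - 2 * p_one (b + d) m q * P_one b n q
      = (\<delta> m n d)\<^sup>2 - 1/2 + 2 * (lambert2 q m + lambert2 q n) + 4 * (lambert2 q (2 * m) + lambert2 q (2 * n))"
    unfolding p_two_eq P_two_eq p_one_eq P_one_eq \<delta>_def by (simp add: power2_eq_square algebra_simps)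
  moreover have "1/2 * (plus_term (b + d) 0 m * minus_term b 2 n) - plus_term (b + d) 1 m * minus_term b 1 n
      + 1/2 * (plus_term (b + d) 2 m * minus_term b 0 n)
    = ((q ^ m) powi (b + d) * (q ^ n) powi b) * (plus_coeff 1 m * minus_coeff 1 n) *
       (P_two b n q + p_two (b + d) m q - 2 * p_one (b + d) m q * P_one b n q) / 2"
    by (simp add: plus_term_def minus_term_def p_fun_def P_fun_def field_simps)
  ultimately show ?thesis unfolding powi_merge by (simp add: mult_ac)
qed

text \<open>
  The factor in front is what every comparison of residues with coefficients produces.
\<close>

definition scaled_residue :: "nat \<Rightarrow> nat \<Rightarrow> complex \<Rightarrow> complex" where
  "scaled_residue N e p = 2 * q ^ (N * N + N) * residue (\<lambda>z. z ^ e / kernel_denom N z) p"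

lemma triple_term_residue:
  assumes "int e = 4 * int (m + n) + 1 + d"
  shows "1/2 * (plus_term (b + d) 0 m * minus_term b 2 n) - plus_term (b + d) 1 m * minus_term b 1 n
      + 1/2 * (plus_term (b + d) 2 m * minus_term b 0 n)
    = (q ^ (m + n)) powi b * scaled_residue (m + n) e (q ^ m)"
  unfolding triple_term scaled_residue_def residue_at_triple_pole[OF refl assms] ..

lemma minus_term_residue:
  assumes "int e = 4 * int (m + n) + 1 + d"
  shows "1/4 * (plus_term (b + d) 4 m * minus_term b 4 n)
    = (q ^ (m + n)) powi b * ((-1) powi d * scaled_residue (m + n) e (- (q ^ m)))"
proof -
  have 1: "1/4 * (plus_term (b + d) 4 m * minus_term b 4 n)
      = ((q ^ m) powi (b + d) * (q ^ n) powi b) * (plus_coeff (-1) m * minus_coeff (-1) n) / 4"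
    by (simp add: plus_term_def minus_term_def)
  have 2: "(q ^ m) powi d = (-1) powi d * (- (q ^ m)) powi d"
    using power_int_mult_distrib[of "-1" "- (q ^ m)" d] by simp
  show ?thesis
    unfolding 1 powi_merge scaled_residue_def residue_at_minus_q_power[OF refl assms] 2 by (simp add: mult_ac)
qed

text \<open>
  Up to the sign $(-1)^d$ the prefactors of $H^+_a$ and $H^-_b$ at $x = \pm s$ multiply to $x^d q^b$
  times a factor that is independent of $a$ and $b$; together with $(q^m)^a (q^n)^b$ this is $(x q^m)^d q^{b(m+n+1)}$.
\<close>

lemma half_term_residue:
  assumes e: "int e = 4 * int (m + n + 1) + 1 + d" and x: "x = s \<or> x = - s"
  shows "- (q / (1 - x) ^ 4 * x powi d * (q powi b * ((q ^ m) powi (b + d) * (q ^ n) powi b) * (plus_coeff_half x m * minus_coeff_half x n)))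
    = (q ^ (m + n + 1)) powi b * scaled_residue (m + n + 1) e (x * q ^ m)"
proof -
  have x2: "x\<^sup>2 = q" using x q_eq by auto
  have off: "x * q ^ m \<noteq> q ^ j" for j
    using x s_power_inj[of "2 * m + 1" "2 * j"] s_power_neq_minus[of "2 * j" "2 * m + 1"]
    by (auto simp: q_power) presburger+
  have "(q ^ (m + n + 1)) powi b = q powi b * (q ^ (m + n)) powi b"
    by (simp add: power_int_mult_distrib)
  moreover have "(x * q ^ m) powi d = x powi d * (q ^ m) powi d"
    by (simp add: power_int_mult_distrib)
  ultimately show ?thesis
    unfolding scaled_residue_def residue_at_half_power[OF x2 refl e off] powi_merge
    by (simp add: mult_ac)
qed

text \<open>
  The entries of the matrix product for $|q| < 1$; the two minus signs at the columns 3 and 5 stem from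
  the pairing matrix, the one at column 1 from $(-1)^{\delta_1}$.
\<close>

definition bilinear_form :: "int \<Rightarrow> int \<Rightarrow> complex" where
  "bilinear_form a b = 1/2 * (H_plus a 0 \<tau> * H_minus b 2 \<tau>) - H_plus a 1 \<tau> * H_minus b 1 \<tau>
     + 1/2 * (H_plus a 2 \<tau> * H_minus b 0 \<tau>) - H_plus a 3 \<tau> * H_minus b 3 \<tau>
     + 1/4 * (H_plus a 4 \<tau> * H_minus b 4 \<tau>) - H_plus a 5 \<tau> * H_minus b 5 \<tau>"

lemma factors_integer:
  assumes "j \<le> 2" "k \<le> 2"
  shows "plus_factor (b + d) j * minus_factor b k = (-1) powi d"
proof -
  have "((-1::complex) powi b)\<^sup>2 = 1" using minus_one_powi_sq[of b] by (simp add: power2_eq_square)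
  then show ?thesis
    using assms by (simp add: plus_factor_def minus_factor_def power_int_add power2_eq_square)
qed

lemma factors_half:
  shows "plus_factor (b + d) 3 * minus_factor b 3 = (-1) powi d * (q / (1 - s) ^ 4 * s powi d * q powi b)"
    and "plus_factor (b + d) 5 * minus_factor b 5 = (-1) powi d * (q / (1 - - s) ^ 4 * (- s) powi d * q powi b)"
proof -
  have e8: "qpow \<tau> (1/8) * qpow \<tau> (-1/8) = 1"
    using qpow_add[of \<tau> "1/8" "-1/8"] by simp
  have s1: "s \<noteq> 1" "s \<noteq> -1" using norm_s by auto
  have p: "1 / (1 - x)\<^sup>2 * (1 / (1 - inverse x)\<^sup>2) = x\<^sup>2 / (1 - x) ^ 4" if "x \<noteq> 0" "x \<noteq> 1" for x :: complex
  proof -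
    have "1 - inverse x = - ((1 - x) / x)" using that by (simp add: field_simps)
    then have "(1 - inverse x)\<^sup>2 = (1 - x)\<^sup>2 / x\<^sup>2" by (simp only: power2_minus power_divide)
    then show ?thesis by (simp add: power4_eq_xxxx power2_eq_square)
  qed
  have sq: "s powi b * s powi b = q powi b" "(- s) powi b * (- s) powi b = q powi b"
    by (simp_all add: power_int_mult_distrib[symmetric] q_eq power2_eq_square)
  have m: "(-1) powi d * s powi d = (- s) powi d" "(-1) powi d * (- s) powi d = s powi d"
    using power_int_mult_distrib[of "-1" s d] power_int_mult_distrib[of "-1" "- s" d] by simp_all
  have "plus_factor (b + d) 3 * minus_factor b 3 =
     (qpow \<tau> (1/8) * qpow \<tau> (-1/8)) * (1 / (1 - s)\<^sup>2 * (1 / (1 - inverse s)\<^sup>2)) * ((- s) powi d * ((- s) powi b * (- s) powi b))"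
    using s_nz by (simp add: plus_factor_def minus_factor_def power_int_add)
  then show "plus_factor (b + d) 3 * minus_factor b 3 = (-1) powi d * (q / (1 - s) ^ 4 * s powi d * q powi b)"
    unfolding e8 p[OF s_nz s1(1)] sq m(1)[symmetric] q_eq[symmetric] by simp
  have f5: "plus_factor (b + d) 5 * minus_factor b 5 =
     (qpow \<tau> (1/8) * qpow \<tau> (-1/8)) * (1 / (1 - - s)\<^sup>2 * (1 / (1 - inverse (- s))\<^sup>2)) * (s powi d * (s powi b * s powi b))"
    using s_nz by (simp add: plus_factor_def minus_factor_def power_int_add)
  have n5: "- s \<noteq> 0" "- s \<noteq> 1" using s_nz s1(2) by (auto simp: minus_equation_iff)
  show "plus_factor (b + d) 5 * minus_factor b 5 = (-1) powi d * (q / (1 - - s) ^ 4 * (- s) powi d * q powi b)"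
    unfolding f5 e8 p[OF n5] sq m(2)[symmetric] by (simp add: q_eq)
qed

text \<open>
  The Cauchy products of the six pairs of series, multiplied by $(-1)^d$. The term $N = 0$ is moved to
  the right-hand side; there the half-integral poles are absent, so their series enter with index
  shifted by one.
\<close>

lemma bilinear_form_sums:
  assumes d: "d \<ge> -5"
  shows "(\<lambda>N. (q ^ Suc N) powi b * (2 * q ^ (Suc N * Suc N + Suc N) * residue_total (Suc N) (nat (4 * int (Suc N) + 1 + d))))
    sums ((-1) powi d * bilinear_form (b + d) b - ((of_int d)\<^sup>2 - 1/2) / 2 - (-1) powi d / 4)"
proof -
  define X where "X N = (\<Sum>m\<le>N. 1/2 * (plus_term (b + d) 0 m * minus_term b 2 (N - m))
      - plus_term (b + d) 1 m * minus_term b 1 (N - m) + 1/2 * (plus_term (b + d) 2 m * minus_term b 0 (N - m)))" for N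
  define Y where "Y N = (\<Sum>m\<le>N. 1/4 * (plus_term (b + d) 4 m * minus_term b 4 (N - m)))" for N
  define c where "c x = q / (1 - x) ^ 4 * x powi d * q powi b" for x
  define Z where "Z N = (\<Sum>m\<le>N. - (c s * (plus_term (b + d) 3 m * minus_term b 3 (N - m))))" for N
  define V where "V N = (\<Sum>m\<le>N. - (c (- s) * (plus_term (b + d) 5 m * minus_term b 5 (N - m))))" for N
  define U where "U j k = (\<Sum>m. plus_term (b + d) j m) * (\<Sum>n. minus_term b k n)" for j k
  note CP = Cauchy_product_terms[of "b + d" _ b, folded U_def]
  have X: "X sums (1/2 * U 0 2 - U 1 1 + 1/2 * U 2 0)"
    unfolding X_def[abs_def] sum.distrib sum_subtractf sum_distrib_left[symmetric]
    by (intro sums_add sums_diff sums_mult CP)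
  have Y: "Y sums (1/4 * U 4 4)"
    unfolding Y_def[abs_def] sum_distrib_left[symmetric] by (intro sums_mult CP)
  have Z: "Z sums (- (c s * U 3 3))"
    unfolding Z_def[abs_def] sum_negf sum_distrib_left[symmetric] by (intro sums_minus sums_mult CP)
  have V: "V sums (- (c (- s) * U 5 5))"
    unfolding V_def[abs_def] sum_negf sum_distrib_left[symmetric] by (intro sums_minus sums_mult CP)
  note sg = minus_one_powi_cancel[of d]
  have bilinear_form: "(-1) powi d * bilinear_form (b + d) b
      = (1/2 * U 0 2 - U 1 1 + 1/2 * U 2 0) + (-1) powi d * (1/4 * U 4 4) - c s * U 3 3 - c (- s) * U 5 5"
  proof -
    have H: "H_plus (b + d) j \<tau> * H_minus b k \<tau> = (plus_factor (b + d) j * minus_factor b k) * U j k"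
      if "j < 6" "k < 6" for j k
      using that by (simp add: H_plus_eq H_minus_eq U_def)
    have P: "(-1) powi d * (H_plus (b + d) j \<tau> * H_minus b k \<tau>) = U j k" if "j \<le> 2" "k \<le> 2" for j k
    proof -
      have "j < 6" "k < 6" using that by auto
      then show ?thesis by (simp only: H factors_integer[OF that] sg)
    qed
    have P3: "(-1) powi d * (H_plus (b + d) 3 \<tau> * H_minus b 3 \<tau>) = c s * U 3 3"
      and P5: "(-1) powi d * (H_plus (b + d) 5 \<tau> * H_minus b 5 \<tau>) = c (- s) * U 5 5"
      using H[of 3 3] H[of 5 5] by (simp_all only: factors_half c_def mult.assoc sg)
    have P4: "H_plus (b + d) 4 \<tau> * H_minus b 4 \<tau> = U 4 4"
      using H[of 4 4] by (simp add: plus_factor_def minus_factor_def)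
    have "(-1) powi d * bilinear_form (b + d) b = 1/2 * ((-1) powi d * (H_plus (b + d) 0 \<tau> * H_minus b 2 \<tau>))
        - (-1) powi d * (H_plus (b + d) 1 \<tau> * H_minus b 1 \<tau>)
        + 1/2 * ((-1) powi d * (H_plus (b + d) 2 \<tau> * H_minus b 0 \<tau>))
        + (-1) powi d * (1/4 * (H_plus (b + d) 4 \<tau> * H_minus b 4 \<tau>))
        - (-1) powi d * (H_plus (b + d) 3 \<tau> * H_minus b 3 \<tau>)
        - (-1) powi d * (H_plus (b + d) 5 \<tau> * H_minus b 5 \<tau>)"
      unfolding bilinear_form_def by (simp only: algebra_simps)
    then show ?thesis unfolding P3 P4 P5 by (simp only: P le_numeral_extra one_le_numeral zero_le order_refl)
  qed
  \<comment> \<open>The terms with $m = n = 0$, where all Lambert sums are empty.\<close>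
  have X0: "X 0 = ((of_int d)\<^sup>2 - 1/2) / 2"
    using triple_term[of b d 0 0]
    by (simp add: X_def plus_coeff_def minus_coeff_def qpoch_def lambert1_def lambert2_def)
  have Y0: "Y 0 = 1/4"
    by (simp add: Y_def plus_term_def minus_term_def plus_coeff_def minus_coeff_def qpoch_def)
  have "(\<lambda>N. X (Suc N) + (-1) powi d * Y (Suc N) + Z N + V N) sums
      ((1/2 * U 0 2 - U 1 1 + 1/2 * U 2 0 - X 0) + (-1) powi d * (1/4 * U 4 4 - Y 0) + - (c s * U 3 3) + - (c (- s) * U 5 5))"
    using X Y by (intro sums_add sums_mult Z V) (simp_all add: sums_Suc_iff)
  also have "(1/2 * U 0 2 - U 1 1 + 1/2 * U 2 0 - X 0) + (-1) powi d * (1/4 * U 4 4 - Y 0) + - (c s * U 3 3) + - (c (- s) * U 5 5)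
      = (-1) powi d * bilinear_form (b + d) b - ((of_int d)\<^sup>2 - 1/2) / 2 - (-1) powi d / 4"
    unfolding bilinear_form X0 Y0 by (simp add: algebra_simps)
  also have "(\<lambda>N. X (Suc N) + (-1) powi d * Y (Suc N) + Z N + V N)
    = (\<lambda>N. (q ^ Suc N) powi b * (2 * q ^ (Suc N * Suc N + Suc N) * residue_total (Suc N) (nat (4 * int (Suc N) + 1 + d))))"
  proof
    fix N
    define M where "M = Suc N"
    define e where "e = nat (4 * int M + 1 + d)"
    have e: "int e = 4 * int M + 1 + d" using d by (simp add: e_def M_def)
    have XM: "X M = (\<Sum>m\<le>M. (q ^ M) powi b * scaled_residue M e (q ^ m))"
      unfolding X_def
    proof (intro sum.cong refl)
      fix m assume "m \<in> {..M}"
      then have "m + (M - m) = M" by simp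
      with triple_term_residue[of e m "M - m" d b] e
      show "1/2 * (plus_term (b + d) 0 m * minus_term b 2 (M - m))
          - plus_term (b + d) 1 m * minus_term b 1 (M - m) + 1/2 * (plus_term (b + d) 2 m * minus_term b 0 (M - m))
          = (q ^ M) powi b * scaled_residue M e (q ^ m)" by simp
    qed
    have YM: "(-1) powi d * Y M = (\<Sum>m\<le>M. (q ^ M) powi b * scaled_residue M e (- (q ^ m)))"
      unfolding Y_def sum_distrib_left[of "(-1) powi d"]
    proof (intro sum.cong refl)
      fix m assume "m \<in> {..M}"
      then have "m + (M - m) = M" by simp
      with minus_term_residue[of e m "M - m" d b] e
      show "(-1) powi d * (1/4 * (plus_term (b + d) 4 m * minus_term b 4 (M - m)))
          = (q ^ M) powi b * scaled_residue M e (- (q ^ m))" by (simp only:) (simp add: mult.left_commute[of _ "(q ^ M) powi b"] sg)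
    qed
    have ZN: "Z N = (\<Sum>m<M. (q ^ M) powi b * scaled_residue M e (s * q ^ m))"
      unfolding Z_def M_def lessThan_Suc_atMost
    proof (intro sum.cong refl)
      fix m assume "m \<in> {..N}"
      then have "m + (N - m) + 1 = M" by (simp add: M_def)
      with half_term_residue[of e m "N - m" d s b] e
      show "- (c s * (plus_term (b + d) 3 m * minus_term b 3 (N - m))) = (q ^ Suc N) powi b * scaled_residue (Suc N) e (s * q ^ m)"
        by (simp add: M_def c_def plus_term_def minus_term_def mult_ac del: power_Suc)
    qed
    have VN: "V N = (\<Sum>m<M. (q ^ M) powi b * scaled_residue M e (- s * q ^ m))"
      unfolding V_def M_def lessThan_Suc_atMost
    proof (intro sum.cong refl)
      fix m assume "m \<in> {..N}"
      then have "m + (N - m) + 1 = M" by (simp add: M_def)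
      with half_term_residue[of e m "N - m" d "- s" b] e
      show "- (c (- s) * (plus_term (b + d) 5 m * minus_term b 5 (N - m))) = (q ^ Suc N) powi b * scaled_residue (Suc N) e (- s * q ^ m)"
        by (simp add: M_def c_def plus_term_def minus_term_def mult_ac del: power_Suc)
    qed
    have "2 * q ^ (M * M + M) * residue_total M e =
      (\<Sum>m\<le>M. scaled_residue M e (q ^ m) + scaled_residue M e (- (q ^ m))) + (\<Sum>m<M. scaled_residue M e (s * q ^ m) + scaled_residue M e (- s * q ^ m))"
      unfolding residue_total_def sum_kernel_poles scaled_residue_def distrib_left sum_distrib_left by simp
    then have "(q ^ M) powi b * (2 * q ^ (M * M + M) * residue_total M e) = X M + (-1) powi d * Y M + Z N + V N"
      unfolding XM YM ZN VN by (simp add: sum_distrib_left sum.distrib algebra_simps)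
    then show "X (Suc N) + (-1) powi d * Y (Suc N) + Z N + V N
      = (q ^ Suc N) powi b * (2 * q ^ (Suc N * Suc N + Suc N) * residue_total (Suc N) (nat (4 * int (Suc N) + 1 + d)))"
      unfolding e_def M_def by simp
  qed
  finally show ?thesis .
qed

text \<open>
  Only $N = 1$ can contribute to the series of residue sums: for $N \ge 2$ the numerator degree
  $4N+1+d$ stays below $6N+3$ as long as $d \le 5$.
\<close>

lemma bilinear_form_eq:
  assumes d: "\<bar>d\<bar> \<le> 5"
  shows "bilinear_form (b + d) b = (-1) powi d * ((of_int d)\<^sup>2 - 1/2) / 2 + 1 / 4
    + (if d = 4 then 2 * q powi (b + 2) else if d = 5 then - 4 * q powi (b + 2) - 4 * q powi (b + 3) else 0)"
proof -
  define G where "G N = (q ^ Suc N) powi b * (2 * q ^ (Suc N * Suc N + Suc N) * residue_total (Suc N) (nat (4 * int (Suc N) + 1 + d)))" for N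
  define R where "R = (if d = 4 then 1 else if d = 5 then 2 + 2 * q else 0)"
  have "G N = 0" if "N \<noteq> 0" for N
  proof -
    have "nat (4 * int (Suc N) + 1 + d) + 1 \<le> 6 * Suc N + 4" "nat (4 * int (Suc N) + 1 + d) \<noteq> 6 * Suc N + 3"
      using d that by auto
    then show ?thesis unfolding G_def by (simp add: residue_total_low)
  qed
  then have "G sums G 0" using sums_finite[of "{0}" G] by simp
  moreover have "G sums ((-1) powi d * bilinear_form (b + d) b - ((of_int d)\<^sup>2 - 1/2) / 2 - (-1) powi d / 4)"
    unfolding G_def[abs_def] by (rule bilinear_form_sums) (use d in auto)
  ultimately have G0: "(-1) powi d * bilinear_form (b + d) b - ((of_int d)\<^sup>2 - 1/2) / 2 - (-1) powi d / 4 = G 0"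
    using sums_unique2 by blast
  have "residue_total 1 (nat (5 + d)) = R"
  proof (cases "d = 5")
    case True
    then show ?thesis using residue_total_degree_10 by (simp add: R_def)
  next
    case False
    then have "nat (5 + d) + 1 \<le> 6 * 1 + 4" "nat (5 + d) = 9 \<longleftrightarrow> d = 4" using d by auto
    then show ?thesis using False by (simp add: residue_total_low R_def)
  qed
  then have "G 0 = q powi b * (2 * q\<^sup>2 * R)" by (simp add: G_def add.commute power2_eq_square)
  also have "\<dots> = 2 * q powi (b + 2) * R" using q_nz by (simp add: power_int_add power2_eq_square)
  finally have G0': "G 0 = 2 * q powi (b + 2) * R" .
  note sg = minus_one_powi_cancel[of d]
  have "bilinear_form (b + d) b = (-1) powi d * ((-1) powi d * bilinear_form (b + d) b)" by (simp only: sg)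
  also have "(-1) powi d * bilinear_form (b + d) b = G 0 + ((of_int d)\<^sup>2 - 1/2) / 2 + (-1) powi d * (1/4)"
    using G0 by (simp add: algebra_simps)
  finally have "bilinear_form (b + d) b = (-1) powi d * (2 * q powi (b + 2) * R) + (-1) powi d * (((of_int d)\<^sup>2 - 1/2) / 2) + 1/4"
    unfolding G0' distrib_left sg .
  moreover have "q powi (b + 3) = q powi (b + 2) * q"
    using power_int_add_1[of q "b + 2"] q_nz by (simp add: add.commute)
  ultimately show ?thesis by (auto simp: R_def algebra_simps)
qed

end

section \<open>The recurrence of order six\<close>

context punctured_disc
begin

text \<open>
  The coefficients of $(1-z)^2 (1-z^2) (1-z^2/q)$.
\<close>

definition rec_coeff :: "nat \<Rightarrow> complex" where
  "rec_coeff k = [1, -2, - (1 / q), 2 + 2 / q, -1, - (2 / q), 1 / q] ! k"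

definition shift_poly :: "complex \<Rightarrow> complex" where
  "shift_poly z = (1 - z)\<^sup>2 * (1 - z\<^sup>2) * (1 - z\<^sup>2 / q)"

lemma sum_up_to_6: "(\<Sum>k\<le>6::nat. f k) = f 0 + f 1 + f 2 + f 3 + f 4 + f 5 + (f 6 :: complex)"
  by (simp add: eval_nat_numeral atMost_Suc add_ac)

lemma rec_coeff_simps [simp]:
  "rec_coeff 0 = 1" "rec_coeff 1 = -2" "rec_coeff (Suc 0) = -2" "rec_coeff 2 = - (1 / q)" "rec_coeff 3 = 2 + 2 / q"
  "rec_coeff 4 = -1" "rec_coeff 5 = - (2 / q)" "rec_coeff 6 = 1 / q"
  by (simp_all add: rec_coeff_def)

lemma shift_poly_eq: "(\<Sum>k\<le>6. rec_coeff k * z ^ k) = shift_poly z"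
  unfolding sum_up_to_6 rec_coeff_simps shift_poly_def by (simp add: eval_nat_numeral field_simps q_nz)

text \<open>
  The first and second Euler derivative of the polynomial, via its logarithmic derivative $-h$. The
  increments of $p_{\lambda,1,m}$ and $p_{\lambda,2,m}$ in $m$ are built from the same $h$ and $g$, and
  this makes the recurrence hold for the columns 1 and 2 as well.
\<close>

lemma shift_poly_derivs:
  assumes a: "1 - z \<noteq> 0" and b: "1 - z\<^sup>2 \<noteq> 0" and c: "1 - z\<^sup>2 / q \<noteq> 0"
  defines "h \<equiv> 2 * (z / (1 - z)) + 2 * (z\<^sup>2 / (1 - z\<^sup>2) + (z\<^sup>2 / q) / (1 - z\<^sup>2 / q))"
  defines "g \<equiv> 2 * (z / (1 - z)\<^sup>2) + 4 * (z\<^sup>2 / (1 - z\<^sup>2)\<^sup>2 + (z\<^sup>2 / q) / (1 - z\<^sup>2 / q)\<^sup>2)"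
  shows "(\<Sum>k\<le>6. rec_coeff k * of_nat k * z ^ k) = - (shift_poly z * h)"
    and "(\<Sum>k\<le>6. rec_coeff k * (of_nat k)\<^sup>2 * z ^ k) = shift_poly z * (h\<^sup>2 - g)"
proof -
  define w where "w = z\<^sup>2 / q"
  define A where "A = z / (1 - z)"
  define B where "B = z\<^sup>2 / (1 - z\<^sup>2)"
  define C where "C = w / (1 - w)"
  have wq: "z\<^sup>2 * (1 / q) = w" by (simp add: w_def)
  have cw: "1 - w \<noteq> 0" using c by (simp add: w_def)
  have A: "A * (1 - z) = z" and B: "B * (1 - z\<^sup>2) = z\<^sup>2" and C: "C * (1 - w) = w"
    using a b cw by (simp_all add: A_def B_def C_def)
  have h: "h = 2 * A + 2 * (B + C)" by (simp add: h_def A_def B_def C_def w_def)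
  have sq: "u / (1 - u)\<^sup>2 = u / (1 - u) + (u / (1 - u))\<^sup>2" if "1 - u \<noteq> 0" for u :: complex
    using that by (simp add: divide_simps power2_eq_square) (simp add: algebra_simps)
  have g: "g = 2 * (A + A\<^sup>2) + 4 * ((B + B\<^sup>2) + (C + C\<^sup>2))"
    unfolding g_def w_def[symmetric] sq[OF a] sq[OF b] sq[OF cw] A_def B_def C_def ..
  \<comment> \<open>In the expansion of the second derivative the squares of \<open>B\<close> and \<open>C\<close> cancel, so every remaining product is a polynomial in $z$ and $w$.\<close>
  have cp: "shift_poly z = (1 - z)\<^sup>2 * (1 - z\<^sup>2) * (1 - w)" by (simp add: shift_poly_def w_def)
  have cA: "shift_poly z * A = z * (1 - z) * (1 - z\<^sup>2) * (1 - w)"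
  proof -
    have "shift_poly z * A = (A * (1 - z)) * (1 - z) * (1 - z\<^sup>2) * (1 - w)" by (simp add: cp power2_eq_square)
    then show ?thesis unfolding A .
  qed
  have cB: "shift_poly z * B = z\<^sup>2 * (1 - z)\<^sup>2 * (1 - w)"
  proof -
    have "shift_poly z * B = (B * (1 - z\<^sup>2)) * (1 - z)\<^sup>2 * (1 - w)" by (simp add: cp)
    then show ?thesis unfolding B .
  qed
  have cC: "shift_poly z * C = w * (1 - z)\<^sup>2 * (1 - z\<^sup>2)"
  proof -
    have "shift_poly z * C = (C * (1 - w)) * (1 - z)\<^sup>2 * (1 - z\<^sup>2)" by (simp add: cp)
    then show ?thesis unfolding C .
  qed
  have cAA: "shift_poly z * A * A = z\<^sup>2 * (1 - z\<^sup>2) * (1 - w)"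
  proof -
    have "shift_poly z * A * A = z * (A * (1 - z)) * (1 - z\<^sup>2) * (1 - w)" unfolding cA by (simp add: mult_ac)
    then show ?thesis unfolding A by (simp add: power2_eq_square)
  qed
  have cAB: "shift_poly z * A * B = z * z\<^sup>2 * (1 - z) * (1 - w)"
  proof -
    have "shift_poly z * A * B = z * (B * (1 - z\<^sup>2)) * (1 - z) * (1 - w)" unfolding cA by (simp add: mult_ac)
    then show ?thesis unfolding B .
  qed
  have cAC: "shift_poly z * A * C = z * w * (1 - z) * (1 - z\<^sup>2)"
  proof -
    have "shift_poly z * A * C = z * (C * (1 - w)) * (1 - z) * (1 - z\<^sup>2)" unfolding cA by (simp add: mult_ac)
    then show ?thesis unfolding C .
  qed
  have cBC: "shift_poly z * B * C = z\<^sup>2 * w * (1 - z)\<^sup>2"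
  proof -
    have "shift_poly z * B * C = z\<^sup>2 * (C * (1 - w)) * (1 - z)\<^sup>2" unfolding cB by (simp add: mult_ac)
    then show ?thesis unfolding C .
  qed
  have "(\<Sum>k\<le>6. rec_coeff k * of_nat k * z ^ k)
      = - 2 * z - 2 * (z\<^sup>2 * (1/q)) + 3 * (2 * z ^ 3 + 2 * z * (z\<^sup>2 * (1/q))) - 4 * z ^ 4 - 10 * z ^ 3 * (z\<^sup>2 * (1/q)) + 6 * z ^ 4 * (z\<^sup>2 * (1/q))"
    unfolding sum_up_to_6 rec_coeff_simps by (simp add: eval_nat_numeral algebra_simps)
  also have "\<dots> = - (2 * (shift_poly z * A) + 2 * (shift_poly z * B + shift_poly z * C))"
    unfolding wq cA cB cC by (simp add: eval_nat_numeral algebra_simps)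
  also have "\<dots> = - (shift_poly z * h)" by (simp add: h algebra_simps)
  finally show "(\<Sum>k\<le>6. rec_coeff k * of_nat k * z ^ k) = - (shift_poly z * h)" .
  have "(\<Sum>k\<le>6. rec_coeff k * (of_nat k)\<^sup>2 * z ^ k)
      = - 2 * z - 4 * (z\<^sup>2 * (1/q)) + 9 * (2 * z ^ 3 + 2 * z * (z\<^sup>2 * (1/q))) - 16 * z ^ 4 - 50 * z ^ 3 * (z\<^sup>2 * (1/q)) + 36 * z ^ 4 * (z\<^sup>2 * (1/q))"
    unfolding sum_up_to_6 rec_coeff_simps by (simp add: eval_nat_numeral algebra_simps)
  also have "\<dots> = 2 * (shift_poly z * A * A) + 8 * (shift_poly z * A * B) + 8 * (shift_poly z * A * C) + 8 * (shift_poly z * B * C)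
      - 2 * (shift_poly z * A) - 4 * (shift_poly z * B) - 4 * (shift_poly z * C)"
    unfolding cAA cAB cAC cBC unfolding wq cA cB cC by (simp add: eval_nat_numeral algebra_simps)
  also have "\<dots> = shift_poly z * (h\<^sup>2 - g)" by (simp add: h g power2_eq_square algebra_simps)
  finally show "(\<Sum>k\<le>6. rec_coeff k * (of_nat k)\<^sup>2 * z ^ k) = shift_poly z * (h\<^sup>2 - g)" .
qed

text \<open>
  Passing from $m$ to $m+1$ enlarges the denominator by exactly the value of the polynomial at
  $t q^{m+1}$.
\<close>

lemma plus_coeff_Suc:
  assumes "t\<^sup>2 = 1"
  shows "shift_poly (t * q ^ Suc m) * plus_coeff t (Suc m) = q ^ (4 * m + 3) * plus_coeff t m"
proof -
  let ?z = "t * q ^ Suc m"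
  have z2: "?z\<^sup>2 = q ^ (2 * m + 2)" 
  proof -
    have "?z\<^sup>2 = q ^ (Suc m * 2)"
      by (simp only: power_mult_distrib power_mult[symmetric] assms mult_1)
    then show ?thesis by (simp add: mult.commute)
  qed
  have z2q: "?z\<^sup>2 / q = q ^ (2 * m + 1)" unfolding z2 using q_nz by simp
  have e: "Suc m * (2 * Suc m + 1) = m * (2 * m + 1) + (4 * m + 3)" by simp
  have den: "(qpoch (t * q) q (Suc m))\<^sup>2 * qpoch q q (2 * Suc m)
      = shift_poly ?z * ((qpoch (t * q) q m)\<^sup>2 * qpoch q q (2 * m))"
    unfolding shift_poly_def z2q unfolding z2 by (simp add: qpoch_def power_mult_distrib mult_ac)
  have "norm t = 1" using assms by (metis norm_one norm_power power2_eq_1_iff norm_ge_zero abs_norm_cancel real_sqrt_abs real_sqrt_one)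
  then have nz: "1 - t * q ^ Suc i \<noteq> 0" for i
    using norm_one_minus_ge[of t i] norm_q by auto
  have "shift_poly ?z \<noteq> 0"
    unfolding shift_poly_def z2q unfolding z2 using nz[of m] one_minus_q_power_nz[of "2 * m"] one_minus_q_power_nz[of "2 * m + 1"] by simp
  then show ?thesis
    unfolding plus_coeff_def den e power_add by simp
qed

lemma plus_coeff_half_Suc:
  assumes "x\<^sup>2 = q" "norm x \<le> 1"
  shows "shift_poly (x * q ^ Suc m) * plus_coeff_half x (Suc m) = x ^ 4 * q ^ (4 * m + 3) * plus_coeff_half x m"
proof -
  let ?z = "x * q ^ Suc m"
  have z2: "?z\<^sup>2 = q ^ (2 * m + 3)" 
  proof -
    have "?z\<^sup>2 = q * q ^ (Suc m * 2)"
      by (simp only: power_mult_distrib power_mult[symmetric] assms(1))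
    also have "\<dots> = q ^ (Suc m * 2 + 1)" by (simp only: power_add power_one_right mult.commute)
    also have "Suc m * 2 + 1 = 2 * m + 3" by simp
    finally show ?thesis .
  qed
  have z2q: "?z\<^sup>2 / q = q ^ (2 * m + 2)" unfolding z2 using q_nz by (simp add: eval_nat_numeral)
  have x4: "x ^ 4 = q\<^sup>2" using assms(1) by (simp add: power4_eq_xxxx power2_eq_square)
  have e: "(2 * Suc m + 1) * (Suc m + 1) = (2 * m + 1) * (m + 1) + (2 + (4 * m + 3))" by simp
  have den: "(qpoch (x * q) q (Suc m))\<^sup>2 * qpoch q q (2 * Suc m + 1)
      = shift_poly ?z * ((qpoch (x * q) q m)\<^sup>2 * qpoch q q (2 * m + 1))"
  proof -
    have "q ^ (2 * m + 3) = q * (q * (q * q ^ (2 * m)))" by (simp add: eval_nat_numeral)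
    then show ?thesis
      unfolding shift_poly_def z2q unfolding z2 by (simp add: qpoch_def power_mult_distrib mult_ac power2_eq_square)
  qed
  have nz: "1 - x * q ^ Suc i \<noteq> 0" for i
    using norm_one_minus_ge[OF assms(2), of i] norm_q by auto
  have "shift_poly ?z \<noteq> 0"
    unfolding shift_poly_def z2q unfolding z2 using nz[of m] one_minus_q_power_nz[of "2 * m + 1"] one_minus_q_power_nz[of "2 * m + 2"]
    by (simp add: eval_nat_numeral)
  then show ?thesis
    unfolding plus_coeff_half_def den e power_add x4 by simp
qed

lemma shift_poly_roots: "shift_poly 1 = 0" "shift_poly (-1) = 0" "shift_poly s = 0" "shift_poly (- s) = 0"
  unfolding shift_poly_def by (simp_all add: q_eq[symmetric] q_nz)

text \<open>
  The root 1 is triple, so the derivatives vanish there too; they start the recurrence at $m = 0$.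
\<close>

lemma shift_poly_triple_root:
  "(\<Sum>k\<le>6. rec_coeff k * of_nat k) = 0" "(\<Sum>k\<le>6. rec_coeff k * (of_nat k)\<^sup>2) = 0"
  unfolding sum_up_to_6 rec_coeff_simps by (simp_all add: field_simps q_nz)

end

context unit_nome
begin

definition base_point :: "nat \<Rightarrow> complex" where
  "base_point j = (if j \<le> 2 then 1 else if j = 3 then s else if j = 4 then -1 else - s)"

lemma base_point_powi:
  "base_point j ^ k * (q ^ m) powi (l + int k) = (q ^ m) powi l * (base_point j * q ^ m) ^ k"
  using q_nz by (simp add: power_int_add power_mult_distrib mult_ac)

lemma shift_down: "(q ^ Suc m) powi l * (x ^ 4 * q ^ (4 * m + 3)) = q powi (l + 3) * (x ^ 4 * (q ^ m) powi (l + 4))"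
  using q_nz by (simp add: power_int_mult_distrib power_int_add power_add power_mult[of q 4] power_mult[of q m] mult.commute[of 4] mult_ac)

lemma p_one_shift: "p_one (l + int k) m q = p_one l m q + of_nat k"
  by (simp add: p_one_eq)

lemma p_two_shift: "p_two (l + int k) m q = p_two l m q + 2 * of_nat k * p_one l m q + (of_nat k)\<^sup>2"
  by (simp add: p_two_eq p_one_shift power2_eq_square algebra_simps)

lemma weighted_p_sum:
  fixes z :: complex
  defines "D0 \<equiv> shift_poly z" and "D1 \<equiv> (\<Sum>k\<le>6. rec_coeff k * of_nat k * z ^ k)"
    and "D2 \<equiv> (\<Sum>k\<le>6. rec_coeff k * (of_nat k)\<^sup>2 * z ^ k)"
  shows "(\<Sum>k\<le>6. rec_coeff k * (z ^ k * p_fun (l + int k) j m q)) =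
    (if j = 0 then D0 else if j = 1 then D0 * p_one l m q + D1 else D0 * p_two l m q + 2 * D1 * p_one l m q + D2)"
proof -
  have D0: "(\<Sum>k\<le>6. rec_coeff k * z ^ k) = D0" unfolding D0_def by (rule shift_poly_eq)
  have 1: "(\<Sum>k\<le>6. rec_coeff k * (z ^ k * (p + of_nat k))) = D0 * p + D1" for p
    unfolding D0[symmetric] D1_def sum_distrib_right sum.distrib[symmetric] by (intro sum.cong refl) (simp add: algebra_simps)
  have 2: "(\<Sum>k\<le>6. rec_coeff k * (z ^ k * (p2 + 2 * of_nat k * p1 + (of_nat k)\<^sup>2))) = D0 * p2 + 2 * D1 * p1 + D2" for p1 p2
    unfolding D0[symmetric] D1_def D2_def sum_distrib_right sum_distrib_left sum.distrib[symmetric]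
    by (intro sum.cong refl) (simp add: algebra_simps)
  show ?thesis
    by (simp add: p_fun_def p_one_shift p_two_shift 1 2 D0)
qed

text \<open>
  The polynomials at index $m+1$ are brought back to index $m$ with $\lambda$ raised by 4, which is the
  shift that the factor $x^{4m}$ of the coefficients induces.
\<close>

lemma weighted_p_sum_Suc:
  fixes m :: nat
  defines "z \<equiv> q ^ Suc m"
  assumes "j \<le> 2"
  shows "(\<Sum>k\<le>6. rec_coeff k * (z ^ k * p_fun (l + int k) j (Suc m) q)) = shift_poly z * p_fun (l + 4) j m q"
proof -
  have z2: "z\<^sup>2 = q ^ Suc (2 * m + 1)" unfolding z_def by (simp add: power2_eq_square power_add mult_2)
  have z2q: "z\<^sup>2 / q = q ^ Suc (2 * m)" unfolding z2 using q_nz by simp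
  define h where "h = 2 * (z / (1 - z)) + 2 * (z\<^sup>2 / (1 - z\<^sup>2) + (z\<^sup>2 / q) / (1 - z\<^sup>2 / q))"
  define g where "g = 2 * (z / (1 - z)\<^sup>2) + 4 * (z\<^sup>2 / (1 - z\<^sup>2)\<^sup>2 + (z\<^sup>2 / q) / (1 - z\<^sup>2 / q)\<^sup>2)"
  have D: "(\<Sum>k\<le>6. rec_coeff k * of_nat k * z ^ k) = - (shift_poly z * h)"
    "(\<Sum>k\<le>6. rec_coeff k * (of_nat k)\<^sup>2 * z ^ k) = shift_poly z * (h\<^sup>2 - g)"
  proof -
    have "1 - z \<noteq> 0" unfolding z_def by (rule one_minus_q_power_nz)
    moreover have "1 - z\<^sup>2 \<noteq> 0" unfolding z2 by (rule one_minus_q_power_nz)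
    moreover have "1 - z\<^sup>2 / q \<noteq> 0" unfolding z2q by (rule one_minus_q_power_nz)
    ultimately have nz: "1 - z \<noteq> 0" "1 - z\<^sup>2 \<noteq> 0" "1 - z\<^sup>2 / q \<noteq> 0" .
    show "(\<Sum>k\<le>6. rec_coeff k * of_nat k * z ^ k) = - (shift_poly z * h)"
      "(\<Sum>k\<le>6. rec_coeff k * (of_nat k)\<^sup>2 * z ^ k) = shift_poly z * (h\<^sup>2 - g)"
      unfolding h_def g_def by (rule shift_poly_derivs[OF nz])+
  qed
  have L1: "2 * lambert1 q (Suc m) + 2 * lambert1 q (2 * Suc m) = 2 * lambert1 q m + 2 * lambert1 q (2 * m) + h"
    unfolding h_def z2q unfolding z2 unfolding z_def by (simp add: lambert1_def)
  have L2: "2 * lambert2 q (Suc m) + 4 * lambert2 q (2 * Suc m) = 2 * lambert2 q m + 4 * lambert2 q (2 * m) + g"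
    unfolding g_def z2q unfolding z2 unfolding z_def by (simp add: lambert2_def)
  have P1: "p_one l (Suc m) q = p_one l m q + 4 + h"
    using L1 by (simp add: p_one_eq algebra_simps)
  have P2: "p_two l (Suc m) q = (p_one l m q + 4 + h)\<^sup>2 + (p_two l m q - (p_one l m q)\<^sup>2) + g"
    using L2 unfolding p_two_eq P1 by (simp add: algebra_simps)
  have s1: "p_one (l + 4) m q = p_one l m q + 4" and s2: "p_two (l + 4) m q = p_two l m q + 8 * p_one l m q + 16"
    using p_one_shift[of l 4 m] p_two_shift[of l 4 m] by simp_all
  consider "j = 0" | "j = 1" | "j = 2" using assms by linarith
  then show ?thesis
    unfolding weighted_p_sum D P1 P2
    by cases (simp_all add: p_fun_def s1 s2 algebra_simps power2_eq_square)
qed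

text \<open>
  Shifting $\lambda$ by $k$ multiplies a term by $z^k$ with $z = x q^{m+1}$. The recurrence sums these to
  the polynomial at $z$, which cancels the new factors of the denominator.
\<close>

lemma plus_term_recurrence_Suc:
  assumes "j < 6"
  shows "(\<Sum>k\<le>6. rec_coeff k * (base_point j ^ k * plus_term (l + int k) j (Suc m)))
    = q powi (l + 3) * (base_point j ^ 4 * plus_term (l + 4) j m)"
proof (cases "j \<le> 2")
  case True
  have "(\<Sum>k\<le>6. rec_coeff k * (base_point j ^ k * plus_term (l + int k) j (Suc m)))
     = (q ^ Suc m) powi l * plus_coeff 1 (Suc m) * (\<Sum>k\<le>6. rec_coeff k * ((q ^ Suc m) ^ k * p_fun (l + int k) j (Suc m) q))"
    unfolding sum_distrib_left
  proof (intro sum.cong refl)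
    fix k
    show "rec_coeff k * (base_point j ^ k * plus_term (l + int k) j (Suc m)) =
        (q ^ Suc m) powi l * plus_coeff 1 (Suc m) * (rec_coeff k * ((q ^ Suc m) ^ k * p_fun (l + int k) j (Suc m) q))"
      using base_point_powi[of j k "Suc m" l] True
      by (simp add: plus_term_def base_point_def mult_ac del: power_Suc)
  qed
  also have "\<dots> = (q ^ Suc m) powi l * (shift_poly (1 * q ^ Suc m) * plus_coeff 1 (Suc m)) * p_fun (l + 4) j m q"
    unfolding weighted_p_sum_Suc[OF True] by (simp add: mult_ac)
  also have "\<dots> = ((q ^ Suc m) powi l * (base_point j ^ 4 * q ^ (4 * m + 3))) * plus_coeff 1 m * p_fun (l + 4) j m q"
    by (subst plus_coeff_Suc) (use True in \<open>simp_all add: base_point_def mult_ac\<close>)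
  finally show ?thesis unfolding shift_down using True by (simp add: plus_term_def mult_ac)
next
  case False
  define c where "c = (if j = 3 then plus_coeff_half s else if j = 4 then plus_coeff (-1) else plus_coeff_half (- s))"
  have t: "plus_term l j m = (q ^ m) powi l * c m" for l m
    using False by (auto simp: plus_term_def c_def)
  have c: "shift_poly (base_point j * q ^ Suc m) * c (Suc m) = base_point j ^ 4 * q ^ (4 * m + 3) * c m"
    using False assms plus_coeff_half_Suc[of s m] plus_coeff_half_Suc[of "- s" m] plus_coeff_Suc[of "-1" m] q_eq
    by (auto simp: base_point_def c_def)
  have "(\<Sum>k\<le>6. rec_coeff k * (base_point j ^ k * plus_term (l + int k) j (Suc m)))
     = (q ^ Suc m) powi l * (shift_poly (base_point j * q ^ Suc m) * c (Suc m))"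
    unfolding shift_poly_eq[symmetric] sum_distrib_left sum_distrib_right
  proof (intro sum.cong refl)
    fix k
    show "rec_coeff k * (base_point j ^ k * plus_term (l + int k) j (Suc m)) =
        (q ^ Suc m) powi l * (rec_coeff k * (base_point j * q ^ Suc m) ^ k * c (Suc m))"
      using base_point_powi[of j k "Suc m" l] unfolding t by (simp add: mult_ac del: power_Suc)
  qed
  then show ?thesis unfolding c t using shift_down[of m l "base_point j"] by (simp add: mult_ac)
qed

lemma plus_term_recurrence_0:
  assumes "j < 6"
  shows "(\<Sum>k\<le>6. rec_coeff k * (base_point j ^ k * plus_term (l + int k) j 0)) = 0"
proof (cases "j \<le> 2")
  case True
  then have "(\<Sum>k\<le>6. rec_coeff k * (base_point j ^ k * plus_term (l + int k) j 0))
     = plus_coeff 1 0 * (\<Sum>k\<le>6. rec_coeff k * (1 ^ k * p_fun (l + int k) j 0 q))"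
    unfolding sum_distrib_left by (intro sum.cong refl) (simp add: plus_term_def base_point_def mult_ac)
  also have "\<dots> = 0"
    unfolding weighted_p_sum using shift_poly_triple_root shift_poly_roots by simp
  finally show ?thesis .
next
  case False
  define c where "c = (if j = 3 then plus_coeff_half s else if j = 4 then plus_coeff (-1) else plus_coeff_half (- s))"
  have "(\<Sum>k\<le>6. rec_coeff k * (base_point j ^ k * plus_term (l + int k) j 0)) = shift_poly (base_point j) * c 0"
    using False unfolding shift_poly_eq[symmetric] sum_distrib_right
    by (intro sum.cong refl) (simp add: plus_term_def c_def mult_ac)
  then show ?thesis using shift_poly_roots False by (simp add: base_point_def)
qed

lemma plus_factor_shift:
  assumes "j < 6"
  shows "plus_factor (l + int k) j = plus_factor l j * (- base_point j) ^ k"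
  using s_nz by (simp add: plus_factor_def base_point_def power_int_add)

text \<open>
  Summation of the recurrences for the terms. The signs $(-1)^k$ are due to the prefactors, which belong
  to the points $-x$ instead of $x$.
\<close>

lemma H_plus_recurrence:
  assumes j: "j < 6"
  shows "(\<Sum>k\<le>6. (-1) ^ k * rec_coeff k * H_plus (l + int k) j \<tau>) = q powi (l + 3) * H_plus (l + 4) j \<tau>"
proof -
  define S where "S l = (\<Sum>m. plus_term l j m)" for l
  have sm: "summable (plus_term l j)" for l by (rule summable_norm_cancel[OF summable_plus_term])
  let ?f = "\<lambda>m. \<Sum>k\<le>6. rec_coeff k * (base_point j ^ k * plus_term (l + int k) j m)"
  have f: "?f sums (\<Sum>k\<le>6. rec_coeff k * (base_point j ^ k * S (l + int k)))"
    unfolding S_def by (intro sums_sum sums_mult summable_sums sm)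
  moreover have "(\<lambda>m. ?f (Suc m)) sums (q powi (l + 3) * (base_point j ^ 4 * S (l + 4)))"
    unfolding plus_term_recurrence_Suc[OF j] S_def by (intro sums_mult summable_sums sm)
  then have "?f sums (q powi (l + 3) * (base_point j ^ 4 * S (l + 4)) + ?f 0)"
    by (rule sums_Suc)
  ultimately have "(\<Sum>k\<le>6. rec_coeff k * (base_point j ^ k * S (l + int k))) = q powi (l + 3) * (base_point j ^ 4 * S (l + 4))"
    unfolding plus_term_recurrence_0[OF j] using sums_unique2 by force
  moreover have H: "H_plus (l + int k) j \<tau> = plus_factor l j * ((- base_point j) ^ k * S (l + int k))" for k
    unfolding H_plus_eq[OF j] plus_factor_shift[OF j] S_def by (simp add: mult_ac)
  have "(\<Sum>k\<le>6. (-1) ^ k * rec_coeff k * H_plus (l + int k) j \<tau>)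
      = plus_factor l j * (\<Sum>k\<le>6. rec_coeff k * (base_point j ^ k * S (l + int k)))"
    unfolding sum_distrib_left H
  proof (intro sum.cong refl)
    fix k :: nat
    have "(-1) ^ k * (- base_point j) ^ k = base_point j ^ k"
      unfolding power_mult_distrib[symmetric] by simp
    then show "(-1) ^ k * rec_coeff k * (plus_factor l j * ((- base_point j) ^ k * S (l + int k)))
        = plus_factor l j * (rec_coeff k * (base_point j ^ k * S (l + int k)))"
      by (metis (no_types, lifting) mult.assoc mult.left_commute)
  qed
  moreover have "H_plus (l + 4) j \<tau> = plus_factor l j * (base_point j ^ 4 * S (l + 4))"
    using H[of 4] by simp
  ultimately show ?thesis by (simp add: mult_ac)
qed

end

section \<open>Six by six determinants\<close>

text \<open>
  The determinant is a polynomial in the entries.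
\<close>

lemma tendsto_det:
  fixes A :: "nat \<Rightarrow> complex Matrix.mat"
  assumes A: "\<And>n. A n \<in> carrier_mat k k" and V: "V \<in> carrier_mat k k"
    and lim: "\<And>i j. i < k \<Longrightarrow> j < k \<Longrightarrow> (\<lambda>n. A n $$ (i, j)) \<longlonglongrightarrow> V $$ (i, j)"
  shows "(\<lambda>n. Determinant.det (A n)) \<longlonglongrightarrow> Determinant.det V"
  unfolding det_def'[OF A] det_def'[OF V]
  by (intro tendsto_sum tendsto_mult tendsto_const tendsto_prod lim) (auto simp: permutes_in_image)

lemma mat_mult_mat:
  fixes f g :: "nat \<times> nat \<Rightarrow> 'a :: semiring_0"
  shows "Matrix.mat n n f * Matrix.mat n n g = Matrix.mat n n (\<lambda>(i, j). \<Sum>k<n. f (i, k) * g (k, j))"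
  by (rule eq_matI) (auto simp: scalar_prod_def lessThan_atLeast0)

lemma sum_less_6: "(\<Sum>k<6::nat. f k) = f 0 + f 1 + f 2 + f 3 + f 4 + (f 5 :: 'a :: comm_monoid_add)"
  by (simp add: eval_nat_numeral add_ac)

lemma forall_less_6: "(\<forall>i<6::nat. P i) \<longleftrightarrow> P 0 \<and> P 1 \<and> P 2 \<and> P 3 \<and> P 4 \<and> P 5"
  by (auto simp: eval_nat_numeral All_less_Suc)

lemma mat_6_cong:
  assumes "\<forall>i<6::nat. \<forall>j<6::nat. f (i, j) = g (i, j)"
  shows "Matrix.mat 6 6 f = Matrix.mat 6 6 g"
  using assms by (intro eq_matI) auto

lemma mat_of_rows_list_eq_mat:
  "length L = n \<Longrightarrow> mat_of_rows_list m L = Matrix.mat n m (\<lambda>(i, j). L ! i ! j)"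
  by (simp add: mat_of_rows_list_def)

lemma eq_mat_6:
  assumes "A \<in> carrier_mat 6 6" "B \<in> carrier_mat 6 6" "\<forall>i<6. \<forall>j<6. A $$ (i, j) = B $$ (i, j)"
  shows "A = B"
  using assms by (intro eq_matI) auto

lemma det_upper_triangular_6:
  fixes f :: "nat \<times> nat \<Rightarrow> complex"
  assumes "\<forall>i<6. \<forall>j<6. j < i \<longrightarrow> f (i, j) = 0"
  shows "Determinant.det (Matrix.mat 6 6 f) = f (0, 0) * f (1, 1) * f (2, 2) * f (3, 3) * f (4, 4) * f (5, 5)"
proof -
  have "Determinant.det (Matrix.mat 6 6 f) = prod_list (diag_mat (Matrix.mat 6 6 f))"
    by (rule det_upper_triangular[of _ 6]) (use assms in \<open>auto simp: upper_triangular_def\<close>)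
  also have "diag_mat (Matrix.mat 6 6 f) = map (\<lambda>i. f (i, i)) [0..<6]"
    by (auto simp: diag_mat_def)
  also have "[0..<6] = [0, 1, 2, 3, 4, 5]" by (simp add: upt_rec)
  finally show ?thesis by simp
qed

lemma det_lower_triangular_6:
  fixes f :: "nat \<times> nat \<Rightarrow> complex"
  assumes "\<forall>i<6. \<forall>j<6. i < j \<longrightarrow> f (i, j) = 0"
  shows "Determinant.det (Matrix.mat 6 6 f) = f (0, 0) * f (1, 1) * f (2, 2) * f (3, 3) * f (4, 4) * f (5, 5)"
proof -
  have "Determinant.det (Matrix.mat 6 6 f) = prod_list (diag_mat (Matrix.mat 6 6 f))"
    by (rule det_lower_triangular[of 6]) (use assms in auto)
  also have "diag_mat (Matrix.mat 6 6 f) = map (\<lambda>i. f (i, i)) [0..<6]"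
    by (auto simp: diag_mat_def)
  also have "[0..<6] = [0, 1, 2, 3, 4, 5]" by (simp add: upt_rec)
  finally show ?thesis by simp
qed

definition confluent_vandermonde :: "complex \<Rightarrow> complex Matrix.mat" where
  "confluent_vandermonde s = Matrix.mat 6 6 (\<lambda>(i, j).
     [(-1) ^ i, (-1) ^ i * of_nat i, (-1) ^ i * (of_nat i)\<^sup>2, (- s) ^ i, 1, s ^ i] ! j)"

text \<open>
  The nodes are $-1$ (three times), $-s$, 1 and $s$. The rows of the unitriangular matrix \<open>L\<close> are the
  coefficients of the products of the first linear factors $z - $ node; such a product annihilates the
  columns of the earlier nodes, so the product of the matrices is triangular.
\<close>

lemma det_confluent_vandermonde:
  "Determinant.det (confluent_vandermonde s) = 32 * s * (1 - s\<^sup>2) ^ 4"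
proof -
  let ?L = "Matrix.mat 6 6 (\<lambda>(i, j).
    [[1, 0, 0, 0, 0, 0],
     [1, 1, 0, 0, 0, 0],
     [1, 2, 1, 0, 0, 0],
     [1, 3, 3, 1, 0, 0],
     [s, 1 + 3 * s, 3 + 3 * s, 3 + s, 1, 0],
     [- s, - 1 - 2 * s, - 2, 2 * s, 2 + s, 1]] ! i ! j)"
  let ?T = "Matrix.mat 6 6 (\<lambda>(i, j).
    [[1, 0, 0, 1, 1, 1],
     [0, -1, -1, 1 - s, 2, 1 + s],
     [0, 0, 2, (1 - s)\<^sup>2, 4, (1 + s)\<^sup>2],
     [0, 0, 0, (1 - s) ^ 3, 8, (1 + s) ^ 3],
     [0, 0, 0, 0, 8 * (1 + s), (1 + s) ^ 3 * (2 * s)],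
     [0, 0, 0, 0, 0, (1 + s) ^ 3 * (2 * s) * (s - 1)]] ! i ! j)"
  have "?L * confluent_vandermonde s = ?T"
    unfolding confluent_vandermonde_def mat_mult_mat
    by (rule mat_6_cong) (simp add: forall_less_6 sum_less_6, simp add: eval_nat_numeral algebra_simps)
  moreover have "Determinant.det (?L * confluent_vandermonde s) = Determinant.det ?L * Determinant.det (confluent_vandermonde s)"
    by (rule det_mult[of _ 6]) (simp_all add: confluent_vandermonde_def)
  ultimately have "Determinant.det ?T = Determinant.det ?L * Determinant.det (confluent_vandermonde s)"
    by simp
  moreover have "Determinant.det ?L = 1"
    by (subst det_lower_triangular_6) (simp_all add: forall_less_6)
  moreover have "Determinant.det ?T = - 2 * (1 - s) ^ 3 * (8 * (1 + s)) * ((1 + s) ^ 3 * (2 * s) * (s - 1))"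
    by (subst det_upper_triangular_6) (simp_all add: forall_less_6)
  moreover have "- 2 * (1 - s) ^ 3 * (8 * (1 + s)) * ((1 + s) ^ 3 * (2 * s) * (s - 1)) = 32 * s * (1 - s\<^sup>2) ^ 4"
  proof -
    have "1 - s\<^sup>2 = (1 - s) * (1 + s)" by (simp add: power2_eq_square algebra_simps)
    then show ?thesis by (simp add: power_mult_distrib) (simp add: eval_nat_numeral algebra_simps)
  qed
  ultimately show ?thesis by simp
qed

definition product_matrix :: "complex \<Rightarrow> complex \<Rightarrow> complex Matrix.mat" where
  "product_matrix X Y = mat_of_rows_list 6
         [[-12,  8, -4,  2,  0,  0],
          [  8, -4,  2,  0,  0,  0],
          [ -4,  2,  0,  0,  0,  2],
          [  2,  0,  0,  0,  2, -4],
          [  0,  0,  0,  2, -4,  8 + 2 * X],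
          [  0,  0,  2, -4,  8 + 2 * Y, -12 - 4 * X - 4 * Y]]"

lemma product_matrix_eq: "product_matrix X Y = Matrix.mat 6 6 (\<lambda>(i, j). [[-12,  8, -4,  2,  0,  0],
          [  8, -4,  2,  0,  0,  0],
          [ -4,  2,  0,  0,  0,  2],
          [  2,  0,  0,  0,  2, -4],
          [  0,  0,  0,  2, -4,  8 + 2 * X],
          [  0,  0,  2, -4,  8 + 2 * Y, -12 - 4 * X - 4 * Y]] ! i ! j)"
  unfolding product_matrix_def by (rule mat_of_rows_list_eq_mat) simp

lemma product_matrix_carrier [simp]: "product_matrix X Y \<in> carrier_mat 6 6"
  by (simp add: product_matrix_eq)

text \<open>
  Row operations clear the last two rows up to $2X$, $2Y$ and one more entry; reversing the
  first four columns and swapping the last two rows gives a triangular matrix.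
\<close>

lemma det_product_matrix: "Determinant.det (product_matrix X Y) = - 64 * X * Y"
proof -
  let ?L = "Matrix.mat 6 6 (\<lambda>(i, j).
    [[1, 0, 0, 0, 0, 0],
     [0, 1, 0, 0, 0, 0],
     [0, 0, 1, 0, 0, 0],
     [0, 0, 0, 1, 0, 0],
     [-1, -2, 0, 2, 1, 0],
     [2, 3, -2, -4, 0, 1 :: complex]] ! i ! j)"
  let ?T = "Matrix.mat 6 6 (\<lambda>(i, j). [[-12,  8, -4,  2,  0,  0],
          [  8, -4,  2,  0,  0,  0],
          [ -4,  2,  0,  0,  0,  2],
          [  2,  0,  0,  0,  2, -4],
          [  0,  0,  0,  0, 0,  2 * X],
          [  0,  0,  0, 0,  2 * Y, - 4 * X - 4 * Y]] ! i ! j)"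
  have "?L * product_matrix X Y = ?T"
    unfolding product_matrix_eq mat_mult_mat
    by (rule mat_6_cong) (simp add: forall_less_6 sum_less_6)
  moreover have "Determinant.det (?L * product_matrix X Y) = Determinant.det ?L * Determinant.det (product_matrix X Y)"
    by (rule det_mult[of _ 6]) simp_all
  ultimately have "Determinant.det ?T = Determinant.det ?L * Determinant.det (product_matrix X Y)"
    by simp
  moreover have "Determinant.det ?L = 1"
    by (subst det_lower_triangular_6) (simp_all add: forall_less_6)
  moreover have "Determinant.det ?T = - 64 * X * Y"
  proof -
    let ?T' = "Matrix.mat 6 6 (\<lambda>(i, j). [[2, -4,  8, -12,  0,  0],
          [  0, 2, -4, 8,  0,  0],
          [  0,  0,  2,  -4,  0,  2],
          [  0,  0,  0,  2,  2, -4],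
          [  0,  0,  0, 0,  2 * Y, - 4 * X - 4 * Y],
          [  0,  0,  0,  0, 0,  2 * X]] ! i ! j)"
    define T where "T = ?T"
    have T: "T \<in> carrier_mat 6 6" by (simp add: T_def)
    have "?T' = mat_swaprows 4 5 (mat_swapcols 0 3 (mat_swapcols 1 2 T))"
    proof (rule eq_mat_6)
      show "mat_swaprows 4 5 (mat_swapcols 0 3 (mat_swapcols 1 2 T)) \<in> carrier_mat 6 6"
        using T by simp
      have "mat_swaprows 4 5 (mat_swapcols 0 3 (mat_swapcols 1 2 T)) $$ (i, j)
          = T $$ (if i = 4 then 5 else if i = 5 then 4 else i,
                  if j = 0 then 3 else if j = 3 then 0 else if j = 1 then 2 else if j = 2 then 1 else j)"
        if "i < 6" "j < 6" for i j
        using that T by auto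
      then show "\<forall>i<6. \<forall>j<6. ?T' $$ (i, j) = mat_swaprows 4 5 (mat_swapcols 0 3 (mat_swapcols 1 2 T)) $$ (i, j)"
        by (simp add: forall_less_6 T_def)
    qed simp
    moreover have "Determinant.det (mat_swaprows 4 5 (mat_swapcols 0 3 (mat_swapcols 1 2 T))) = - Determinant.det T"
    proof -
      have "Determinant.det (mat_swaprows 4 5 (mat_swapcols 0 3 (mat_swapcols 1 2 T)))
          = - Determinant.det (mat_swapcols 0 3 (mat_swapcols 1 2 T))"
        by (rule det_swaprows[of _ 6]) (use T in auto)
      also have "Determinant.det (mat_swapcols 0 3 (mat_swapcols 1 2 T)) = - Determinant.det (mat_swapcols 1 2 T)"
        by (rule det_swapcols[of _ 6]) (use T in auto)
      also have "Determinant.det (mat_swapcols 1 2 T) = - Determinant.det T"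
        by (rule det_swapcols[of _ 6]) (use T in auto)
      finally show ?thesis by simp
    qed
    moreover have "Determinant.det ?T' = 64 * X * Y"
      by (subst det_upper_triangular_6) (simp_all add: forall_less_6)
    ultimately have "- Determinant.det T = 64 * X * Y" by (simp only:)
    then have "Determinant.det T = - 64 * X * Y" by (simp add: minus_equation_iff[of "Determinant.det T"])
    then show ?thesis unfolding T_def .
  qed
  ultimately show ?thesis by simp
qed

section \<open>The determinant inside the unit disc\<close>

context unit_nome
begin

lemma H_fun_eq: "H_fun l j \<tau> = H_plus l j \<tau>"
  using norm_nome by (simp add: H_fun_def)

lemma W_mat_carrier [simp]: "W_mat l t \<in> carrier_mat 6 6"
  by (simp add: W_mat_def)

text \<open>
  One step of the recurrence as a matrix: the first five rows shift, the last one solves for the value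
  at $\lambda + 6$.
\<close>

definition companion :: "int \<Rightarrow> complex Matrix.mat" where
  "companion l = Matrix.mat 6 6 (\<lambda>(i, j).
     if i < 5 then (if j = i + 1 then 1 else 0)
     else - q * ((-1) ^ j * rec_coeff j) + (if j = 4 then q * q powi (l + 3) else 0))"

lemma det_companion: "Determinant.det (companion l) = q"
proof -
  have "Determinant.det (companion l) = (\<Sum>i<6. companion l $$ (i, 0) * cofactor (companion l) i 0)"
    by (rule laplace_expansion_column) (simp_all add: companion_def)
  also have "\<dots> = (\<Sum>i\<in>{5}. companion l $$ (i, 0) * cofactor (companion l) i 0)"
    by (rule sum.mono_neutral_right) (auto simp: companion_def)
  also have "\<dots> = - q * cofactor (companion l) 5 0"
    by (simp add: companion_def)
  also have "mat_delete (companion l) 5 0 = 1\<^sub>m 5"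
    unfolding mat_delete_def by (rule eq_matI) (auto simp: companion_def)
  then have "cofactor (companion l) 5 0 = -1"
    by (simp add: cofactor_def)
  finally show ?thesis by simp
qed

lemma companion_shift: "W_mat (l + 1) \<tau> = companion l * W_mat l \<tau>"
proof (rule eq_matI)
  fix i j assume "i < dim_row (companion l * W_mat l \<tau>)" "j < dim_col (companion l * W_mat l \<tau>)"
  then have ij: "i < 6" "j < 6" by (simp_all add: companion_def W_mat_def)
  have e: "(companion l * W_mat l \<tau>) $$ (i, j) = (\<Sum>k<6. companion l $$ (i, k) * H_plus (l + int k) j \<tau>)"
    using ij by (auto simp: companion_def W_mat_def scalar_prod_def lessThan_atLeast0 H_fun_eq intro!: sum.cong)
  show "W_mat (l + 1) \<tau> $$ (i, j) = (companion l * W_mat l \<tau>) $$ (i, j)"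
  proof (cases "i < 5")
    case True
    have "(\<Sum>k<6. companion l $$ (i, k) * H_plus (l + int k) j \<tau>) = (\<Sum>k\<in>{i + 1}. companion l $$ (i, k) * H_plus (l + int k) j \<tau>)"
      by (rule sum.mono_neutral_right) (use True in \<open>auto simp: companion_def\<close>)
    also have "\<dots> = H_plus (l + 1 + int i) j \<tau>"
      using True by (simp add: companion_def add_ac)
    finally show ?thesis unfolding e using ij by (simp add: W_mat_def H_fun_eq)
  next
    case False
    then have i: "i = 5" using ij by simp
    have "{..6::nat} = insert 6 {..<6}" by auto
    then have "(\<Sum>k<6. (-1) ^ k * rec_coeff k * H_plus (l + int k) j \<tau>) + 1 / q * H_plus (l + 6) j \<tau>
        = q powi (l + 3) * H_plus (l + 4) j \<tau>"
      using H_plus_recurrence[OF ij(2), of l] by (simp add: add.commute)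
    then have r: "H_plus (l + 6) j \<tau> = - q * (\<Sum>k<6. (-1) ^ k * rec_coeff k * H_plus (l + int k) j \<tau>)
        + q * q powi (l + 3) * H_plus (l + 4) j \<tau>"
      using q_nz by (simp add: field_simps)
    have "(\<Sum>k<6. companion l $$ (i, k) * H_plus (l + int k) j \<tau>)
        = (\<Sum>k<6. - q * ((-1) ^ k * rec_coeff k * H_plus (l + int k) j \<tau>)
             + (if k = 4 then q * q powi (l + 3) * H_plus (l + int k) j \<tau> else 0))"
      by (intro sum.cong refl) (auto simp: companion_def i algebra_simps)
    also have "\<dots> = - q * (\<Sum>k<6. (-1) ^ k * rec_coeff k * H_plus (l + int k) j \<tau>)
        + q * q powi (l + 3) * H_plus (l + 4) j \<tau>"
      unfolding sum.distrib sum_distrib_left[symmetric] by (subst sum.delta) auto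
    finally show ?thesis unfolding e using ij i r by (simp add: W_mat_def H_fun_eq add_ac)
  qed
qed (simp_all add: companion_def W_mat_def)

lemma det_W_shift: "Determinant.det (W_mat (l + 1) \<tau>) = q * Determinant.det (W_mat l \<tau>)"
  unfolding companion_shift det_companion[of l, symmetric]
  by (rule det_mult[of _ 6]) (simp_all add: companion_def)

text \<open>
  As a function of $w = q^n$ the sum is a power series, and its value at $w = 0$ is the first term.
\<close>

lemma gaussian_limit:
  assumes "gaussian f"
  shows "(\<lambda>n. \<Sum>m. (q ^ m) powi (l + int n) * f m) \<longlonglongrightarrow> f 0"
proof -
  define a where "a m = (q ^ m) powi l * f m" for m
  have "summable (\<lambda>m. norm (a m))"
    unfolding a_def by (intro gaussian_summable gaussian_mult assms exp_bounded_powi)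
  then have sm: "summable (\<lambda>m. a m * x ^ m)" if "norm x < 1" for x
  proof (rule summable_comparison_test')
    show "norm (a m * x ^ m) \<le> norm (a m)" for m
      using that by (simp add: norm_mult norm_power mult_left_le power_le_one)
  qed
  have "((\<lambda>x. \<Sum>m. a m * x ^ m) \<longlongrightarrow> a 0) (at 0)"
    by (rule powser_limit_0[of 1]) (use sm in \<open>auto intro: summable_sums\<close>)
  moreover have "filterlim (\<lambda>n. q ^ n) (at 0) sequentially"
    unfolding filterlim_at using q_nz norm_q by (auto intro!: LIMSEQ_power_zero)
  ultimately have lim: "(\<lambda>n. \<Sum>m. a m * (q ^ n) ^ m) \<longlonglongrightarrow> a 0"
    by (rule filterlim_compose)
  have eq: "(q ^ m) powi (l + int n) * f m = a m * (q ^ n) ^ m" for m n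
    using q_nz by (simp add: a_def power_int_add mult_ac flip: power_mult)
  have "a 0 = f 0" by (simp add: a_def)
  with lim show ?thesis unfolding eq by simp
qed

text \<open>
  The value $p_{\lambda,1,0}$.
\<close>

definition p_one_offset :: "int \<Rightarrow> complex" where
  "p_one_offset l = of_int l + 1 - 4 * E_series 1 0 q"

text \<open>
  Column operations that make the limit $\lambda \to \infty$ exist. The leading terms of the columns 1 and
  2 are polynomials in $\lambda$; completing the square in \<open>p_one_offset\<close> turns them into 1, $i$, $i^2$.
  The remaining columns are divided by their leading behaviour; $q/(1-q)$ is the first coefficient of the
  half-integral series.
\<close>

definition normalizer :: "int \<Rightarrow> complex Matrix.mat" where
  "normalizer l = (let \<sigma> = (-1) powi l; \<kappa> = p_one_offset l; t = - 6 * E_series 2 0 q - calE2 q / 3;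
      u = inverse (q / (1 - q)) in
     Matrix.mat 6 6 (\<lambda>(k, j).
      [[\<sigma>, - (\<sigma> * \<kappa>), \<sigma> * (\<kappa>\<^sup>2 - t), 0, 0, 0],
       [0, \<sigma>, - (2 * \<sigma> * \<kappa>), 0, 0, 0],
       [0, 0, \<sigma>, 0, 0, 0],
       [0, 0, 0, u * inverse (plus_factor l 3), 0, 0],
       [0, 0, 0, 0, 1, 0],
       [0, 0, 0, 0, 0, u * inverse (plus_factor l 5)]] ! k ! j))"

lemma det_normalizer:
  "Determinant.det (normalizer l) = ((-1) powi l) ^ 3 * (inverse (q / (1 - q)))\<^sup>2
     * inverse (plus_factor l 3 * plus_factor l 5)"
  unfolding normalizer_def Let_def
  by (subst det_upper_triangular_6) (simp_all add: forall_less_6 power2_eq_square power3_eq_cube)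

lemma plus_factor_product:
  "plus_factor l 3 * plus_factor l 5 = (-1) powi l * (qpow \<tau> (1/4) * q powi l) / (1 - q)\<^sup>2"
proof -
  have e: "qpow \<tau> (1/8) * qpow \<tau> (1/8) = qpow \<tau> (1/4)"
    using qpow_add[of \<tau> "1/8" "1/8"] by simp
  have p: "(- s) powi l * s powi l = (-1) powi l * q powi l"
    unfolding power_int_mult_distrib[symmetric] q_eq by (simp add: power2_eq_square)
  have d: "(1 - s)\<^sup>2 * (1 + s)\<^sup>2 = (1 - q)\<^sup>2"
    unfolding power_mult_distrib[symmetric] q_eq by (simp add: algebra_simps power2_eq_square)
  have "plus_factor l 3 * plus_factor l 5 = (qpow \<tau> (1/8) * qpow \<tau> (1/8)) * ((- s) powi l * s powi l) / ((1 - s)\<^sup>2 * (1 + s)\<^sup>2)"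
    by (simp add: plus_factor_def)
  then show ?thesis unfolding e p d by (simp add: mult_ac)
qed

lemma plus_factor_nz: "plus_factor l j \<noteq> 0"
proof -
  have "s \<noteq> 1" "s \<noteq> -1" using norm_s by auto
  then have "1 - s \<noteq> 0" "1 + s \<noteq> 0" by (auto simp: add_eq_0_iff2 minus_equation_iff)
  then show ?thesis using s_nz by (simp add: plus_factor_def)
qed

text \<open>
  The coefficients of the entries of the product of $W_\lambda$ with its normalizer, in row $i$ and column
  $j$.
\<close>

definition normalized_coeff :: "nat \<Rightarrow> nat \<Rightarrow> nat \<Rightarrow> complex" where
  "normalized_coeff i j m =
     (let r = of_nat i + (4 * of_nat m + 2 * lambert1 q m + 2 * lambert1 q (2 * m)) in
      [plus_coeff 1 m, plus_coeff 1 m * r,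
       plus_coeff 1 m * (r\<^sup>2 + (2 * lambert2 q m + 4 * lambert2 q (2 * m))),
       inverse (q / (1 - q)) * plus_coeff_half s m, plus_coeff (-1) m,
       inverse (q / (1 - q)) * plus_coeff_half (- s) m] ! j)"

lemma gaussian_normalized_coeff:
  assumes "j < 6"
  shows "gaussian (normalized_coeff i j)"
proof -
  have r: "exp_bounded (\<lambda>m. of_nat i + (4 * of_nat m + 2 * lambert1 q m + 2 * lambert1 q (2 * m)))"
    by (intro exp_bounded_add exp_bounded_mult exp_bounded_const exp_bounded_of_nat exp_bounded_lambert1 exp_bounded_double[OF exp_bounded_lambert1])
  have r2: "exp_bounded (\<lambda>m. (of_nat i + (4 * of_nat m + 2 * lambert1 q m + 2 * lambert1 q (2 * m)))\<^sup>2
      + (2 * lambert2 q m + 4 * lambert2 q (2 * m)))"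
    unfolding power2_eq_square
    by (intro exp_bounded_add[OF exp_bounded_mult[OF r r]] exp_bounded_add exp_bounded_mult exp_bounded_const
        exp_bounded_lambert2 exp_bounded_double[OF exp_bounded_lambert2])
  have c: "gaussian (plus_coeff 1)" "gaussian (plus_coeff (-1))"
    by (simp_all add: gaussian_plus_coeff)
  have h: "gaussian (plus_coeff_half s)" "gaussian (plus_coeff_half (- s))"
    by (simp_all add: gaussian_plus_coeff_half)
  have "\<forall>j<6. gaussian (normalized_coeff i j)"
    unfolding forall_less_6 normalized_coeff_def[abs_def] Let_def
    using c gaussian_mult(1)[OF c(1) r] gaussian_mult(1)[OF c(1) r2]
      gaussian_mult(2)[OF h(1) exp_bounded_const] gaussian_mult(2)[OF h(2) exp_bounded_const]
    by (simp del: inverse_divide)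
  then show ?thesis using assms by blast
qed

lemma normalized_coeff_0: "j < 6 \<Longrightarrow> (- base_point j) ^ i * normalized_coeff i j 0 = confluent_vandermonde s $$ (i, j)" if "i < 6"
proof -
  have q1: "1 - q \<noteq> 0" using norm_q by auto
  have "\<forall>j<6. (- base_point j) ^ i * normalized_coeff i j 0 = confluent_vandermonde s $$ (i, j)"
    unfolding forall_less_6 using that q_nz q1
    by (simp add: normalized_coeff_def Let_def confluent_vandermonde_def base_point_def plus_coeff_def plus_coeff_half_def
        qpoch_def lambert1_def lambert2_def)
  then show "j < 6 \<Longrightarrow> ?thesis" by blast
qed

lemma normalized_entry:
  assumes i: "i < 6" and j: "j < 6"
  shows "(W_mat l \<tau> * normalizer l) $$ (i, j) =
    (- base_point j) ^ i * (\<Sum>m. (q ^ m) powi (l + int i) * normalized_coeff i j m)"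
proof -
  define A where "A = l + int i"
  define U where "U j = (\<Sum>m. plus_term A j m)" for j
  have sm: "summable (plus_term A j)" for j by (rule summable_norm_cancel[OF summable_plus_term])
  have H: "H_plus A k \<tau> = plus_factor l k * (- base_point k) ^ i * U k" if "k < 6" for k
    unfolding A_def U_def H_plus_eq[OF that] plus_factor_shift[OF that] ..
  define t where "t = - 6 * E_series 2 0 q - calE2 q / 3"
  define \<kappa> where "\<kappa> = p_one_offset l"
  have p1: "p_one A m q = \<kappa> + (of_nat i + (4 * of_nat m + 2 * lambert1 q m + 2 * lambert1 q (2 * m)))" for m
    by (simp add: p_one_eq A_def \<kappa>_def p_one_offset_def)
  have p2: "p_two A m q = (p_one A m q)\<^sup>2 + (2 * lambert2 q m + 4 * lambert2 q (2 * m)) + t" for m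
    by (simp add: p_two_eq t_def)
  have e: "(W_mat l \<tau> * normalizer l) $$ (i, j) = (\<Sum>k<6. H_plus A k \<tau> * normalizer l $$ (k, j))"
    using i j by (auto simp: normalizer_def Let_def W_mat_def scalar_prod_def lessThan_atLeast0 H_fun_eq A_def intro!: sum.cong)
  have S1: "(\<Sum>m. (q ^ m) powi A * normalized_coeff i 1 m) = U 1 - \<kappa> * U 0"
  proof -
    have "(\<lambda>m. plus_term A 1 m - \<kappa> * plus_term A 0 m) sums (U 1 - \<kappa> * U 0)"
      unfolding U_def by (intro sums_diff sums_mult summable_sums sm)
    moreover have "plus_term A 1 m - \<kappa> * plus_term A 0 m = (q ^ m) powi A * normalized_coeff i 1 m" for m
      by (simp add: plus_term_def normalized_coeff_def Let_def p_fun_def p1 algebra_simps)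
    ultimately show ?thesis by (simp add: sums_iff)
  qed
  have S2: "(\<Sum>m. (q ^ m) powi A * normalized_coeff i 2 m) = U 2 - 2 * \<kappa> * U 1 + (\<kappa>\<^sup>2 - t) * U 0"
  proof -
    have "(\<lambda>m. plus_term A 2 m - 2 * \<kappa> * plus_term A 1 m + (\<kappa>\<^sup>2 - t) * plus_term A 0 m) sums (U 2 - 2 * \<kappa> * U 1 + (\<kappa>\<^sup>2 - t) * U 0)"
      unfolding U_def by (intro sums_diff sums_add sums_mult summable_sums sm)
    moreover have "plus_term A 2 m - 2 * \<kappa> * plus_term A 1 m + (\<kappa>\<^sup>2 - t) * plus_term A 0 m = (q ^ m) powi A * normalized_coeff i 2 m" for m
      by (simp add: plus_term_def normalized_coeff_def Let_def p_fun_def p2 p1 power2_eq_square algebra_simps)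
    ultimately show ?thesis by (simp add: sums_iff)
  qed
  have S0: "(\<Sum>m. (q ^ m) powi A * normalized_coeff i 0 m) = U 0"
    by (simp add: U_def plus_term_def normalized_coeff_def Let_def p_fun_def)
  have S4: "(\<Sum>m. (q ^ m) powi A * normalized_coeff i 4 m) = U 4"
    by (simp add: U_def plus_term_def normalized_coeff_def Let_def)
  have S3: "(\<Sum>m. (q ^ m) powi A * normalized_coeff i 3 m) = inverse (q / (1 - q)) * U 3"
  proof -
    have "(\<lambda>m. inverse (q / (1 - q)) * plus_term A 3 m) sums (inverse (q / (1 - q)) * U 3)"
      unfolding U_def by (intro sums_mult summable_sums sm)
    moreover have "inverse (q / (1 - q)) * plus_term A 3 m = (q ^ m) powi A * normalized_coeff i 3 m" for m
      by (simp add: plus_term_def normalized_coeff_def Let_def)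
    ultimately show ?thesis by (simp add: sums_iff)
  qed
  have S5: "(\<Sum>m. (q ^ m) powi A * normalized_coeff i 5 m) = inverse (q / (1 - q)) * U 5"
  proof -
    have "(\<lambda>m. inverse (q / (1 - q)) * plus_term A 5 m) sums (inverse (q / (1 - q)) * U 5)"
      unfolding U_def by (intro sums_mult summable_sums sm)
    moreover have "inverse (q / (1 - q)) * plus_term A 5 m = (q ^ m) powi A * normalized_coeff i 5 m" for m
      by (simp add: plus_term_def normalized_coeff_def Let_def)
    ultimately show ?thesis by (simp add: sums_iff)
  qed
  have F: "plus_factor l 0 = (-1) powi l" "plus_factor l 1 = (-1) powi l" "plus_factor l 2 = (-1) powi l" "plus_factor l 4 = 1"
    by (simp_all add: plus_factor_def)
  have B: "base_point 0 = 1" "base_point 1 = 1" "base_point 2 = 1" by (simp_all add: base_point_def)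
  note sg = minus_one_powi_cancel[of l]
  have "\<forall>j<6. (\<Sum>k<6. H_plus A k \<tau> * normalizer l $$ (k, j)) = (- base_point j) ^ i * (\<Sum>m. (q ^ m) powi A * normalized_coeff i j m)"
    unfolding forall_less_6
  proof (intro conjI)
    note N = normalizer_def Let_def \<kappa>_def[symmetric]
    show "(\<Sum>k<6. H_plus A k \<tau> * normalizer l $$ (k, 0)) = (- base_point 0) ^ i * (\<Sum>m. (q ^ m) powi A * normalized_coeff i 0 m)"
      unfolding S0 sum_less_6 by (simp add: N H F B sg mult_ac)
    show "(\<Sum>k<6. H_plus A k \<tau> * normalizer l $$ (k, 1)) = (- base_point 1) ^ i * (\<Sum>m. (q ^ m) powi A * normalized_coeff i 1 m)"
      unfolding S1 sum_less_6 by (simp add: N H F B sg algebra_simps del: One_nat_def)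
    show "(\<Sum>k<6. H_plus A k \<tau> * normalizer l $$ (k, 2)) = (- base_point 2) ^ i * (\<Sum>m. (q ^ m) powi A * normalized_coeff i 2 m)"
      unfolding S2 sum_less_6 t_def by (simp add: N H F B sg algebra_simps del: One_nat_def)
    show "(\<Sum>k<6. H_plus A k \<tau> * normalizer l $$ (k, 3)) = (- base_point 3) ^ i * (\<Sum>m. (q ^ m) powi A * normalized_coeff i 3 m)"
      unfolding S3 sum_less_6 using plus_factor_nz[of l 3] by (simp add: N H)
    show "(\<Sum>k<6. H_plus A k \<tau> * normalizer l $$ (k, 4)) = (- base_point 4) ^ i * (\<Sum>m. (q ^ m) powi A * normalized_coeff i 4 m)"
      unfolding S4 sum_less_6 by (simp add: N H F)
    show "(\<Sum>k<6. H_plus A k \<tau> * normalizer l $$ (k, 5)) = (- base_point 5) ^ i * (\<Sum>m. (q ^ m) powi A * normalized_coeff i 5 m)"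
      unfolding S5 sum_less_6 using plus_factor_nz[of l 5] by (simp add: N H)
  qed
  then show ?thesis unfolding e using j unfolding A_def by blast
qed

text \<open>
  The normalized determinant does not change when $\lambda$ is increased by 1 and tends to the determinant
  of the confluent Vandermonde matrix, so it equals that determinant for every $\lambda$.
\<close>

lemma det_W_disc: "Determinant.det (W_mat l \<tau>) = 32 * qpow \<tau> (of_int l + 11/4)"
proof -
  define D where "D l = Determinant.det (W_mat l \<tau> * normalizer l)" for l
  have carr: "normalizer l \<in> carrier_mat 6 6" for l by (simp add: normalizer_def Let_def)
  have D: "D l = Determinant.det (W_mat l \<tau>) * Determinant.det (normalizer l)" for l
    unfolding D_def by (rule det_mult[OF W_mat_carrier carr])
  have N: "Determinant.det (normalizer l) = (1 - q) ^ 4 / (q\<^sup>2 * (qpow \<tau> (1/4) * q powi l))" for l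
  proof -
    have *: "\<sigma> ^ 3 * (inverse (a / b))\<^sup>2 * inverse (\<sigma> * P / b\<^sup>2) = b ^ 4 / (a\<^sup>2 * P)"
      if "\<sigma> * \<sigma> = 1" for \<sigma> a b P :: complex
    proof -
      have "\<sigma> \<noteq> 0" "\<sigma> ^ 3 = \<sigma>" using that by (auto simp: power3_eq_cube)
      then have "\<sigma> ^ 3 * inverse (\<sigma> * P / b\<^sup>2) = b\<^sup>2 / P" by simp
      moreover have "(inverse (a / b))\<^sup>2 = b\<^sup>2 / a\<^sup>2" by (simp add: power_divide)
      ultimately have "\<sigma> ^ 3 * (inverse (a / b))\<^sup>2 * inverse (\<sigma> * P / b\<^sup>2) = (b\<^sup>2 / P) * (b\<^sup>2 / a\<^sup>2)"
        by (metis mult.assoc mult.commute)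
      then show ?thesis by (simp add: power4_eq_xxxx power2_eq_square mult_ac)
    qed
    show ?thesis
      unfolding det_normalizer plus_factor_product by (rule *[OF minus_one_powi_sq])
  qed
  have "D (l + 1) = D l" for l
    unfolding D N det_W_shift using q_nz by (simp add: power_int_add)
  then have Dn: "D (l + int n) = D l" for n
  proof (induction n)
    case (Suc n)
    then show ?case using Suc.prems[of "l + int n"] by (simp add: add_ac)
  qed simp
  have lim: "(\<lambda>n. D (l + int n)) \<longlonglongrightarrow> Determinant.det (confluent_vandermonde s)"
    unfolding D_def
  proof (rule tendsto_det[where k = 6])
    fix i j :: nat assume ij: "i < 6" "j < 6"
    have "(\<lambda>n. (- base_point j) ^ i * (\<Sum>m. (q ^ m) powi (l + int i + int n) * normalized_coeff i j m))
        \<longlonglongrightarrow> (- base_point j) ^ i * normalized_coeff i j 0"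
      by (intro tendsto_mult tendsto_const gaussian_limit gaussian_normalized_coeff ij)
    then show "(\<lambda>n. (W_mat (l + int n) \<tau> * normalizer (l + int n)) $$ (i, j)) \<longlonglongrightarrow> confluent_vandermonde s $$ (i, j)"
      unfolding normalized_coeff_0[OF ij] normalized_entry[OF ij] by (simp add: add_ac)
  qed (use carr in \<open>auto simp: confluent_vandermonde_def intro!: mult_carrier_mat[of _ 6 6]\<close>)
  have "D l = Determinant.det (confluent_vandermonde s)"
    using lim unfolding Dn by (rule LIMSEQ_unique[OF tendsto_const])
  then have "D l = 32 * s * (1 - q) ^ 4"
    unfolding det_confluent_vandermonde q_eq .
  moreover have "1 - q \<noteq> 0" using norm_q by auto
  ultimately have "Determinant.det (W_mat l \<tau>) = 32 * (s * q\<^sup>2 * qpow \<tau> (1/4) * q powi l)"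
    unfolding D N using q_nz by (simp add: field_simps)
  also have "s * q\<^sup>2 * qpow \<tau> (1/4) * q powi l = qpow \<tau> (of_int l + 11/4)"
  proof -
    have e: "of_int l + 11/4 = 1/2 + of_nat 2 + 1/4 + of_int l * (1 :: real)" by simp
    show ?thesis
      unfolding e qpow_add qpow_of_nat qpow_of_int_mult by (simp only: s_def qpow_1 q_def)
  qed
  finally show ?thesis .
qed

end

section \<open>Both sides of the unit circle\<close>

definition pairing_matrix :: "complex Matrix.mat" where
  "pairing_matrix = mat_of_rows_list 6
         [[0,   0, 1/2,  0,   0,  0],
          [0,   1,   0,  0,   0,  0],
          [1/2, 0,   0,  0,   0,  0],
          [0,   0,   0, -1,   0,  0],
          [0,   0,   0,  0, 1/4,  0],
          [0,   0,   0,  0,   0, -1]]"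

lemma pairing_matrix_eq: "pairing_matrix = Matrix.mat 6 6 (\<lambda>(i, j). [[0,   0, 1/2,  0,   0,  0],
          [0,   1,   0,  0,   0,  0],
          [1/2, 0,   0,  0,   0,  0],
          [0,   0,   0, -1,   0,  0],
          [0,   0,   0,  0, 1/4,  0],
          [0,   0,   0,  0,   0, -1]] ! i ! j)"
  unfolding pairing_matrix_def by (rule mat_of_rows_list_eq_mat) simp

lemma pairing_matrix_carrier [simp]: "pairing_matrix \<in> carrier_mat 6 6"
  by (simp add: pairing_matrix_eq)

lemma det_pairing_matrix: "Determinant.det pairing_matrix = - 1 / 16"
proof -
  let ?D = "Matrix.mat 6 6 (\<lambda>(i, j). if i = j then [1/2, 1, 1/2, -1, 1/4, -1 :: complex] ! i else 0)"
  have C: "pairing_matrix \<in> carrier_mat 6 6" by (simp add: pairing_matrix_eq)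
  have "mat_swapcols 0 2 pairing_matrix = ?D"
  proof (rule eq_mat_6)
    have "mat_swapcols 0 2 pairing_matrix $$ (i, j) = pairing_matrix $$ (i, if j = 0 then 2 else if j = 2 then 0 else j)"
      if "i < 6" "j < 6" for i j
      using that carrier_matD[OF C] by auto
    then show "\<forall>i<6. \<forall>j<6. mat_swapcols 0 2 pairing_matrix $$ (i, j) = ?D $$ (i, j)"
      by (simp add: forall_less_6 pairing_matrix_eq)
  qed (use C in simp_all)
  moreover have "Determinant.det (mat_swapcols 0 2 pairing_matrix) = - Determinant.det pairing_matrix"
    by (rule det_swapcols[of _ 6]) (use C in auto)
  moreover have "Determinant.det ?D = 1 / 16"
    by (subst det_upper_triangular_6) simp_all
  ultimately have "- Determinant.det pairing_matrix = 1 / 16" by (simp only:)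
  then have "Determinant.det pairing_matrix = - (1 / 16)" by (metis minus_minus)
  then show ?thesis by simp
qed

lemma pairing_entry:
  assumes A: "A \<in> carrier_mat 6 6" and B: "B \<in> carrier_mat 6 6" and ik: "i < 6" "k < 6"
  shows "(A * pairing_matrix * transpose_mat B) $$ (i, k) =
    1/2 * (A $$ (i, 0) * B $$ (k, 2)) + A $$ (i, 1) * B $$ (k, 1) + 1/2 * (A $$ (i, 2) * B $$ (k, 0))
    - A $$ (i, 3) * B $$ (k, 3) + 1/4 * (A $$ (i, 4) * B $$ (k, 4)) - A $$ (i, 5) * B $$ (k, 5)"
proof -
  have AC: "(A * pairing_matrix) $$ (i, j) = (\<Sum>m<6. A $$ (i, m) * pairing_matrix $$ (m, j))" if "j < 6" for j
    using A ik that by (auto simp: pairing_matrix_eq scalar_prod_def lessThan_atLeast0 intro!: sum.cong)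
  have "(A * pairing_matrix * transpose_mat B) $$ (i, k) = (\<Sum>j<6. (A * pairing_matrix) $$ (i, j) * B $$ (k, j))"
    using A B ik by (auto simp: pairing_matrix_eq scalar_prod_def lessThan_atLeast0 intro!: sum.cong)
  also have "\<dots> = (\<Sum>j<6. (\<Sum>m<6. A $$ (i, m) * pairing_matrix $$ (m, j)) * B $$ (k, j))"
    by (intro sum.cong refl) (simp add: AC)
  finally show ?thesis
    unfolding sum_less_6 by (simp add: pairing_matrix_eq)
qed

context unit_nome
begin

text \<open>
  The point $-\tau$ lies on the other side of the unit circle, where the second branch applies.
\<close>

lemma H_fun_minus: "H_fun l j (- \<tau>) = (-1) ^ H_delta j * H_minus (- l) j \<tau>"
proof -
  have "norm (nome (- \<tau>)) * norm (nome \<tau>) = 1"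
    unfolding nome_minus norm_mult[symmetric] by simp
  moreover have "norm (nome (- \<tau>)) * norm (nome \<tau>) < 1" if "norm (nome (- \<tau>)) < 1"
    using mult_strict_mono[of "norm (nome (- \<tau>))" 1 "norm (nome \<tau>)" 1] that norm_nome by simp
  ultimately show ?thesis by (auto simp: H_fun_def)
qed

lemma bilinear_form_entries:
  "\<forall>i<6. \<forall>k<6. bilinear_form (l + int i) (l + 5 - int k) = product_matrix (q powi (l + 2)) (q powi (l + 3)) $$ (i, k)"
proof -
  have "bilinear_form (l + int i) (l + 5 - int k) = (-1) powi (int i + int k - 5) * ((of_int (int i + int k - 5))\<^sup>2 - 1/2) / 2 + 1 / 4
    + (if i + k = 9 then 2 * q powi (l + 5 - int k + 2)
       else if i + k = 10 then - 4 * q powi (l + 5 - int k + 2) - 4 * q powi (l + 5 - int k + 3) else 0)"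
    if "i < 6" "k < 6" for i k
  proof -
    have "\<bar>int i + int k - 5\<bar> \<le> 5" using that by auto
    from bilinear_form_eq[OF this, of "l + 5 - int k"] show ?thesis
      by (simp add: algebra_simps)
  qed
  then show ?thesis
    by (simp add: forall_less_6 product_matrix_eq power_int_def[of "-1"] power2_eq_square) (simp add: add.commute)
qed

text \<open>
  The case $|q| > 1$: the row index now belongs to $H^-$ and the column index to $H^+$. The difference
  of the arguments is again $i + k - 5$.
\<close>

lemma bilinear_form_entries_reflected:
  "\<forall>i<6. \<forall>k<6. bilinear_form (- l - 5 + int k) (- l - int i) = product_matrix (q powi (- l - 2)) (q powi (- l - 3)) $$ (i, k)"
proof -
  have "bilinear_form (- l - 5 + int k) (- l - int i) = (-1) powi (int i + int k - 5) * ((of_int (int i + int k - 5))\<^sup>2 - 1/2) / 2 + 1 / 4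
    + (if i + k = 9 then 2 * q powi (- l - int i + 2)
       else if i + k = 10 then - 4 * q powi (- l - int i + 2) - 4 * q powi (- l - int i + 3) else 0)"
    if "i < 6" "k < 6" for i k
  proof -
    have "\<bar>int i + int k - 5\<bar> \<le> 5" using that by auto
    from bilinear_form_eq[OF this, of "- l - int i"] show ?thesis
      by (simp add: algebra_simps)
  qed
  moreover have "q powi (- 2 - l) = q powi (- l - 2)" "q powi (- 3 - l) = q powi (- l - 3)"
    by (rule arg_cong[of _ _ "(powi) q"], simp)+
  ultimately show ?thesis
    by (simp add: forall_less_6 product_matrix_eq power_int_def[of "-1"] power2_eq_square)
qed

lemma pairing_disc:
  "W_mat l \<tau> * pairing_matrix * transpose_mat (W_mat (- l - 5) (- \<tau>))
     = product_matrix (q powi (l + 2)) (q powi (l + 3))"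
proof (rule eq_mat_6)
  show "\<forall>i<6. \<forall>k<6. (W_mat l \<tau> * pairing_matrix * transpose_mat (W_mat (- l - 5) (- \<tau>))) $$ (i, k)
      = product_matrix (q powi (l + 2)) (q powi (l + 3)) $$ (i, k)"
  proof (intro allI impI)
    fix i k :: nat assume ik: "i < 6" "k < 6"
    have "(W_mat l \<tau> * pairing_matrix * transpose_mat (W_mat (- l - 5) (- \<tau>))) $$ (i, k) = bilinear_form (l + int i) (l + 5 - int k)"
      unfolding pairing_entry[OF W_mat_carrier W_mat_carrier ik] bilinear_form_def using ik
      by (simp add: W_mat_def H_fun_eq H_fun_minus H_delta_def algebra_simps)
    then show "(W_mat l \<tau> * pairing_matrix * transpose_mat (W_mat (- l - 5) (- \<tau>))) $$ (i, k)
      = product_matrix (q powi (l + 2)) (q powi (l + 3)) $$ (i, k)"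
      using bilinear_form_entries[of l] ik by simp
  qed
qed (simp_all add: mult_carrier_mat[of _ 6 6 _ 6])

lemma pairing_outside:
  "W_mat l (- \<tau>) * pairing_matrix * transpose_mat (W_mat (- l - 5) \<tau>)
     = product_matrix (q powi (- l - 2)) (q powi (- l - 3))"
proof (rule eq_mat_6)
  show "\<forall>i<6. \<forall>k<6. (W_mat l (- \<tau>) * pairing_matrix * transpose_mat (W_mat (- l - 5) \<tau>)) $$ (i, k)
      = product_matrix (q powi (- l - 2)) (q powi (- l - 3)) $$ (i, k)"
  proof (intro allI impI)
    fix i k :: nat assume ik: "i < 6" "k < 6"
    have "(W_mat l (- \<tau>) * pairing_matrix * transpose_mat (W_mat (- l - 5) \<tau>)) $$ (i, k) = bilinear_form (- l - 5 + int k) (- l - int i)"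
      unfolding pairing_entry[OF W_mat_carrier W_mat_carrier ik] bilinear_form_def using ik
      by (simp add: W_mat_def H_fun_eq H_fun_minus H_delta_def algebra_simps)
    then show "(W_mat l (- \<tau>) * pairing_matrix * transpose_mat (W_mat (- l - 5) \<tau>)) $$ (i, k)
      = product_matrix (q powi (- l - 2)) (q powi (- l - 3)) $$ (i, k)"
      using bilinear_form_entries_reflected[of l] ik by simp
  qed
qed (simp_all add: mult_carrier_mat[of _ 6 6 _ 6])

text \<open>
  Determinants of both sides of the product formula; the second matrix factor lies inside the disc, where
  its determinant is known.
\<close>

lemma det_W_outside: "Determinant.det (W_mat l (- \<tau>)) = 32 * qpow (- \<tau>) (of_int l + 11/4)"
proof -
  have "Determinant.det (W_mat l (- \<tau>) * pairing_matrix * transpose_mat (W_mat (- l - 5) \<tau>))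
      = Determinant.det (W_mat l (- \<tau>)) * Determinant.det pairing_matrix * Determinant.det (W_mat (- l - 5) \<tau>)"
  proof -
    have "Determinant.det (W_mat l (- \<tau>) * pairing_matrix * transpose_mat (W_mat (- l - 5) \<tau>))
        = Determinant.det (W_mat l (- \<tau>) * pairing_matrix) * Determinant.det (transpose_mat (W_mat (- l - 5) \<tau>))"
      by (rule det_mult[of _ 6]) (simp_all add: mult_carrier_mat[of _ 6 6 _ 6])
    also have "Determinant.det (W_mat l (- \<tau>) * pairing_matrix) = Determinant.det (W_mat l (- \<tau>)) * Determinant.det pairing_matrix"
      by (rule det_mult[of _ 6]) simp_all
    also have "Determinant.det (transpose_mat (W_mat (- l - 5) \<tau>)) = Determinant.det (W_mat (- l - 5) \<tau>)"
      by (rule Determinant.det_transpose[OF W_mat_carrier])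
    finally show ?thesis .
  qed
  then have "- 64 * q powi (- l - 2) * q powi (- l - 3)
      = Determinant.det (W_mat l (- \<tau>)) * (- 1 / 16) * (32 * qpow \<tau> (of_int (- l - 5) + 11/4))"
    unfolding pairing_outside det_product_matrix det_pairing_matrix det_W_disc .
  then have "Determinant.det (W_mat l (- \<tau>)) * qpow \<tau> (of_int (- l - 5) + 11/4) = 32 * (q powi (- l - 2) * q powi (- l - 3))"
    by simp
  also have "q powi (- l - 2) * q powi (- l - 3) = qpow \<tau> (of_int (- 2 * l - 5))"
    using qpow_of_int_mult[of \<tau> "- 2 * l - 5" 1] q_nz by (simp add: q_def flip: power_int_add)
  also have "of_int (- 2 * l - 5) = (of_int (- l - 5) + 11/4) + - (of_int l + 11/4 :: real)" by simp
  also have "qpow \<tau> \<dots> = qpow \<tau> (of_int (- l - 5) + 11/4) * qpow (- \<tau>) (of_int l + 11/4)"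
    unfolding qpow_add[of _ _ "- (of_int l + 11/4)"] qpow_minus qpow_minus_arg ..
  finally show ?thesis by simp
qed

end

theorem theorem3:
  fixes \<tau> q :: complex and l :: int
  assumes q_def: "q = nome \<tau>"
    and q_pos: "0 < cmod q"
    and q_ne: "cmod q \<noteq> 1"
  shows "Determinant.det (W_mat l \<tau>) = 32 * qpow \<tau> (of_int l + 11/4) \<and>
    W_mat l \<tau>
      * mat_of_rows_list 6
         [[0,   0, 1/2,  0,   0,  0],
          [0,   1,   0,  0,   0,  0],
          [1/2, 0,   0,  0,   0,  0],
          [0,   0,   0, -1,   0,  0],
          [0,   0,   0,  0, 1/4,  0],
          [0,   0,   0,  0,   0, -1]]
      * transpose_mat (W_mat (- l - 5) (- \<tau>))
    = mat_of_rows_list 6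
         [[-12,  8, -4,  2,  0,  0],
          [  8, -4,  2,  0,  0,  0],
          [ -4,  2,  0,  0,  0,  2],
          [  2,  0,  0,  0,  2, -4],
          [  0,  0,  0,  2, -4,  8 + 2 * q powi (l + 2)],
          [  0,  0,  2, -4,  8 + 2 * q powi (l + 3),
             -12 - 4 * q powi (l + 2) - 4 * q powi (l + 3)]]"
proof (cases "cmod q < 1")
  case True
  then have u: "unit_nome \<tau>" by unfold_locales (simp add: q_def)
  show ?thesis
    using unit_nome.det_W_disc[OF u, of l] unit_nome.pairing_disc[OF u, of l]
    unfolding unit_nome.q_def[OF u] pairing_matrix_def product_matrix_def q_def by (rule conjI)
next
  case False
  then have "cmod (nome (- \<tau>)) < 1"
    using q_ne by (simp add: q_def nome_minus norm_inverse inverse_less_1_iff)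
  then have u: "unit_nome (- \<tau>)" by unfold_locales
  have inv: "inverse (nome \<tau>) powi (- l - 2) = nome \<tau> powi (l + 2)"
    "inverse (nome \<tau>) powi (- l - 3) = nome \<tau> powi (l + 3)"
    using power_int_minus[of "inverse (nome \<tau>)" "l + 2"] power_int_minus[of "inverse (nome \<tau>)" "l + 3"]
    by (simp_all add: power_int_inverse)
  show ?thesis
    using unit_nome.det_W_outside[OF u, of l] unit_nome.pairing_outside[OF u, of l]
    unfolding unit_nome.q_def[OF u] nome_minus inv pairing_matrix_def product_matrix_def minus_minus q_def
    by (rule conjI)
qed

end
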